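(* Let $N\ge 1$, let $\phi\in C^1((0,+\infty);(0,+\infty))$ satisfy $(\phi(s)s)'>0$ and $l-1\le \frac{(\phi(s)s)'}{\phi(s)}\le m-1$ for all $s>0$, where $1<l\le m$ are real constants. Let $V\in C^1(\mathbb R^N;\mathbb R)$ be such that there exist two distinct points $a^-,a^+\in\mathbb R^N$ with $V(a^\pm)=0$ and $V(x)>0$ for all $x\in\mathbb R^N\setminus\{a^-,a^+\}$, and such that $\liminf_{|x|\to+\infty}V(x)>0$. Let $\bar r=\frac12|a^--a^+|$ and $c^*=\inf\{V(x): x\in\mathbb R^N\setminus(B_{\bar r}(a^-)\cup B_{\bar r}(a^+))\}$. Then for every $c\in[0,c^* )$ there exist $I=(\alpha,\omega)$ with $-\infty\le\alpha<\omega\le+\infty$ and a minimal $c$-connection $q:\bar I\to\mathbb R^N$ between $\mathcal V_c^-=\mathcal V_c\cap B_{\bar r}(a^-)$ and $\mathcal V_c^+=\mathcal V_c\cap B_{\bar r}(a^+)$, where $\mathcal V_c=\{x: V(x)\le c\}$. In particular $q\in C^2(I;\mathbb R^N)\cap C^1(\bar I;\mathbb R^N)$ and $q$ solves $(\phi(|\dot q|)\dot q)'=\nabla V(q)$ on $I$ with $E_q(t)=-c$ for all $t\in I$.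
   Context: Set $\Phi(s)=\int_0^{|s|}\phi(r)r\,dr$ and $G(s)=\phi(s)s^2-\Phi(s)$ for $s>0$, $G(0)=0$; $\phi(|v|)v$ is read as $0$ when $v=0$. $\operatorname{dist}$ is Euclidean distance; $B_r(x)$ is the open ball. The energy is $E_q(t)=G(|\dot q(t)|)-V(q(t))$. For an interval $I$, $L^\Phi(I;\mathbb R^N)$ is the set of $q\in L^1_{loc}(I;\mathbb R^N)$ with $\int_I\Phi(|q|/\lambda)\,dt<\infty$ for some $\lambda>0$; $W^{1,\Phi}(I;\mathbb R^N)$ is the set of $q\in L^\Phi$ with weak derivative in $L^\Phi$; $W^{1,\Phi}_{loc}(\mathbb R;\mathbb R^N)$ consists of functions whose restriction to every compact interval $I$ lies in $W^{1,\Phi}(I;\mathbb R^N)$ (identified with continuous representatives). $J_{c,I}(q)=\int_I(\Phi(|\dot q|)+V(q)-c)\,dt$, $J_c=J_{c,\mathbb R}$; $\Gamma_c$ is the set of $q\in W^{1,\Phi}_{loc}(\mathbb R;\mathbb R^N)$ with $V(q(t))\ge c$ for all $t$ and $\liminf_{t\to-\infty}\operatorname{dist}(q(t),\mathcal V_c^-)=\liminf_{t\to+\infty}\operatorname{dist}(q(t),\mathcal V_c^+)=0$; $m_c=\inf_{\Gamma_c}J_c$. Let $I=(\alpha,\omega)$, $-\infty\le\alpha<\omega\le+\infty$, with closure $\bar I$ in $\mathbb R$. A function $q:\bar I\to\mathbb R^N$ is a minimal $c$-connection between $\mathcal V_c^-$ and $\mathcal V_c^+$ if $q\in L^\infty(I;\mathbb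 R^N)$ and: (i) $q\in C^1(\bar I;\mathbb R^N)\cap C^2(I;\mathbb R^N)$ and $(\phi(|\dot q|)\dot q)'=\nabla V(q)$ on $I$; (ii) $V(q(t))>c$ and $E_q(t)=-c$ for all $t\in I$; (iii) $\lim_{t\to\alpha^+}\operatorname{dist}(q(t),\mathcal V_c^-)=\lim_{t\to\omega^-}\operatorname{dist}(q(t),\mathcal V_c^+)=0$; (iv) $J_{c,I}(q)=m_c$. *)

theory Defs
  imports "HOL-Analysis.Analysis"
begin

definition Phi :: "(real \<Rightarrow> real) \<Rightarrow> real \<Rightarrow> real" where
  "Phi \<phi> s = integral {0..\<bar>s\<bar>} (\<lambda>r. \<phi> r * r)"

definition G_fun :: "(real \<Rightarrow> real) \<Rightarrow> real \<Rightarrow> real" where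
  "G_fun \<phi> s = (if s = 0 then 0 else \<phi> s * s\<^sup>2 - Phi \<phi> s)"

definition gradient :: "('a::real_inner \<Rightarrow> real) \<Rightarrow> 'a \<Rightarrow> 'a" where
  "gradient V x = (THE D. GDERIV V x :> D)"

definition C1_scalar_field :: "('a::real_inner \<Rightarrow> real) \<Rightarrow> bool" where
  "C1_scalar_field V \<longleftrightarrow> (\<forall>x. GDERIV V x :> gradient V x) \<and> continuous_on UNIV (gradient V)"

text \<open>Curves on an interval \<open>S\<close> that may contain its endpoints: the derivative there is one-sided.
  (The library's \<open>C1_differentiable_on\<close> uses two-sided derivatives and is suited to open sets.)\<close>

definition C1_curve_on :: "real set \<Rightarrow> (real \<Rightarrow> 'a::real_normed_vector) \<Rightarrow> bool" where
  "C1_curve_on S q \<longleftrightarrow> (\<forall>t\<in>S. q differentiable (at t within S)) \<and>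
     continuous_on S (\<lambda>t. vector_derivative q (at t within S))"

definition C2_curve_on :: "real set \<Rightarrow> (real \<Rightarrow> 'a::real_normed_vector) \<Rightarrow> bool" where
  "C2_curve_on I q \<longleftrightarrow> q C1_differentiable_on I \<and>
     (\<lambda>t. vector_derivative q (at t)) C1_differentiable_on I"

definition energy ::
  "(real \<Rightarrow> real) \<Rightarrow> ('a::real_normed_vector \<Rightarrow> real) \<Rightarrow> (real \<Rightarrow> 'a) \<Rightarrow> real \<Rightarrow> real" where
  "energy \<phi> V q t = G_fun \<phi> (norm (vector_derivative q (at t))) - V (q t)"

text \<open>At points where the velocity vanishes, \<open>\<phi> 0 *\<^sub>R 0 = 0\<close>, whatever the value \<open>\<phi> 0\<close> is.\<close>

definition solves_EL ::
  "(real \<Rightarrow> real) \<Rightarrow> ('a::real_inner \<Rightarrow> real) \<Rightarrow> real set \<Rightarrow> (real \<Rightarrow> 'a) \<Rightarrow> bool" where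
  "solves_EL \<phi> V I q \<longleftrightarrow>
     (\<forall>t\<in>I. ((\<lambda>s. \<phi> (norm (vector_derivative q (at s))) *\<^sub>R vector_derivative q (at s))
        has_vector_derivative gradient V (q t)) (at t))"

definition L1_loc :: "real set \<Rightarrow> (real \<Rightarrow> 'a::euclidean_space) set" where
  "L1_loc I = {q. \<forall>K. compact K \<and> K \<subseteq> I \<longrightarrow> q absolutely_integrable_on K}"

definition L_infinity :: "real set \<Rightarrow> (real \<Rightarrow> 'a::euclidean_space) set" where
  "L_infinity I = {q. q \<in> borel_measurable (lebesgue_on I) \<and>
     (\<exists>C. AE t in lebesgue_on I. norm (q t) \<le> C)}"

definition L_Phi :: "(real \<Rightarrow> real) \<Rightarrow> real set \<Rightarrow> (real \<Rightarrow> 'a::euclidean_space) set" where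
  "L_Phi \<phi> I = {q \<in> L1_loc I.
     \<exists>k>0. (\<integral>\<^sup>+t\<in>I. ennreal (Phi \<phi> (norm (q t) / k)) \<partial>lebesgue) < \<infinity>}"

definition test_functions :: "real set \<Rightarrow> (real \<Rightarrow> real) set" where
  "test_functions I = {\<psi>. (\<forall>k t. ((deriv ^^ k) \<psi>) field_differentiable (at t)) \<and>
     (\<exists>K. compact K \<and> K \<subseteq> interior I \<and> (\<forall>t. t \<notin> K \<longrightarrow> \<psi> t = 0))}"

definition is_weak_deriv ::
  "real set \<Rightarrow> (real \<Rightarrow> 'a::euclidean_space) \<Rightarrow> (real \<Rightarrow> 'a) \<Rightarrow> bool" where
  "is_weak_deriv I q g \<longleftrightarrow> q \<in> L1_loc I \<and> g \<in> L1_loc I \<and>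
     (\<forall>\<psi>\<in>test_functions I.
        (LINT t:I|lebesgue. deriv \<psi> t *\<^sub>R q t) = - (LINT t:I|lebesgue. \<psi> t *\<^sub>R g t))"

text \<open>A representative of the weak derivative, which is unique up to null sets.\<close>

definition weak_deriv :: "real set \<Rightarrow> (real \<Rightarrow> 'a::euclidean_space) \<Rightarrow> real \<Rightarrow> 'a" where
  "weak_deriv I q = (SOME g. is_weak_deriv I q g)"

definition W1_Phi :: "(real \<Rightarrow> real) \<Rightarrow> real set \<Rightarrow> (real \<Rightarrow> 'a::euclidean_space) set" where
  "W1_Phi \<phi> I = {q \<in> L_Phi \<phi> I. \<exists>g\<in>L_Phi \<phi> I. is_weak_deriv I q g}"

text \<open>Sobolev classes are identified with their continuous representatives.\<close>

definition W1_Phi_loc :: "(real \<Rightarrow> real) \<Rightarrow> (real \<Rightarrow> 'a::euclidean_space) set" where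
  "W1_Phi_loc \<phi> = {q. continuous_on UNIV q \<and> (\<forall>a b. a < b \<longrightarrow> q \<in> W1_Phi \<phi> {a..b})}"

text \<open>The integral is taken in \<open>[0, \<infinity>]\<close>: the functional is only used for curves with
  \<open>V (q t) \<ge> c\<close> on \<open>I\<close>, for which the integrand is nonnegative.\<close>

definition J_fun ::
  "(real \<Rightarrow> real) \<Rightarrow> ('a::euclidean_space \<Rightarrow> real) \<Rightarrow> real \<Rightarrow> real set \<Rightarrow> (real \<Rightarrow> 'a) \<Rightarrow> ennreal" where
  "J_fun \<phi> V c I q =
     (\<integral>\<^sup>+t\<in>I. ennreal (Phi \<phi> (norm (weak_deriv I q t)) + V (q t) - c) \<partial>lebesgue)"

text \<open>In the next three definitions \<open>A\<close> and \<open>B\<close> are the sets to be connected, playing the roles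
  of \<open>\<V>\<^sub>c\<^sup>-\<close> and \<open>\<V>\<^sub>c\<^sup>+\<close>.\<close>

definition Gamma_class ::
  "(real \<Rightarrow> real) \<Rightarrow> ('a::euclidean_space \<Rightarrow> real) \<Rightarrow> real \<Rightarrow> 'a set \<Rightarrow> 'a set \<Rightarrow> (real \<Rightarrow> 'a) set" where
  "Gamma_class \<phi> V c A B = {q \<in> W1_Phi_loc \<phi>. (\<forall>t. V (q t) \<ge> c) \<and>
     Liminf at_bot (\<lambda>t. ereal (infdist (q t) A)) = 0 \<and>
     Liminf at_top (\<lambda>t. ereal (infdist (q t) B)) = 0}"

definition m_val ::
  "(real \<Rightarrow> real) \<Rightarrow> ('a::euclidean_space \<Rightarrow> real) \<Rightarrow> real \<Rightarrow> 'a set \<Rightarrow> 'a set \<Rightarrow> ennreal" where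
  "m_val \<phi> V c A B = (INF q\<in>Gamma_class \<phi> V c A B. J_fun \<phi> V c UNIV q)"

text \<open>The interval is \<open>I = einterval \<alpha> \<omega>\<close>; only the values of \<open>q\<close> on \<open>closure I\<close> matter.
  The limits at the endpoints are taken along filters on \<^typ>\<open>ereal\<close>, as in the library's
  interval integrals, so that infinite endpoints are covered.\<close>

definition minimal_connection ::
  "(real \<Rightarrow> real) \<Rightarrow> ('a::euclidean_space \<Rightarrow> real) \<Rightarrow> real \<Rightarrow> 'a set \<Rightarrow> 'a set \<Rightarrow>
     ereal \<Rightarrow> ereal \<Rightarrow> (real \<Rightarrow> 'a) \<Rightarrow> bool" where
  "minimal_connection \<phi> V c A B \<alpha> \<omega> q \<longleftrightarrow>
     (let I = einterval \<alpha> \<omega> in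
        q \<in> L_infinity I \<and>
        C1_curve_on (closure I) q \<and> C2_curve_on I q \<and> solves_EL \<phi> V I q \<and>
        (\<forall>t\<in>I. V (q t) > c \<and> energy \<phi> V q t = - c) \<and>
        ((\<lambda>t. infdist (q (real_of_ereal t)) A) \<longlongrightarrow> 0) (at_right \<alpha>) \<and>
        ((\<lambda>t. infdist (q (real_of_ereal t)) B) \<longlongrightarrow> 0) (at_left \<omega>) \<and>
        J_fun \<phi> V c I q = m_val \<phi> V c A B)"

end

theory Submission
  imports Defs
begin

text \<open>
  The proof is Maupertuis' principle with a degenerate Jacobi metric, and avoids weak compactness.
  Write \<open>p s = \<phi> s * s\<close> and \<open>G s = s * p s - Phi \<phi> s\<close>, an increasing bijection of the half-line with
  inverse \<open>sp\<close>, and \<open>Kw = p \<circ> sp\<close>. Young's inequality \<open>Phi \<phi> v + w \<ge> Kw w * v\<close>, with equality iff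
  \<open>v = sp w\<close>, bounds the action \<open>J\<^sub>c\<close> of a curve from below by its length for the metric
  \<open>F x * norm dx\<close>, where \<open>F x = Kw (max 0 (V x - c))\<close>, with equality iff the energy is \<open>- c\<close>.
  So \<open>m\<^sub>c\<close> is the \<open>F\<close>-distance \<open>D\<close> of the two wells. It is realised by a geodesic \<open>\<gamma>\<close> parametrised by
  \<open>F\<close>-distance, which stays in \<open>{x. V x > c}\<close> in between.

  Displacing a subarc of \<open>\<gamma>\<close> by a small vector and comparing distances shows that the momentum
  \<open>F\<^sup>2 * \<gamma>'\<close> exists, is \<open>C\<^sup>1\<close> and has derivative \<open>grad F / F\<close>. Reparametrising by
  \<open>\<sigma>' = Kw w * sp w\<close>, where \<open>w = V (\<gamma> \<sigma>) - c\<close>, gives speed \<open>sp w\<close>, hence energy \<open>- c\<close>, and since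
  \<open>Kw' = 1 / sp\<close> the equation for the momentum becomes the Euler-Lagrange equation. As \<open>sp 0 = 0\<close>,
  the curve reaches the wells with zero speed and can be continued by resting there, which
  makes it a competitor for \<open>m\<^sub>c\<close>.
\<close>

section \<open>The distance of a degenerate conformal metric\<close>

text \<open>The gradient of \<open>V\<close> is merely continuous, so the geodesic equation has no
  uniqueness theory to draw on, and \<open>Kw' = 1 / sp\<close> blows up at 0, so \<open>F\<close>
  is not controlled to first order at the wells. Regularity is therefore extracted from minimality,
  by comparing distances to first order, and only where \<open>V > c\<close>. The factor in the time
  change has a simple origin: a curve parametrised by \<open>F\<close>-distance has speed
  \<open>1 / F\<close>, and \<open>F * sp\<close> is what turns this into the speed
  \<open>sp\<close> of energy \<open>- c\<close>. Then \<open>\<phi> (norm q') * q'\<close> is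
  exactly the momentum, and since the speed is positive between the wells, the velocity is a C1
  function of momentum and position; this gives C2. The bound \<open>l > 1\<close> enters twice: it
  makes \<open>p\<close> tend to 0 at 0 and \<open>G\<close> tend to infinity, so that
  \<open>sp\<close> is continuous on the whole closed half-line. The condition
  \<open>c < cstar\<close> splits the sublevel set into two compact wells with a shell of positive
  cost between them, hence \<open>D > 0\<close>, and keeps \<open>F\<close> away from 0 far out.
  Whether a well is reached in finite time depends on the data; both cases are treated alike by an
  interval with extended real ends.\<close>

text \<open>A straight step may be charged with any bound \<open>M\<close> of \<open>F\<close> along it, so that costs are only upper
  bounds of the length. The infimum over all chains is not affected, and a lower bound for one step
  needs the value of \<open>F\<close> at a single point of the segment.\<close>

inductive chain_cost :: "('a::real_normed_vector \<Rightarrow> real) \<Rightarrow> 'a \<Rightarrow> 'a \<Rightarrow> real \<Rightarrow> bool"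
  for F :: "'a::real_normed_vector \<Rightarrow> real" and x :: 'a where
  chain_refl: "chain_cost F x x 0"
| chain_step: "chain_cost F x y C \<Longrightarrow> \<forall>w\<in>closed_segment y z. F w \<le> M \<Longrightarrow>
    chain_cost F x z (C + M * norm (z - y))"

definition jdist :: "('a::real_normed_vector \<Rightarrow> real) \<Rightarrow> 'a \<Rightarrow> 'a \<Rightarrow> real" where
  "jdist F x y = Inf {C. chain_cost F x y C}"

lemma chain_seg:
  assumes "\<forall>w\<in>closed_segment x y. F w \<le> M"
  shows "chain_cost F x y (M * norm (y - x))"
  using chain_step[OF chain_refl assms] by simp

lemma chain_trans:
  assumes "chain_cost F y z C'" "chain_cost F x y C"
  shows "chain_cost F x z (C + C')"
  using assms
proof (induction rule: chain_cost.induct)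
  case chain_refl
  then show ?case by simp
next
  case (chain_step z' C' z M)
  then show ?case using chain_cost.chain_step[of F x z' "C + C'" z M] by (simp add: add.assoc)
qed

lemma chain_sym:
  assumes "chain_cost F x y C"
  shows "chain_cost F y x C"
  using assms
proof (induction rule: chain_cost.induct)
  case chain_refl
  then show ?case by (rule chain_cost.chain_refl)
next
  case (chain_step y C z M)
  have "chain_cost F z y (M * norm (y - z))"
    using chain_step.hyps by (intro chain_seg) (simp add: closed_segment_commute)
  from chain_trans[OF chain_step.IH this] show ?case by (simp add: norm_minus_commute add.commute)
qed

locale conformal_metric =
  fixes F :: "'a::euclidean_space \<Rightarrow> real"
  assumes cont_F: "continuous_on UNIV F" and F_nonneg: "0 \<le> F x"
begin

lemma F_bound: "\<exists>B\<ge>0. \<forall>x\<in>cball z r. F x \<le> B"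
proof -
  have "compact (F ` cball z r)"
    by (intro compact_continuous_image continuous_on_subset[OF cont_F]) auto
  then obtain B where "\<forall>v\<in>F ` cball z r. v \<le> B"
    using bounded_imp_bdd_above[OF compact_imp_bounded] by (metis bdd_above_def)
  then show ?thesis by (intro exI[of _ "max 0 B"]) (auto simp: le_max_iff_disj)
qed

lemma chain_nonneg: "chain_cost F x y C \<Longrightarrow> 0 \<le> C"
proof (induction rule: chain_cost.induct)
  case (chain_step y C z M)
  then have "0 \<le> M" using F_nonneg[of z] by (meson ends_in_segment(2) order_trans)
  then show ?case using chain_step by simp
qed simp

lemma chain_exists: "\<exists>C. chain_cost F x y C"
proof -
  obtain B where "\<forall>w\<in>cball x (norm (y - x)). F w \<le> B" using F_bound by blast
  moreover have "closed_segment x y \<subseteq> cball x (norm (y - x))"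
    by (rule closed_segment_subset) (auto simp: dist_norm norm_minus_commute)
  ultimately show ?thesis using chain_seg by blast
qed

lemma chain_bdd: "bdd_below {C. chain_cost F x y C}"
  using chain_nonneg by (auto simp: bdd_below_def)

lemma jdist_le: "chain_cost F x y C \<Longrightarrow> jdist F x y \<le> C"
  unfolding jdist_def by (intro cInf_lower chain_bdd) simp

lemma jdist_ge: "(\<And>C. chain_cost F x y C \<Longrightarrow> k \<le> C) \<Longrightarrow> k \<le> jdist F x y"
  unfolding jdist_def using chain_exists by (intro cInf_greatest) auto

lemma jdist_approx: "e > 0 \<Longrightarrow> \<exists>C. chain_cost F x y C \<and> C < jdist F x y + e"
proof (rule ccontr)
  assume e: "e > 0" and "\<nexists>C. chain_cost F x y C \<and> C < jdist F x y + e"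
  then have "jdist F x y + e \<le> jdist F x y" by (intro jdist_ge) force
  then show False using e by simp
qed

lemma jdist_nonneg: "0 \<le> jdist F x y"
  using chain_nonneg by (rule jdist_ge)

lemma jdist_refl [simp]: "jdist F x x = 0"
  using jdist_le[OF chain_refl] jdist_nonneg[of x x] by (simp add: antisym)

lemma jdist_sym: "jdist F x y = jdist F y x"
proof -
  have "chain_cost F x y = chain_cost F y x" using chain_sym by blast
  then show ?thesis unfolding jdist_def by simp
qed

lemma jdist_triangle: "jdist F x z \<le> jdist F x y + jdist F y z"
proof (rule field_le_epsilon)
  fix e :: real assume "e > 0"
  then obtain C C' where "chain_cost F x y C" "C < jdist F x y + e/2"
    "chain_cost F y z C'" "C' < jdist F y z + e/2" using jdist_approx half_gt_zero by metis
  then show "jdist F x z \<le> jdist F x y + jdist F y z + e"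
    using jdist_le[OF chain_trans] by fastforce
qed

lemma jdist_seg: "(\<And>w. w \<in> closed_segment x y \<Longrightarrow> F w \<le> M) \<Longrightarrow> jdist F x y \<le> M * norm (y - x)"
  by (intro jdist_le chain_seg) auto

lemma jdist_cball:
  assumes "\<And>w. w \<in> cball z r \<Longrightarrow> F w \<le> M" "x \<in> cball z r" "y \<in> cball z r"
  shows "jdist F x y \<le> M * norm (y - x)"
proof (rule jdist_seg)
  fix w assume "w \<in> closed_segment x y"
  then have "w \<in> cball z r" using assms(2,3) closed_segment_subset[of x "cball z r" y] by auto
  then show "F w \<le> M" by (rule assms(1))
qed

text \<open>The distance to \<open>a\<close>, clipped to \<open>[r1, r2]\<close>, changes by at most
  the length of a step. It does not change at all along a step that misses the shell, and a step
  that meets the shell carries a bound \<open>M\<close> of at least \<open>f\<close>.\<close>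

lemma chain_shell:
  assumes "\<And>w. r1 \<le> dist a w \<Longrightarrow> dist a w \<le> r2 \<Longrightarrow> f \<le> F w" "0 \<le> f" "r1 \<le> r2"
    "chain_cost F x y C"
  shows "f * \<bar>max r1 (min r2 (dist a x)) - max r1 (min r2 (dist a y))\<bar> \<le> C"
  using assms(4)
proof (induction rule: chain_cost.induct)
  case (chain_step y C z M)
  define u where "u y = max r1 (min r2 (dist a y))" for y
  have u: "\<bar>u y - u z\<bar> \<le> norm (z - y)"
  proof -
    have "\<bar>u y - u z\<bar> \<le> \<bar>dist a y - dist a z\<bar>" unfolding u_def by linarith
    also have "\<dots> \<le> dist y z" by (simp add: abs_le_iff) (metis dist_triangle dist_commute diff_le_eq add.commute)
    finally show ?thesis by (simp add: dist_norm norm_minus_commute)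
  qed
  have M: "0 \<le> M" using chain_step.hyps F_nonneg[of z] by (meson ends_in_segment(2) order_trans)
  have "f * \<bar>u y - u z\<bar> \<le> M * norm (z - y)"
  proof (cases "\<exists>w\<in>closed_segment y z. r1 \<le> dist a w \<and> dist a w \<le> r2")
    case True
    then have "f \<le> M" using assms(1) chain_step.hyps by (meson order_trans)
    then show ?thesis using u assms(2) M by (intro mult_mono) auto
  next
    case False
    define T where "T = dist a ` closed_segment y z"
    have "connected T" unfolding T_def
      by (intro connected_continuous_image continuous_intros) auto
    then have c: "\<And>s t v. s \<in> T \<Longrightarrow> t \<in> T \<Longrightarrow> s \<le> v \<Longrightarrow> v \<le> t \<Longrightarrow> v \<in> T"
      by (metis connected_iff_interval)
    have "dist a y \<in> T" "dist a z \<in> T" and F: "\<And>v. v \<in> T \<Longrightarrow> r1 \<le> v \<Longrightarrow> v \<le> r2 \<Longrightarrow> False"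
      using False unfolding T_def by auto
    then have "u y = u z" unfolding u_def
      using c[of "dist a y" "dist a z" r1] c[of "dist a z" "dist a y" r1] assms(3)
      by (smt (verit, best))
    then show ?thesis using M by simp
  qed
  moreover have "f * \<bar>u x - u z\<bar> \<le> f * \<bar>u x - u y\<bar> + f * \<bar>u y - u z\<bar>"
    using mult_left_mono[OF _ assms(2), of "\<bar>u x - u z\<bar>" "\<bar>u x - u y\<bar> + \<bar>u y - u z\<bar>"] 
    by (simp add: distrib_left)
  ultimately show ?case using chain_step.IH unfolding u_def by linarith
qed simp

lemma jdist_shell:
  assumes "\<And>w. r1 \<le> dist a w \<Longrightarrow> dist a w \<le> r2 \<Longrightarrow> f \<le> F w" "0 \<le> f" "r1 \<le> r2"
  shows "f * \<bar>max r1 (min r2 (dist a x)) - max r1 (min r2 (dist a y))\<bar> \<le> jdist F x y"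
  using chain_shell[OF assms] by (intro jdist_ge)

text \<open>The minimum with \<open>r\<close> is the price of leaving the ball: a path to a farther
  point still has to cross it.\<close>

lemma jdist_lower:
  assumes "\<And>w. w \<in> cball a r \<Longrightarrow> f \<le> F w" "0 \<le> f" "0 \<le> r"
  shows "f * min r (dist a y) \<le> jdist F a y"
  using jdist_shell[of 0 a r f a y] assms by auto

lemma jdist_pos:
  assumes "F a > 0" "a \<noteq> y" shows "jdist F a y > 0"
proof -
  obtain r where r: "r > 0" "\<And>w. dist w a < r \<Longrightarrow> dist (F w) (F a) < F a / 2"
    using cont_F assms(1) unfolding continuous_on_iff by (metis UNIV_I half_gt_zero)
  have "F a / 2 * min (r/2) (dist a y) \<le> jdist F a y"
  proof (rule jdist_lower)
    fix w assume "w \<in> cball a (r/2)"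
    then have "dist w a < r" using r(1) by (auto simp: dist_commute)
    then have "dist (F w) (F a) < F a / 2" by (rule r(2))
    then show "F a / 2 \<le> F w" unfolding dist_real_def by linarith
  qed (use assms r in auto)
  moreover have "F a / 2 * min (r/2) (dist a y) > 0" using assms r by auto
  ultimately show ?thesis by linarith
qed

text \<open>\<open>jdist\<close> is only a pseudometric, as it may vanish between distinct points.
  It is nevertheless continuous for the Euclidean topology because \<open>F\<close> is locally
  bounded.\<close>

lemma jdist_self_tendsto:
  assumes "(f \<longlongrightarrow> a) G"
  shows "((\<lambda>x. jdist F a (f x)) \<longlongrightarrow> 0) G"
proof -
  obtain B where B: "B \<ge> 0" "\<And>w. w \<in> cball a 1 \<Longrightarrow> F w \<le> B" using F_bound by blast
  have "\<forall>\<^sub>F x in G. dist (f x) a < 1" using assms by (simp add: tendstoD)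
  then have "\<forall>\<^sub>F x in G. jdist F a (f x) \<le> B * norm (f x - a)"
    by (rule eventually_mono) (auto intro!: jdist_cball[of a 1] B simp: dist_commute)
  moreover have "((\<lambda>x. B * norm (f x - a)) \<longlongrightarrow> B * norm (a - a)) G"
    by (intro tendsto_intros assms)
  then have "((\<lambda>x. B * norm (f x - a)) \<longlongrightarrow> 0) G" by simp
  moreover have "\<forall>\<^sub>F x in G. 0 \<le> jdist F a (f x)" by (simp add: jdist_nonneg)
  ultimately show ?thesis
    using tendsto_sandwich[of "\<lambda>_. 0" "\<lambda>x. jdist F a (f x)" G "\<lambda>x. B * norm (f x - a)" 0] tendsto_const
      \<open>\<forall>\<^sub>F x in G. jdist F a (f x) \<le> B * norm (f x - a)\<close> by fast
qed

lemma jdist_lipschitz: "\<bar>jdist F x y - jdist F a b\<bar> \<le> jdist F a x + jdist F b y"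
  using jdist_triangle[of x y a] jdist_triangle[of a y b] jdist_triangle[of a b x] jdist_triangle[of x b y]
    jdist_sym[of a x] jdist_sym[of b y] by linarith

lemma tendsto_jdist:
  assumes "(f \<longlongrightarrow> a) G" "(g \<longlongrightarrow> b) G"
  shows "((\<lambda>x. jdist F (f x) (g x)) \<longlongrightarrow> jdist F a b) G"
proof -
  have "((\<lambda>x. jdist F a (f x) + jdist F b (g x)) \<longlongrightarrow> 0) G"
    using tendsto_add[OF jdist_self_tendsto[OF assms(1)] jdist_self_tendsto[OF assms(2)]] by simp
  moreover have "\<forall>\<^sub>F x in G. norm (jdist F (f x) (g x) - jdist F a b) \<le> jdist F a (f x) + jdist F b (g x)"
    by (simp add: jdist_lipschitz)
  ultimately have "((\<lambda>x. jdist F (f x) (g x) - jdist F a b) \<longlongrightarrow> 0) G"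
    using Lim_null_comparison[of "\<lambda>x. jdist F (f x) (g x) - jdist F a b"
        "\<lambda>x. jdist F a (f x) + jdist F b (g x)" G] by fast
  then show ?thesis by (rule LIM_zero_cancel)
qed

lemma continuous_on_jdist:
  assumes "continuous_on T f" "continuous_on T g"
  shows "continuous_on T (\<lambda>x. jdist F (f x) (g x))"
  using assms unfolding continuous_on_def by (auto intro: tendsto_jdist)

text \<open>A chain of cost \<open>C\<close> is traversed at unit rate of cost. The result is a
  family of points with distance bounds rather than a continuous curve, which is the right object
  for a pointwise limit.\<close>

lemma chain_param:
  assumes "chain_cost F x y C"
  shows "\<exists>\<gamma>. \<forall>s\<in>{0..C}. jdist F x (\<gamma> s) \<le> s \<and> jdist F (\<gamma> s) y \<le> C - s \<and>
    (\<forall>t\<in>{s..C}. jdist F (\<gamma> s) (\<gamma> t) \<le> t - s)"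
  using assms
proof (induction rule: chain_cost.induct)
  case chain_refl
  show ?case by (rule exI[of _ "\<lambda>_. x"]) auto
next
  case (chain_step y C z M)
  then obtain \<gamma> where \<gamma>: "\<And>s. s \<in> {0..C} \<Longrightarrow> jdist F x (\<gamma> s) \<le> s"
    "\<And>s. s \<in> {0..C} \<Longrightarrow> jdist F (\<gamma> s) y \<le> C - s"
    "\<And>s t. s \<in> {0..C} \<Longrightarrow> t \<in> {s..C} \<Longrightarrow> jdist F (\<gamma> s) (\<gamma> t) \<le> t - s"
    by blast
  have C: "0 \<le> C" using chain_step chain_nonneg by blast
  define L where "L = M * norm (z - y)"
  have M: "0 \<le> M" using chain_step.hyps F_nonneg[of z] by (meson ends_in_segment(2) order_trans)
  \<comment> \<open>When \<open>L = 0\<close> the new piece has no parameters beyond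
    \<open>C\<close>, so the quotient with denominator zero does no harm.\<close>
  define p where "p t = y + ((t - C) / L) *\<^sub>R (z - y)" for t
  have yz: "jdist F y z \<le> L" unfolding L_def using chain_step.hyps by (intro jdist_seg) auto
  have pseg: "p t \<in> closed_segment y z" if "C \<le> t" "t \<le> C + L" for t
  proof -
    have "0 \<le> (t - C)/L" "(t - C)/L \<le> 1" using that by (auto simp: divide_simps)
    then show ?thesis unfolding in_segment p_def
      by (intro exI[of _ "(t - C)/L"]) (simp add: algebra_simps)
  qed
  have pd: "jdist F (p s) (p t) \<le> t - s" if "C < s" "s \<le> t" "t \<le> C + L" for s t
  proof -
    have L: "L > 0" using that by linarith
    have "jdist F (p s) (p t) \<le> M * norm (p t - p s)"
    proof (rule jdist_seg)
      fix w assume "w \<in> closed_segment (p s) (p t)"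
      moreover have "closed_segment (p s) (p t) \<subseteq> closed_segment y z"
        using that pseg by (intro closed_segment_subset) auto
      ultimately show "F w \<le> M" using chain_step.hyps by auto
    qed
    also have "p t - p s = ((t - s)/L) *\<^sub>R (z - y)" unfolding p_def
      by (simp add: algebra_simps diff_divide_distrib)
    also have "M * norm \<dots> = t - s" using L that unfolding L_def by (auto simp: divide_simps)
    finally show ?thesis .
  qed
  have py: "jdist F y (p t) \<le> t - C" if "C < t" "t \<le> C + L" for t
  proof -
    have L: "L > 0" using that by linarith
    have "jdist F y (p t) \<le> M * norm (p t - y)"
    proof (rule jdist_seg)
      fix w assume "w \<in> closed_segment y (p t)"
      moreover have "closed_segment y (p t) \<subseteq> closed_segment y z"
        using that pseg by (intro closed_segment_subset) auto
      ultimately show "F w \<le> M" using chain_step.hyps by auto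
    qed
    also have "p t - y = ((t - C)/L) *\<^sub>R (z - y)" unfolding p_def by simp
    also have "M * norm \<dots> = t - C" using L that unfolding L_def by (auto simp: divide_simps)
    finally show ?thesis .
  qed
  have pz: "jdist F (p t) z \<le> C + L - t" if "C < t" "t \<le> C + L" for t
  proof -
    have "L > 0" using that by linarith
    then have "p (C + L) = z" unfolding p_def by simp
    then show ?thesis using pd[of t "C + L"] that by auto
  qed
  \<comment> \<open>The value at \<open>C\<close> is the old one. It need not be \<open>y\<close>,
    but its distance to \<open>y\<close> is at most 0, so the two pieces fit together.\<close>
  define g where "g t = (if t \<le> C then \<gamma> t else p t)" for t
  have 1: "jdist F x (g s) \<le> s" if "0 \<le> s" "s \<le> C + L" for s
  proof (cases "s \<le> C")
    case False
    have "jdist F x y \<le> C" using chain_step.hyps(1) by (rule jdist_le)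
    then show ?thesis using jdist_triangle[of x "p s" y] py[of s] False that by (simp add: g_def)
  qed (use that \<gamma> in \<open>auto simp: g_def\<close>)
  have 2: "jdist F (g s) z \<le> C + L - s" if "0 \<le> s" "s \<le> C + L" for s
  proof (cases "s \<le> C")
    case True
    then show ?thesis using jdist_triangle[of "\<gamma> s" z y] \<gamma>(2)[of s] yz that by (simp add: g_def)
  qed (use that pz in \<open>auto simp: g_def\<close>)
  have 3: "jdist F (g s) (g t) \<le> t - s" if "0 \<le> s" "s \<le> t" "t \<le> C + L" for s t
  proof -
    consider "t \<le> C" | "s \<le> C" "C < t" | "C < s" by linarith
    then show ?thesis
    proof cases
      case 2
      then show ?thesis using jdist_triangle[of "\<gamma> s" "p t" y] \<gamma>(2)[of s] py[of t] that
        by (simp add: g_def)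
    qed (use that \<gamma>(3)[of s t] pd[of s t] in \<open>auto simp: g_def\<close>)
  qed
  show ?case unfolding L_def[symmetric] by (rule exI[of _ g]) (use 1 2 3 in auto)
qed

text \<open>Crossing the shell between the radii \<open>r1\<close> and
  \<open>r1 + \<bar>B\<bar> / f + 1\<close> costs at least \<open>\<bar>B\<bar> + f\<close>, which
  exceeds \<open>B\<close>. Boundedness of distance balls is what the compactness arguments rest
  on.\<close>

lemma jdist_bounded:
  assumes "f > 0" "\<And>w. R \<le> norm w \<Longrightarrow> f \<le> F w"
  shows "\<exists>r. \<forall>z. jdist F x z \<le> B \<longrightarrow> norm z \<le> r"
proof (intro exI[of _ "max R (norm x) + \<bar>B\<bar> / f + 1"] allI impI)
  fix z assume z: "jdist F x z \<le> B"
  define r1 where "r1 = max R (norm x)"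
  define r2 where "r2 = r1 + \<bar>B\<bar> / f + 1"
  have "0 \<le> \<bar>B\<bar> / f" using assms(1) by simp
  then have r: "r1 \<le> r2" unfolding r2_def by linarith
  have "f * \<bar>max r1 (min r2 (dist 0 x)) - max r1 (min r2 (dist 0 z))\<bar> \<le> B"
    using jdist_shell[of r1 0 r2 f x z] assms r z by (auto simp: r1_def)
  moreover have "max r1 (min r2 (dist 0 x)) = r1" using r by (auto simp: r1_def)
  ultimately have *: "f * \<bar>r1 - max r1 (min r2 (norm z))\<bar> \<le> B" by simp
  show "norm z \<le> max R (norm x) + \<bar>B\<bar> / f + 1"
  proof (rule ccontr)
    assume "\<not> ?thesis"
    then have "max r1 (min r2 (norm z)) = r2" using r by (simp add: r1_def r2_def)
    then have "f * (\<bar>B\<bar> / f + 1) \<le> B" using * \<open>0 \<le> \<bar>B\<bar> / f\<close> by (simp add: r2_def add.commute)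
    then show False using assms(1) by (simp add: distrib_left)
  qed
qed

text \<open>Approximate geodesics need not converge as curves; exact ones exist because the
  approximate ones form a decreasing sequence of nonempty closed sets in a compact product space.\<close>

lemma geodesic_exists:
  assumes "f > 0" "\<And>w. R \<le> norm w \<Longrightarrow> f \<le> F w"
  shows "\<exists>\<gamma>. \<forall>s\<in>{0..jdist F x y}. jdist F x (\<gamma> s) = s \<and> jdist F (\<gamma> s) y = jdist F x y - s \<and>
    (\<forall>t\<in>{0..jdist F x y}. jdist F (\<gamma> s) (\<gamma> t) = \<bar>s - t\<bar>)"
proof -
  define D where "D = jdist F x y"
  have D: "0 \<le> D" by (simp add: D_def jdist_nonneg)
  obtain r where r: "\<And>z. jdist F x z \<le> D \<Longrightarrow> norm z \<le> r"
    using jdist_bounded[OF assms] by blast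
  \<comment> \<open>Arbitrary maps with values in a ball: compact for pointwise convergence by
    Tychonoff, in contrast to a space of curves.\<close>
  define U where "U = {\<gamma>::real \<Rightarrow> 'a. \<forall>s. \<gamma> s \<in> cball 0 r}"
  have U: "compact U"
  proof -
    have "U = PiE UNIV (\<lambda>_. cball 0 r)" by (auto simp: U_def PiE_def Pi_def extensional_def)
    then have "compactin (product_topology (\<lambda>_. euclidean) UNIV) U"
      by (simp add: compactin_PiE)
    then show ?thesis by (simp add: euclidean_product_topology)
  qed
  \<comment> \<open>Only inequalities are imposed, each a closed condition on at most two values of
    \<open>\<gamma>\<close>; \<open>e\<close> is the excess cost of the approximating chain.\<close>
  define T where "T e = {\<gamma>. \<forall>s\<in>{0..D}. jdist F x (\<gamma> s) \<le> s \<and> jdist F (\<gamma> s) y \<le> D - s + e \<and>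
    (\<forall>t\<in>{s..D}. jdist F (\<gamma> s) (\<gamma> t) \<le> t - s)}" for e
  have closed: "closed (T e)" for e
  proof -
    have T: "T e = (\<Inter>s\<in>{0..D}. {\<gamma>. jdist F x (\<gamma> s) \<le> s} \<inter> {\<gamma>. jdist F (\<gamma> s) y \<le> D - s + e} \<inter>
      (\<Inter>t\<in>{s..D}. {\<gamma>. jdist F (\<gamma> s) (\<gamma> t) \<le> t - s}))"
      unfolding T_def by auto
    show ?thesis unfolding T
      by (intro closed_INT ballI closed_Int closed_Collect_le continuous_on_jdist
          continuous_on_const continuous_on_product_coordinates)
  qed
  have nonempty: "U \<inter> T e \<noteq> {}" if "e > 0" for e
  proof -
    obtain C where C: "chain_cost F x y C" "C < D + e" using jdist_approx[OF \<open>e > 0\<close>] D_def by metis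
    have "D \<le> C" using jdist_le[OF C(1)] by (simp add: D_def)
    obtain \<gamma> where \<gamma>: "\<forall>s\<in>{0..C}. jdist F x (\<gamma> s) \<le> s \<and> jdist F (\<gamma> s) y \<le> C - s \<and>
      (\<forall>t\<in>{s..C}. jdist F (\<gamma> s) (\<gamma> t) \<le> t - s)" using chain_param[OF C(1)] by blast
    \<comment> \<open>The chain may cost slightly more than \<open>D\<close>. Clamping the parameter
      to \<open>[0, D]\<close> keeps all values in the ball.\<close>
    define g where "g s = \<gamma> (max 0 (min D s))" for s
    have "g s \<in> cball 0 r" for s
    proof -
      have "jdist F x (g s) \<le> max 0 (min D s)" using \<gamma> \<open>D \<le> C\<close> D unfolding g_def by auto
      also have "\<dots> \<le> D" using D by simp
      finally show ?thesis using r by simp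
    qed
    moreover have "g \<in> T e"
    proof -
      have g: "g s = \<gamma> s" if "s \<in> {0..D}" for s using that by (simp add: g_def)
      have "jdist F x (\<gamma> s) \<le> s" "jdist F (\<gamma> s) y \<le> D - s + e"
        "\<forall>t\<in>{s..D}. jdist F (\<gamma> s) (\<gamma> t) \<le> t - s" if "s \<in> {0..D}" for s
      proof -
        have "s \<in> {0..C}" using that \<open>D \<le> C\<close> by simp
        with \<gamma> have *: "jdist F x (\<gamma> s) \<le> s" "jdist F (\<gamma> s) y \<le> C - s"
          "\<forall>t\<in>{s..C}. jdist F (\<gamma> s) (\<gamma> t) \<le> t - s" by blast+
        show "jdist F x (\<gamma> s) \<le> s" "jdist F (\<gamma> s) y \<le> D - s + e" using * C(2) by auto
        show "\<forall>t\<in>{s..D}. jdist F (\<gamma> s) (\<gamma> t) \<le> t - s" using *(3) \<open>D \<le> C\<close> by auto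
      qed
      then show ?thesis unfolding T_def using g by auto
    qed
    ultimately show ?thesis unfolding U_def by blast
  qed
  have mono: "T e \<subseteq> T e'" if "e \<le> e'" for e e' using that unfolding T_def by fastforce
  have "U \<inter> \<Inter>(T ` {0<..}) \<noteq> {}"
  proof (rule compact_imp_fip[OF U])
    fix F' assume "finite F'" "F' \<subseteq> T ` {0<..}"
    then obtain E where E: "finite E" "E \<subseteq> {0<..}" "F' = T ` E" by (metis finite_subset_image)
    define e where "e = Min (insert 1 E)"
    have "e > 0" "\<And>e'. e' \<in> E \<Longrightarrow> e \<le> e'" using E unfolding e_def by (auto simp: subset_eq)
    then have "U \<inter> T e \<subseteq> U \<inter> \<Inter>F'" using mono E(3) by fastforce
    then show "U \<inter> \<Inter>F' \<noteq> {}" using nonempty[OF \<open>e > 0\<close>] by blast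
  qed (use closed in auto)
  then obtain \<gamma> where \<gamma>: "\<And>e. e > 0 \<Longrightarrow> \<gamma> \<in> T e" by auto
  have 1: "jdist F x (\<gamma> s) \<le> s" if "s \<in> {0..D}" for s using \<gamma>[of 1] that by (auto simp: T_def)
  have 2: "jdist F (\<gamma> s) y \<le> D - s" if "s \<in> {0..D}" for s
    by (rule field_le_epsilon) (use \<gamma> that in \<open>auto simp: T_def\<close>)
  have 3: "jdist F (\<gamma> s) (\<gamma> t) \<le> t - s" if "s \<in> {0..D}" "t \<in> {s..D}" for s t
    using \<gamma>[of 1] that by (auto simp: T_def)
  \<comment> \<open>\<open>D \<le> jdist F x (\<gamma> s) + jdist F (\<gamma> s) y \<le> s + (D -
    s)\<close> forces both estimates to be equalities.\<close>
  have 4: "jdist F x (\<gamma> s) = s" "jdist F (\<gamma> s) y = D - s" if "s \<in> {0..D}" for s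
    using 1[OF that] 2[OF that] jdist_triangle[of x y "\<gamma> s"] by (auto simp: D_def)
  have 5: "jdist F (\<gamma> s) (\<gamma> t) = t - s" if "s \<in> {0..D}" "t \<in> {s..D}" for s t
    using 3[OF that] 4(1)[of s] 4(1)[of t] jdist_triangle[of x "\<gamma> t" "\<gamma> s"] that by auto
  have 6: "jdist F (\<gamma> s) (\<gamma> t) = \<bar>s - t\<bar>" if "s \<in> {0..D}" "t \<in> {0..D}" for s t
    using 5[of s t] 5[of t s] that jdist_sym[of "\<gamma> s" "\<gamma> t"] by (cases "s \<le> t") auto
  show ?thesis using 4 6 unfolding D_def by blast
qed

end

section \<open>Regularity of geodesics\<close>

text \<open>Add up steps of length at most \<open>\<delta> / 2\<close>. This replaces integration of
  a derivative when \<open>f\<close> is a distance that is not known to be differentiable.\<close>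

lemma increment_le_of_local:
  fixes f g :: "real \<Rightarrow> real"
  assumes "a \<le> b" "\<delta> > 0"
    and loc: "\<And>t t'. a \<le> t \<Longrightarrow> t \<le> t' \<Longrightarrow> t' \<le> b \<Longrightarrow> t' - t < \<delta> \<Longrightarrow> f t' - f t \<le> g t' - g t"
  shows "f b - f a \<le> g b - g a"
proof -
  have "f c - f a \<le> g c - g a" if "a \<le> c" "c \<le> b" "c - a \<le> real n * (\<delta> / 2)" for n c
    using that
  proof (induction n arbitrary: c)
    case (Suc n)
    define d where "d = max a (c - \<delta> / 2)"
    have "c - a \<le> real n * (\<delta> / 2) + \<delta> / 2" using Suc.prems by (simp add: algebra_simps)
    moreover have "0 \<le> real n * (\<delta> / 2)" using \<open>\<delta> > 0\<close> by simp
    ultimately have "f d - f a \<le> g d - g a"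
      using Suc.prems \<open>\<delta> > 0\<close> unfolding d_def max_def by (intro Suc.IH) auto
    moreover have "f c - f d \<le> g c - g d"
      using Suc.prems \<open>\<delta> > 0\<close> by (intro loc) (auto simp: d_def max_def)
    ultimately show ?case by linarith
  qed simp
  moreover obtain n where "b - a \<le> real n * (\<delta> / 2)"
    using reals_Archimedean3[of "\<delta> / 2" ] \<open>\<delta> > 0\<close> by (metis half_gt_zero less_imp_le)
  ultimately show ?thesis using \<open>a \<le> b\<close> by blast
qed

text \<open>The radii leave room for variations: the arc stays in the ball of radius
  \<open>\<rho> / 4\<close>, its chords are at most \<open>\<rho> / 2\<close>, and points within
  \<open>3 * \<rho> / 4\<close> of the arc still lie in the ball where the bounds \<open>f\<close>,
  \<open>B\<close> and \<open>M\<close> hold.\<close>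

locale geodesic_patch = conformal_metric F for F :: "'a::euclidean_space \<Rightarrow> real" +
  fixes DF :: "'a \<Rightarrow> 'a" and \<gamma> :: "real \<Rightarrow> 'a" and s0 \<delta> \<rho> f M B :: real and x0 :: 'a
  assumes pos: "0 < \<delta>" "0 < \<rho>" "0 < f" "0 \<le> M"
    and F_lower: "x \<in> cball x0 \<rho> \<Longrightarrow> f \<le> F x"
    and F_upper: "x \<in> cball x0 \<rho> \<Longrightarrow> F x \<le> B"
    and F_lip: "x \<in> cball x0 \<rho> \<Longrightarrow> y \<in> cball x0 \<rho> \<Longrightarrow> \<bar>F x - F y\<bar> \<le> M * norm (x - y)"
    and F_grad: "x \<in> cball x0 \<rho> \<Longrightarrow> GDERIV F x :> DF x"
    and cont_DF: "continuous_on (cball x0 \<rho>) DF"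
    and geo: "s \<in> ball s0 \<delta> \<Longrightarrow> t \<in> ball s0 \<delta> \<Longrightarrow> jdist F (\<gamma> s) (\<gamma> t) = \<bar>s - t\<bar>"
    and near: "s \<in> ball s0 \<delta> \<Longrightarrow> \<gamma> s \<in> cball x0 (\<rho> / 4)"
begin

lemma in_patch: "s \<in> ball s0 \<delta> \<Longrightarrow> dist (\<gamma> s) z \<le> 3 * \<rho> / 4 \<Longrightarrow> z \<in> cball x0 \<rho>"
  using near[of s] dist_triangle[of x0 z "\<gamma> s"] by simp

lemma in_patch_self: "s \<in> ball s0 \<delta> \<Longrightarrow> \<gamma> s \<in> cball x0 \<rho>"
  using in_patch[of s "\<gamma> s"] pos by simp

lemma dist_\<gamma>: "s \<in> ball s0 \<delta> \<Longrightarrow> t \<in> ball s0 \<delta> \<Longrightarrow> dist (\<gamma> s) (\<gamma> t) \<le> \<rho> / 2"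
  using near[of s] near[of t] dist_triangle2[of "\<gamma> s" "\<gamma> t" x0] by (simp add: dist_commute)

lemma \<gamma>_lip: 
  assumes "s \<in> ball s0 \<delta>" "t \<in> ball s0 \<delta>"
  shows "norm (\<gamma> t - \<gamma> s) \<le> \<bar>t - s\<bar> / f"
proof -
  have "f * min (\<rho> / 2) (dist (\<gamma> s) (\<gamma> t)) \<le> jdist F (\<gamma> s) (\<gamma> t)"
  proof (rule jdist_lower)
    fix w assume "w \<in> cball (\<gamma> s) (\<rho> / 2)"
    then have "w \<in> cball x0 \<rho>" using in_patch[OF assms(1), of w] pos by simp
    then show "f \<le> F w" by (rule F_lower)
  qed (use pos in auto)
  then have "f * norm (\<gamma> t - \<gamma> s) \<le> \<bar>t - s\<bar>"
    using dist_\<gamma>[OF assms] geo[OF assms] by (simp add: min_absorb2 dist_norm norm_minus_commute abs_minus_commute)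
  then show ?thesis using pos by (simp add: field_simps)
qed

lemma \<gamma>_lip_sq:
  assumes "s \<in> ball s0 \<delta>" "t \<in> ball s0 \<delta>"
  shows "(norm (\<gamma> t - \<gamma> s))\<^sup>2 \<le> (t - s)\<^sup>2 / f\<^sup>2"
  using power_mono[OF \<gamma>_lip[OF assms], of 2] by (simp add: power_divide)

lemma cont_\<gamma>: "continuous_on (ball s0 \<delta>) \<gamma>"
proof -
  have "(1 / f)-lipschitz_on (ball s0 \<delta>) \<gamma>"
  proof (rule lipschitz_onI)
    fix x y assume "x \<in> ball s0 \<delta>" "y \<in> ball s0 \<delta>"
    then show "dist (\<gamma> x) (\<gamma> y) \<le> 1 / f * dist x y" using \<gamma>_lip[of y x] by (simp add: dist_norm)
  qed (use pos in simp)
  then show ?thesis by (rule lipschitz_on_continuous_on)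
qed

lemma cont_F\<gamma>: "continuous_on (ball s0 \<delta>) (\<lambda>s. F (\<gamma> s))"
  using continuous_on_compose[OF cont_\<gamma> continuous_on_subset[OF cont_F]] by (simp add: comp_def)

lemma F\<gamma>_pos: "s \<in> ball s0 \<delta> \<Longrightarrow> 0 < F (\<gamma> s)"
  using F_lower[OF in_patch_self] pos by (meson less_le_trans)

text \<open>The gradient of \<open>ln F\<close> along the arc: \<open>e \<bullet> A s\<close> is the
  relative rate at which a translation by \<open>e\<close> changes the length element. It will turn
  out to be the derivative of the momentum.\<close>

definition A where "A s = DF (\<gamma> s) /\<^sub>R F (\<gamma> s)"

lemma cont_A: "continuous_on (ball s0 \<delta>) A"
proof -
  have "continuous_on (ball s0 \<delta>) (\<lambda>s. DF (\<gamma> s))"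
    using in_patch_self
    by (intro continuous_on_compose2[OF cont_DF cont_\<gamma>]) blast
  then show ?thesis unfolding A_def using cont_F\<gamma> F\<gamma>_pos
    by (intro continuous_intros) (auto, fastforce)
qed

text \<open>On the ball whose radius is the chord, \<open>F\<close> differs from
  \<open>F (\<gamma> s)\<close> by at most \<open>M\<close> times the chord, and the chord is at
  most \<open>\<bar>t - s\<bar> / f\<close>. Together with \<open>chord_lower\<close> this is the
  relation \<open>F * norm \<gamma>' = 1\<close> up to second order, available before any derivative
  is known to exist.\<close>

lemma chord_upper:
  assumes "s \<in> ball s0 \<delta>" "t \<in> ball s0 \<delta>"
  shows "F (\<gamma> s) * norm (\<gamma> t - \<gamma> s) \<le> \<bar>t - s\<bar> + M / f\<^sup>2 * (t - s)\<^sup>2"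
proof -
  define n where "n = norm (\<gamma> t - \<gamma> s)"
  have n: "M * n\<^sup>2 \<le> M / f\<^sup>2 * (t - s)\<^sup>2"
    using mult_left_mono[OF \<gamma>_lip_sq[OF assms], of M] pos by (simp add: n_def)
  show ?thesis
  proof (cases "F (\<gamma> s) \<le> M * n")
    \<comment> \<open>The lower bound \<open>F (\<gamma> s) - M * n\<close> is not positive here,
      but then the whole left-hand side is already of second order.\<close>
    case True
    then have "F (\<gamma> s) * n \<le> M * n\<^sup>2"
      using mult_right_mono[OF True, of n] by (simp add: n_def power2_eq_square mult.assoc)
    then show ?thesis using n unfolding n_def by linarith
  next
    case False
    have "(F (\<gamma> s) - M * n) * min n (dist (\<gamma> s) (\<gamma> t)) \<le> jdist F (\<gamma> s) (\<gamma> t)"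
    proof (rule jdist_lower)
      fix w assume w: "w \<in> cball (\<gamma> s) n"
      have "n \<le> \<rho> / 2" using dist_\<gamma>[OF assms] by (simp add: n_def dist_norm norm_minus_commute)
      then have "w \<in> cball x0 \<rho>" using in_patch[OF assms(1), of w] pos w by simp
      then have "\<bar>F (\<gamma> s) - F w\<bar> \<le> M * norm (\<gamma> s - w)"
        by (rule F_lip[OF in_patch_self[OF assms(1)]])
      also have "\<dots> \<le> M * n" using w pos by (intro mult_left_mono) (auto simp: dist_norm)
      finally show "F (\<gamma> s) - M * n \<le> F w" by linarith
    qed (use False in \<open>auto simp: n_def\<close>)
    then have "(F (\<gamma> s) - M * n) * n \<le> \<bar>t - s\<bar>"
      using geo[OF assms] by (simp add: n_def dist_norm norm_minus_commute abs_minus_commute)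
    then show ?thesis using n unfolding n_def by (simp add: algebra_simps power2_eq_square)
  qed
qed

lemma chord_lower:
  assumes "s \<in> ball s0 \<delta>" "t \<in> ball s0 \<delta>"
  shows "\<bar>t - s\<bar> - M / f\<^sup>2 * (t - s)\<^sup>2 \<le> F (\<gamma> s) * norm (\<gamma> t - \<gamma> s)"
proof -
  define n where "n = norm (\<gamma> t - \<gamma> s)"
  have n: "M * n\<^sup>2 \<le> M / f\<^sup>2 * (t - s)\<^sup>2"
    using mult_left_mono[OF \<gamma>_lip_sq[OF assms], of M] pos by (simp add: n_def)
  have "jdist F (\<gamma> s) (\<gamma> t) \<le> (F (\<gamma> s) + M * n) * norm (\<gamma> t - \<gamma> s)"
  proof (rule jdist_cball)
    fix w assume w: "w \<in> cball (\<gamma> s) n"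
    have "n \<le> \<rho> / 2" using dist_\<gamma>[OF assms] by (simp add: n_def dist_norm norm_minus_commute)
    then have "w \<in> cball x0 \<rho>" using in_patch[OF assms(1), of w] pos w by simp
    then have "\<bar>F (\<gamma> s) - F w\<bar> \<le> M * norm (\<gamma> s - w)"
      by (rule F_lip[OF in_patch_self[OF assms(1)]])
    also have "\<dots> \<le> M * n" using w pos by (intro mult_left_mono) (auto simp: dist_norm)
    finally show "F w \<le> F (\<gamma> s) + M * n" by linarith
  qed (auto simp: n_def dist_norm norm_minus_commute)
  then show ?thesis using n geo[OF assms] unfolding n_def
    by (simp add: algebra_simps power2_eq_square abs_minus_commute)
qed

text \<open>Collects the errors of \<open>end_cost\<close>: the first term comes from the variation
  of \<open>F\<close> along the displaced segment, the next two from squaring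
  \<open>chord_upper\<close>, the last from the term quadratic in \<open>e\<close>.\<close>

definition K where
  "K = M * (1 + 1 / f)\<^sup>2 + M / f\<^sup>2 + (M / f\<^sup>2)\<^sup>2 / 2 + B\<^sup>2 / 2"

text \<open>First variation of the distance at one endpoint. The straight segment from the displaced
  point is a competitor, and the coefficient of \<open>e\<close> is the discrete momentum
  \<open>(F (\<gamma> s))\<^sup>2 * (\<gamma> t - \<gamma> s) / h\<close>.\<close>

lemma end_cost:
  assumes s: "s \<in> ball s0 \<delta>" and t: "t \<in> ball s0 \<delta>" and h: "\<bar>t - s\<bar> = h" "0 < h" "h \<le> 1" "h \<le> \<rho> / 4"
    and e: "norm e \<le> h"
  shows "jdist F (\<gamma> s + e) (\<gamma> t) \<le> h - (F (\<gamma> s))\<^sup>2 * ((\<gamma> t - \<gamma> s) \<bullet> e) / h + K * (h\<^sup>2 + (norm e)\<^sup>2 / h)"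
proof -
  define \<Delta> where "\<Delta> = \<gamma> t - \<gamma> s"
  define Fs where "Fs = F (\<gamma> s)"
  define c where "c = 1 + 1 / f"
  have \<Delta>: "norm \<Delta> \<le> h / f" using \<gamma>_lip[OF s t] h by (simp add: \<Delta>_def)
  have Fs: "0 < Fs" "Fs \<le> B" using F\<gamma>_pos[OF s] F_upper[OF in_patch_self[OF s]] by (auto simp: Fs_def)
  have c: "norm \<Delta> \<le> h * c" "norm e \<le> h * c" "norm (\<Delta> - e) \<le> h * c"
  proof -
    have "h * c = h + h / f" by (simp add: c_def distrib_left)
    moreover have "0 \<le> h / f" using h(2) pos(3) by simp
    ultimately show "norm \<Delta> \<le> h * c" "norm e \<le> h * c" "norm (\<Delta> - e) \<le> h * c"
      using \<Delta> e h(2) norm_triangle_ineq4[of \<Delta> e] by linarith+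
  qed
  have "jdist F (\<gamma> s + e) (\<gamma> t) \<le> (Fs + M * (h * c)) * norm (\<gamma> t - (\<gamma> s + e))"
  proof (rule jdist_seg)
    fix w assume w: "w \<in> closed_segment (\<gamma> s + e) (\<gamma> t)"
    have "closed_segment (\<gamma> s + e) (\<gamma> t) \<subseteq> cball (\<gamma> s) (h * c)"
      using c by (intro closed_segment_subset) (auto simp: dist_norm \<Delta>_def norm_minus_commute)
    then have w1: "dist (\<gamma> s) w \<le> h * c" using w by auto
    have "closed_segment (\<gamma> s + e) (\<gamma> t) \<subseteq> cball (\<gamma> s) (\<rho> / 2)"
      using e h pos dist_\<gamma>[OF s t] by (intro closed_segment_subset) (auto simp: dist_norm)
    then have "dist (\<gamma> s) w \<le> \<rho> / 2" using w by auto
    then have "w \<in> cball x0 \<rho>" using in_patch[OF s, of w] pos by simp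
    then have "\<bar>F (\<gamma> s) - F w\<bar> \<le> M * norm (\<gamma> s - w)" by (rule F_lip[OF in_patch_self[OF s]])
    also have "\<dots> \<le> M * (h * c)" using w1 pos by (intro mult_left_mono) (auto simp: dist_norm)
    finally show "F w \<le> Fs + M * (h * c)" unfolding Fs_def by linarith
  qed
  also have "\<gamma> t - (\<gamma> s + e) = \<Delta> - e" by (simp add: \<Delta>_def)
  also have "(Fs + M * (h * c)) * norm (\<Delta> - e) = Fs * norm (\<Delta> - e) + M * (h * c) * norm (\<Delta> - e)"
    by (simp add: distrib_right)
  also have "M * (h * c) * norm (\<Delta> - e) \<le> M * (h * c) * (h * c)"
    using c pos h by (intro mult_left_mono) (auto simp: c_def)
  \<comment> \<open>\<open>2 * a * b \<le> a\<^sup>2 + b\<^sup>2\<close> with \<open>b = h\<close>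
    replaces the norm by its square, which expands exactly in \<open>e\<close>. Little is lost
    because \<open>Fs * norm \<Delta>\<close> is \<open>h\<close> up to second order.\<close>
  also have "Fs * norm (\<Delta> - e) \<le> (Fs\<^sup>2 * (norm (\<Delta> - e))\<^sup>2 + h\<^sup>2) / (2 * h)"
  proof -
    have "0 \<le> (Fs * norm (\<Delta> - e) - h)\<^sup>2" by simp
    then show ?thesis using h by (simp add: field_simps power2_eq_square)
  qed
  also have "(norm (\<Delta> - e))\<^sup>2 = (norm \<Delta>)\<^sup>2 - 2 * (\<Delta> \<bullet> e) + (norm e)\<^sup>2"
    by (simp add: power2_norm_eq_inner algebra_simps inner_commute)
  also have "(Fs\<^sup>2 * ((norm \<Delta>)\<^sup>2 - 2 * (\<Delta> \<bullet> e) + (norm e)\<^sup>2) + h\<^sup>2) / (2 * h) + M * (h * c) * (h * c)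
    = (Fs * norm \<Delta>)\<^sup>2 / (2 * h) + h / 2 - Fs\<^sup>2 * (\<Delta> \<bullet> e) / h + Fs\<^sup>2 / 2 * ((norm e)\<^sup>2 / h) + M * c\<^sup>2 * h\<^sup>2"
    using h by (simp add: field_simps power2_eq_square)
  also have "(Fs * norm \<Delta>)\<^sup>2 / (2 * h) \<le> h / 2 + (M / f\<^sup>2 + (M / f\<^sup>2)\<^sup>2 / 2) * h\<^sup>2"
  proof -
    define q where "q = M / f\<^sup>2"
    have q: "0 \<le> q" using pos by (simp add: q_def)
    have "(t - s)\<^sup>2 = h\<^sup>2" using h(1) by (metis power2_abs)
    then have "Fs * norm \<Delta> \<le> h + q * h\<^sup>2" using chord_upper[OF s t] h(1) by (simp add: Fs_def \<Delta>_def q_def)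
    then have "(Fs * norm \<Delta>)\<^sup>2 \<le> (h + q * h\<^sup>2)\<^sup>2" using Fs by (intro power_mono) auto
    then have "(Fs * norm \<Delta>)\<^sup>2 / (2 * h) \<le> (h + q * h\<^sup>2)\<^sup>2 / (2 * h)" using h by (intro divide_right_mono) auto
    also have "\<dots> = h / 2 + q * h\<^sup>2 + q\<^sup>2 / 2 * h\<^sup>2 * h" using h by (simp add: field_simps power2_eq_square)
    also have "q\<^sup>2 / 2 * h\<^sup>2 * h \<le> q\<^sup>2 / 2 * h\<^sup>2 * 1" using h q by (intro mult_left_mono) auto
    finally show ?thesis unfolding q_def by (simp add: algebra_simps)
  qed
  also have "Fs\<^sup>2 / 2 * ((norm e)\<^sup>2 / h) \<le> K * ((norm e)\<^sup>2 / h)"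
  proof (rule mult_right_mono)
    have "Fs\<^sup>2 \<le> B\<^sup>2" using Fs by (intro power_mono) auto
    moreover have "0 \<le> M * (1 + 1 / f)\<^sup>2 + M / f\<^sup>2 + (M / f\<^sup>2)\<^sup>2 / 2" using pos by simp
    ultimately show "Fs\<^sup>2 / 2 \<le> K" unfolding K_def by linarith
  qed (use h in auto)
  finally have "jdist F (\<gamma> s + e) (\<gamma> t) \<le> h + (M * c\<^sup>2 + M / f\<^sup>2 + (M / f\<^sup>2)\<^sup>2 / 2) * h\<^sup>2
    - Fs\<^sup>2 * (\<Delta> \<bullet> e) / h + K * ((norm e)\<^sup>2 / h)" by (simp add: algebra_simps)
  moreover have "(M * c\<^sup>2 + M / f\<^sup>2 + (M / f\<^sup>2)\<^sup>2 / 2) * h\<^sup>2 \<le> K * h\<^sup>2"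
    by (intro mult_right_mono) (auto simp: K_def c_def)
  ultimately show ?thesis unfolding Fs_def \<Delta>_def by (simp add: distrib_left)
qed

text \<open>The translated arc is followed by short chords: a piece of parameter length
  \<open>d\<close> costs about \<open>d * (1 + e \<bullet> A t)\<close> after translation. Comparing
  increments avoids any derivative of \<open>\<gamma>\<close>. The last term carries the error of
  linearising \<open>F\<close>.\<close>

lemma shift_cost:
  assumes rs: "r \<in> ball s0 \<delta>" "s \<in> ball s0 \<delta>" "r \<le> s" and e: "norm e \<le> \<rho> / 4" and \<eta>: "0 \<le> \<eta>"
    and lin: "\<And>x. x \<in> cball x0 (\<rho> / 4) \<Longrightarrow> F (x + e) \<le> F x + e \<bullet> DF x + \<eta> * norm e"
  shows "jdist F (\<gamma> r + e) (\<gamma> s + e) \<le> (s - r) + e \<bullet> integral {r..s} A + \<eta> * norm e / f * (s - r)"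
proof (rule field_le_epsilon)
  fix \<mu>' :: real assume "0 < \<mu>'"
  define \<mu> where "\<mu> = \<mu>' / (s - r + 1)"
  have \<mu>: "0 < \<mu>" "\<mu> * (s - r) \<le> \<mu>'" using \<open>0 < \<mu>'\<close> rs by (auto simp: \<mu>_def field_simps)
  have sub: "{r..s} \<subseteq> ball s0 \<delta>" using rs by (auto simp: dist_real_def)
  define a where "a \<sigma> = e \<bullet> A \<sigma>" for \<sigma>
  have cont_a: "continuous_on {r..s} a"
    unfolding a_def by (intro continuous_intros continuous_on_subset[OF cont_A sub])
  then have "uniformly_continuous_on {r..s} a" by (intro compact_uniformly_continuous) auto
  then obtain d0 where d0: "0 < d0" "\<And>x y. x \<in> {r..s} \<Longrightarrow> y \<in> {r..s} \<Longrightarrow> dist y x < d0 \<Longrightarrow> dist (a y) (a x) < \<mu> / 2"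
    using \<mu> unfolding uniformly_continuous_on_def by (metis half_gt_zero)
  \<comment> \<open>Coefficient of the quadratic errors: the excess in \<open>chord_upper\<close>,
    enlarged by the ratio of \<open>F\<close> at the translated and the original point, and the
    variation of \<open>F\<close> along the translated chord.\<close>
  define C where "C = M / f\<^sup>2 * B / f + M / f\<^sup>2"
  have "f \<le> B" using F_lower[OF in_patch_self[OF rs(1)]] F_upper[OF in_patch_self[OF rs(1)]] by linarith
  then have C: "0 \<le> C" using pos by (simp add: C_def)
  define d1 where "d1 = min d0 (\<mu> / (2 * (C + 1)))"
  have d1: "0 < d1" "d1 \<le> d0" "\<And>d. d \<le> d1 \<Longrightarrow> C * d \<le> \<mu> / 2"
  proof -
    show "0 < d1" "d1 \<le> d0" using d0 \<mu> C by (auto simp: d1_def)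
    fix d assume "d \<le> d1"
    then have "C * d \<le> C * (\<mu> / (2 * (C + 1)))" using C by (intro mult_left_mono) (auto simp: d1_def)
    also have "\<dots> \<le> \<mu> / 2" using C \<mu> by (simp add: field_simps)
    finally show "C * d \<le> \<mu> / 2" .
  qed
  define k where "k = \<eta> * norm e / f"
  \<comment> \<open>Half of \<open>\<mu>\<close> pays for the quadratic errors, the other half for
    replacing \<open>d * a t\<close> by an integral of \<open>a\<close>.\<close>
  define g where "g t = (1 + k + \<mu>) * t + integral {r..t} a" for t
  define T where "T t = jdist F (\<gamma> r + e) (\<gamma> t + e)" for t
  have "T s - T r \<le> g s - g r"
  proof (rule increment_le_of_local[OF rs(3) d1(1)])
    fix t t' assume t: "r \<le> t" "t \<le> t'" "t' \<le> s" "t' - t < d1"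
    define d where "d = t' - t"
    have d: "0 \<le> d" "d < d1" using t by (auto simp: d_def)
    have tb: "t \<in> ball s0 \<delta>" "t' \<in> ball s0 \<delta>" by (rule subsetD[OF sub], use t in simp)+
    define n where "n = norm (\<gamma> t' - \<gamma> t)"
    have n2: "n\<^sup>2 \<le> d\<^sup>2 / f\<^sup>2" using \<gamma>_lip_sq[OF tb] by (simp add: n_def d_def)
    have nr: "n \<le> \<rho> / 2" using dist_\<gamma>[OF tb] by (simp add: n_def dist_norm norm_minus_commute)
    define Ft where "Ft = F (\<gamma> t)"
    define Fe where "Fe = F (\<gamma> t + e)"
    have te: "\<gamma> t + e \<in> cball x0 \<rho>" using in_patch[OF tb(1), of "\<gamma> t + e"] e pos by (simp add: dist_norm)
    have Ft: "0 < Ft" "f \<le> Ft" using F\<gamma>_pos[OF tb(1)] F_lower[OF in_patch_self[OF tb(1)]] by (auto simp: Ft_def)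
    have Fe: "0 \<le> Fe" "Fe \<le> B" using F_nonneg F_upper[OF te] by (auto simp: Fe_def)
    have "T t' \<le> T t + jdist F (\<gamma> t + e) (\<gamma> t' + e)" unfolding T_def by (rule jdist_triangle)
    also have "jdist F (\<gamma> t + e) (\<gamma> t' + e) \<le> (Fe + M * n) * norm ((\<gamma> t' + e) - (\<gamma> t + e))"
    proof (rule jdist_cball)
      fix w assume w: "w \<in> cball (\<gamma> t + e) n"
      have "dist (\<gamma> t) w \<le> dist (\<gamma> t) (\<gamma> t + e) + dist (\<gamma> t + e) w" by (rule dist_triangle)
      then have "dist (\<gamma> t) w \<le> 3 * \<rho> / 4" using w nr e by (simp add: dist_norm)
      then have "w \<in> cball x0 \<rho>" using in_patch[OF tb(1), of w] by simp
      then have "\<bar>Fe - F w\<bar> \<le> M * norm (\<gamma> t + e - w)" unfolding Fe_def by (rule F_lip[OF te])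
      also have "\<dots> \<le> M * n" using w pos by (intro mult_left_mono) (auto simp: dist_norm)
      finally show "F w \<le> Fe + M * n" by linarith
    qed (auto simp: n_def dist_norm norm_minus_commute)
    also have "(Fe + M * n) * norm ((\<gamma> t' + e) - (\<gamma> t + e)) = Fe * n + M * n\<^sup>2"
      by (simp add: n_def algebra_simps power2_eq_square)
    also have "M * n\<^sup>2 \<le> M / f\<^sup>2 * d\<^sup>2" using mult_left_mono[OF n2 pos(4)] by simp
    also have "Fe * n \<le> d * (1 + a t + k) + M / f\<^sup>2 * B / f * d\<^sup>2"
    proof -
      have "Ft * n \<le> d + M / f\<^sup>2 * d\<^sup>2" using chord_upper[OF tb] t by (simp add: Ft_def n_def d_def)
      then have "n \<le> (d + M / f\<^sup>2 * d\<^sup>2) / Ft" using Ft by (simp add: field_simps)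
      then have "Fe * n \<le> Fe * ((d + M / f\<^sup>2 * d\<^sup>2) / Ft)" using Fe by (intro mult_left_mono)
      also have "\<dots> = d * (Fe / Ft) + Fe * (M / f\<^sup>2 * d\<^sup>2) / Ft" by (simp add: algebra_simps add_divide_distrib)
      also have "Fe * (M / f\<^sup>2 * d\<^sup>2) / Ft \<le> B * (M / f\<^sup>2 * d\<^sup>2) / f"
        using Fe Ft pos by (intro frac_le mult_right_mono) auto
      also have "d * (Fe / Ft) \<le> d * (1 + a t + k)"
      proof (rule mult_left_mono[OF _ d(1)])
        have "Fe \<le> Ft + e \<bullet> DF (\<gamma> t) + \<eta> * norm e"
          unfolding Fe_def Ft_def using near[OF tb(1)] by (rule lin)
        then have "Fe / Ft \<le> (Ft + e \<bullet> DF (\<gamma> t) + \<eta> * norm e) / Ft" using Ft by (intro divide_right_mono) auto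
        also have "\<dots> = 1 + a t + \<eta> * norm e / Ft" using Ft
          by (simp add: a_def A_def Ft_def field_simps)
        also have "\<eta> * norm e / Ft \<le> k" unfolding k_def using \<eta> Ft pos by (intro divide_left_mono) auto
        finally show "Fe / Ft \<le> 1 + a t + k" by simp
      qed
      finally show ?thesis by (simp add: mult_ac)
    qed
    finally have "T t' \<le> T t + d * (1 + a t + k) + C * d\<^sup>2" by (simp add: C_def algebra_simps)
    also have "C * d\<^sup>2 \<le> \<mu> / 2 * d" using mult_right_mono[OF d1(3)[of d] d(1)] d by (simp add: power2_eq_square mult_ac)
    also have "d * (1 + a t + k) = d * (1 + k) + d * a t" by (simp add: algebra_simps)
    also have "d * a t \<le> integral {t..t'} a + d * (\<mu> / 2)"
    proof -
      have "integral {t..t'} (\<lambda>_. a t - \<mu> / 2) \<le> integral {t..t'} a"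
      proof (rule integral_le)
        show "a integrable_on {t..t'}"
          by (rule integrable_continuous_real, rule continuous_on_subset[OF cont_a]) (use t in auto)
        fix x assume "x \<in> {t..t'}"
        then have "dist (a t) (a x) < \<mu> / 2" using t d1(2) by (intro d0(2)) (auto simp: dist_real_def)
        then show "a t - \<mu> / 2 \<le> a x" unfolding dist_real_def by linarith
      qed auto
      then show ?thesis using t by (simp add: d_def algebra_simps)
    qed
    also have "integral {t..t'} a = integral {r..t'} a - integral {r..t} a"
    proof -
      have "integral {r..t} a + integral {t..t'} a = integral {r..t'} a"
        using t by (intro Henstock_Kurzweil_Integration.integral_combine integrable_continuous_real
            continuous_on_subset[OF cont_a]) auto
      then show ?thesis by simp
    qed
    finally show "T t' - T t \<le> g t' - g t" unfolding g_def d_def by (simp add: algebra_simps)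
  qed
  then have "jdist F (\<gamma> r + e) (\<gamma> s + e) \<le> (1 + k + \<mu>) * (s - r) + integral {r..s} a"
    by (simp add: T_def g_def algebra_simps)
  also have "integral {r..s} a = e \<bullet> integral {r..s} A"
    unfolding a_def by (rule integral_linear[OF integrable_continuous_real[OF continuous_on_subset[OF cont_A sub]]
        bounded_linear_inner_right, of e, unfolded comp_def])
  finally show "jdist F (\<gamma> r + e) (\<gamma> s + e) \<le> s - r + e \<bullet> integral {r..s} A + \<eta> * norm e / f * (s - r) + \<mu>'"
    using \<mu>(2) by (simp add: k_def algebra_simps)
qed

text \<open>For \<open>h > 0\<close>, \<open>mom s h\<close> and \<open>- mom r (- h)\<close> approximate the derivative of the distance
  under displacement of the two endpoints; displacing a whole subarc by \<open>e\<close> balances them against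
  the change of its length.\<close>

definition mom where "mom s h = ((F (\<gamma> s))\<^sup>2 / h) *\<^sub>R (\<gamma> (s + h) - \<gamma> s)"

text \<open>The path through \<open>\<gamma> r + e\<close> and \<open>\<gamma> s + e\<close> joins
  the ends of a geodesic arc of length \<open>s - r + 2 * h\<close> and so cannot be shorter. The
  linear part of its excess is \<open>- (e \<bullet> X)\<close>, hence \<open>e \<bullet> X\<close>
  is bounded by the error terms for every small \<open>e\<close>, in particular for \<open>e\<close>
  along \<open>X\<close>.\<close>

lemma momentum_balance:
  assumes rs: "r \<le> s" "r - h \<in> ball s0 \<delta>" "s + h \<in> ball s0 \<delta>" and h: "0 < h" "h \<le> 1" "h \<le> \<rho> / 4" and \<eta>: "0 \<le> \<eta>"
    and lin: "\<And>x e. x \<in> cball x0 (\<rho> / 4) \<Longrightarrow> norm e \<le> h \<Longrightarrow> F (x + e) \<le> F x + e \<bullet> DF x + \<eta> * norm e"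
  shows "norm (mom s h - mom r (- h) - integral {r..s} A) \<le> 4 * K * sqrt h + \<eta> / f * (s - r)"
proof -
  define X where "X = mom s h - mom r (- h) - integral {r..s} A"
  have b: "r \<in> ball s0 \<delta>" "s \<in> ball s0 \<delta>" using rs h by (auto simp: dist_real_def)
  have *: "e \<bullet> X \<le> 2 * K * (h\<^sup>2 + (norm e)\<^sup>2 / h) + \<eta> * norm e / f * (s - r)" if e: "norm e \<le> h" for e
  proof -
    have "s - r + 2 * h = jdist F (\<gamma> (r - h)) (\<gamma> (s + h))" using geo[OF rs(2,3)] rs h by simp
    also have "\<dots> \<le> jdist F (\<gamma> (r - h)) (\<gamma> r + e) + jdist F (\<gamma> r + e) (\<gamma> s + e) + jdist F (\<gamma> s + e) (\<gamma> (s + h))"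
      using jdist_triangle[of "\<gamma> (r - h)" "\<gamma> (s + h)" "\<gamma> r + e"]
        jdist_triangle[of "\<gamma> r + e" "\<gamma> (s + h)" "\<gamma> s + e"] by linarith
    also have "jdist F (\<gamma> (r - h)) (\<gamma> r + e) \<le> h - (F (\<gamma> r))\<^sup>2 * ((\<gamma> (r - h) - \<gamma> r) \<bullet> e) / h + K * (h\<^sup>2 + (norm e)\<^sup>2 / h)"
      using end_cost[OF b(1) rs(2), of h e] h e by (simp add: jdist_sym)
    also have "jdist F (\<gamma> s + e) (\<gamma> (s + h)) \<le> h - (F (\<gamma> s))\<^sup>2 * ((\<gamma> (s + h) - \<gamma> s) \<bullet> e) / h + K * (h\<^sup>2 + (norm e)\<^sup>2 / h)"
      using end_cost[OF b(2) rs(3), of h e] h e by simp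
    also have "jdist F (\<gamma> r + e) (\<gamma> s + e) \<le> (s - r) + e \<bullet> integral {r..s} A + \<eta> * norm e / f * (s - r)"
      using shift_cost[OF b rs(1) _ \<eta>, of e] lin e h by simp
    finally show ?thesis
      unfolding X_def mom_def by (simp add: algebra_simps inner_commute diff_divide_distrib)
  qed
  show ?thesis
  proof (cases "X = 0")
    case True
    have "f \<le> B" using F_lower[OF in_patch_self[OF b(1)]] F_upper[OF in_patch_self[OF b(1)]] by linarith
    then have "0 \<le> K" using pos unfolding K_def by simp
    then show ?thesis using True h \<eta> rs pos unfolding X_def[symmetric] by simp
  next
    case False
    \<comment> \<open>This size balances the error terms \<open>h\<^sup>2 / \<epsilon>\<close> and \<open>\<epsilon> / h\<close>.\<close>
    define \<epsilon> where "\<epsilon> = h * sqrt h"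
    have \<epsilon>: "0 < \<epsilon>" "\<epsilon> \<le> h" using h by (auto simp: \<epsilon>_def mult_left_le)
    define e where "e = (\<epsilon> / norm X) *\<^sub>R X"
    have e: "norm e = \<epsilon>" "e \<bullet> X = \<epsilon> * norm X" using False \<epsilon> 
      by (auto simp: e_def power2_norm_eq_inner[symmetric] power2_eq_square)
    have "\<epsilon> * norm X \<le> 2 * K * (h\<^sup>2 + \<epsilon>\<^sup>2 / h) + \<eta> * \<epsilon> / f * (s - r)" using *[of e] e \<epsilon> by simp
    also have "h\<^sup>2 + \<epsilon>\<^sup>2 / h = \<epsilon> * (2 * sqrt h)"
      using h by (simp add: \<epsilon>_def power2_eq_square mult_ac)
    finally have "\<epsilon> * norm X \<le> \<epsilon> * (4 * K * sqrt h + \<eta> / f * (s - r))"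
      by (simp add: algebra_simps)
    then show ?thesis using \<epsilon> unfolding X_def[symmetric] by simp
  qed
qed

text \<open>Mean value theorem along the segment, with \<open>DF\<close> uniformly continuous so
  that \<open>d\<close> does not depend on \<open>x\<close>. The estimate is one-sided because costs
  of competitors are only bounded from above.\<close>

lemma F_expand:
  assumes "\<eta> > 0"
  shows "\<exists>d>0. \<forall>x\<in>cball x0 (\<rho> / 4). \<forall>e. norm e \<le> d \<longrightarrow> F (x + e) \<le> F x + e \<bullet> DF x + \<eta> * norm e"
proof -
  have "uniformly_continuous_on (cball x0 \<rho>) DF"
    by (intro compact_uniformly_continuous cont_DF) auto
  then obtain d where d: "0 < d" "\<And>x y. x \<in> cball x0 \<rho> \<Longrightarrow> y \<in> cball x0 \<rho> \<Longrightarrow> dist y x < d \<Longrightarrow> dist (DF y) (DF x) < \<eta>"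
    unfolding uniformly_continuous_on_def using assms by metis
  show ?thesis
  proof (intro exI[of _ "min (d / 2) (\<rho> / 4)"] conjI ballI allI impI)
    fix x e :: 'a assume x: "x \<in> cball x0 (\<rho> / 4)" and e: "norm e \<le> min (d / 2) (\<rho> / 4)"
    have inb: "x + u *\<^sub>R e \<in> cball x0 \<rho>" "norm (u *\<^sub>R e) < d" if "0 \<le> u" "u \<le> 1" for u
    proof -
      have "norm (u *\<^sub>R e) \<le> norm e" using that by (simp add: mult_left_le_one_le)
      then show "norm (u *\<^sub>R e) < d" "x + u *\<^sub>R e \<in> cball x0 \<rho>"
        using x e d(1) pos(2) norm_triangle_ineq4[of "x0 - x" "u *\<^sub>R e"] by (auto simp: dist_norm algebra_simps)
    qed
    have "\<exists>z>0. z < 1 \<and> F (x + 1 *\<^sub>R e) - F (x + 0 *\<^sub>R e) = (1 - 0) * (e \<bullet> DF (x + z *\<^sub>R e))"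
    proof (rule MVT2)
      fix u :: real assume u: "0 \<le> u" "u \<le> 1"
      have "(F has_derivative (\<lambda>h. h \<bullet> DF (x + u *\<^sub>R e))) (at (x + u *\<^sub>R e))"
        using F_grad[OF inb(1)[OF u]] by (simp add: gderiv_def)
      moreover have "((\<lambda>u. x + u *\<^sub>R e) has_derivative (\<lambda>h. h *\<^sub>R e)) (at u)"
        by (auto intro!: derivative_eq_intros)
      ultimately have "((\<lambda>u. F (x + u *\<^sub>R e)) has_derivative (\<lambda>h. (h *\<^sub>R e) \<bullet> DF (x + u *\<^sub>R e))) (at u)"
        using has_derivative_compose by fastforce
      then show "((\<lambda>u. F (x + u *\<^sub>R e)) has_real_derivative e \<bullet> DF (x + u *\<^sub>R e)) (at u)"
        by (simp add: has_field_derivative_def mult_commute_abs)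
    qed simp
    then obtain z where z: "0 < z" "z < 1" "F (x + e) - F x = e \<bullet> DF (x + z *\<^sub>R e)" by auto
    have "e \<bullet> (DF (x + z *\<^sub>R e) - DF x) \<le> norm e * \<eta>"
    proof -
      have "norm (DF (x + z *\<^sub>R e) - DF x) \<le> \<eta>"
        using d(2)[of x "x + z *\<^sub>R e"] inb[of z] inb[of 0] z by (simp add: dist_norm less_imp_le)
      then show ?thesis
        by (meson mult_left_mono norm_cauchy_schwarz norm_ge_zero order_trans)
    qed
    then show "F (x + e) \<le> F x + e \<bullet> DF x + \<eta> * norm e"
      using z(3) by (simp add: inner_diff_right mult.commute)
  qed (use d pos in auto)
qed

text \<open>A subsequence is extracted at the single point \<open>r\<close>, where the backward
  quotients are bounded by \<open>B\<^sup>2 / f\<close>. The balance then transfers convergence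
  along the same sequence to every \<open>s\<close> and yields the formula for the limit.\<close>

lemma momentum_limit:
  "\<exists>h \<pi>0. (\<forall>n. 0 < h n \<and> h n \<le> \<delta> / 4) \<and> h \<longlonglongrightarrow> 0 \<and>
    (\<forall>s\<in>{s0 - \<delta> / 2..s0 + \<delta> / 2}. (\<lambda>n. mom s (h n)) \<longlonglongrightarrow> \<pi>0 + integral {s0 - \<delta> / 2..s} A)"
proof -
  define r where "r = s0 - \<delta> / 2"
  define h0 where "h0 = min 1 (min (\<rho> / 4) (\<delta> / 4))"
  have h0: "0 < h0" "h0 \<le> 1" "h0 \<le> \<rho> / 4" "h0 \<le> \<delta> / 4" using pos by (auto simp: h0_def)
  define g where "g n = h0 / real (Suc n)" for n
  have g: "0 < g n" "g n \<le> h0" for n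
    using h0 by (auto simp: g_def divide_simps mult_le_cancel_left1)
  have g0: "g \<longlonglongrightarrow> 0"
    unfolding g_def using LIMSEQ_Suc[OF lim_const_over_n[of h0]] by simp
  have "norm (mom r (- g n)) \<le> B\<^sup>2 / f" for n
  proof -
    have b: "r \<in> ball s0 \<delta>" "r + - g n \<in> ball s0 \<delta>" using g[of n] h0 pos by (auto simp: r_def dist_real_def)
    have "norm (\<gamma> (r + - g n) - \<gamma> r) \<le> g n / f" using \<gamma>_lip[OF b] g(1)[of n] by simp
    moreover have "(F (\<gamma> r))\<^sup>2 \<le> B\<^sup>2" using F_upper[OF in_patch_self[OF b(1)]] F\<gamma>_pos[OF b(1)]
      by (intro power_mono) auto
    ultimately have "(F (\<gamma> r))\<^sup>2 / g n * norm (\<gamma> (r + - g n) - \<gamma> r) \<le> B\<^sup>2 / g n * (g n / f)"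
      using g(1)[of n] by (intro mult_mono divide_right_mono) auto
    then show ?thesis using g(1)[of n] by (simp add: mom_def)
  qed
  then have "bounded (range (\<lambda>n. mom r (- g n)))" by (auto simp: bounded_iff)
  then obtain \<pi>0 k where k: "strict_mono k" "((\<lambda>n. mom r (- g n)) \<circ> k) \<longlonglongrightarrow> \<pi>0"
    using bounded_imp_convergent_subsequence by blast
  define h where "h n = g (k n)" for n
  have h: "0 < h n" "h n \<le> h0" for n using g by (auto simp: h_def)
  have "h = g \<circ> k" by (auto simp: h_def)
  then have hlim: "h \<longlonglongrightarrow> 0" using LIMSEQ_subseq_LIMSEQ[OF g0 k(1)] by simp
  have \<pi>0: "(\<lambda>n. mom r (- h n)) \<longlonglongrightarrow> \<pi>0" using k(2) by (simp add: h_def comp_def)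
  have "(\<lambda>n. mom s (h n)) \<longlonglongrightarrow> \<pi>0 + integral {r..s} A" if s: "s \<in> {r..s0 + \<delta> / 2}" for s
  proof -
    have "(\<lambda>n. mom s (h n) - mom r (- h n) - integral {r..s} A) \<longlonglongrightarrow> 0"
    proof (rule tendstoI)
      fix \<epsilon> :: real assume \<epsilon>: "0 < \<epsilon>"
      \<comment> \<open>The summand 1 keeps the denominator positive when
        \<open>s = r\<close>.\<close>
      define k where "k = (s - r) / f + 1"
      define \<eta> where "\<eta> = \<epsilon> / 2 / k"
      have den: "0 < k" unfolding k_def using s pos by (intro add_nonneg_pos divide_nonneg_pos) auto
      then have \<eta>: "0 < \<eta>" "\<eta> / f * (s - r) \<le> \<epsilon> / 2"
      proof -
        show "0 < \<eta>" using den \<epsilon> unfolding \<eta>_def by (intro divide_pos_pos) auto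
        have "\<eta> / f * (s - r) \<le> \<eta> * k" using \<open>0 < \<eta>\<close> by (simp add: k_def algebra_simps)
        also have "\<dots> = \<epsilon> / 2" using den by (simp add: \<eta>_def)
        finally show "\<eta> / f * (s - r) \<le> \<epsilon> / 2" .
      qed
      obtain d where d: "0 < d" "\<And>x e. x \<in> cball x0 (\<rho> / 4) \<Longrightarrow> norm e \<le> d \<Longrightarrow> F (x + e) \<le> F x + e \<bullet> DF x + \<eta> * norm e"
        using F_expand[OF \<eta>(1)] by blast
      have "(\<lambda>n. 4 * K * sqrt (h n)) \<longlonglongrightarrow> 4 * K * sqrt 0" by (intro tendsto_intros hlim)
      then have "(\<lambda>n. 4 * K * sqrt (h n)) \<longlonglongrightarrow> 0" by simp
      then have "\<forall>\<^sub>F n in sequentially. 4 * K * sqrt (h n) < \<epsilon> / 2"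
        using \<epsilon> by (intro order_tendstoD(2)) auto
      moreover have "\<forall>\<^sub>F n in sequentially. h n < d" using hlim d(1) by (rule order_tendstoD(2))
      ultimately show "\<forall>\<^sub>F n in sequentially. dist (mom s (h n) - mom r (- h n) - integral {r..s} A) 0 < \<epsilon>"
      proof eventually_elim
        case (elim n)
        have "norm (mom s (h n) - mom r (- h n) - integral {r..s} A) \<le> 4 * K * sqrt (h n) + \<eta> / f * (s - r)"
        proof (rule momentum_balance)
          show "r - h n \<in> ball s0 \<delta>" "s + h n \<in> ball s0 \<delta>"
            using h[of n] h0 s pos by (auto simp: r_def dist_real_def)
        qed (use s h[of n] h0 \<eta> d elim in auto)
        then show ?case using elim(1) \<eta>(2) unfolding dist_0_norm dist_commute[of _ 0] by linarith
      qed
    qed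
    from tendsto_add[OF tendsto_add[OF this \<pi>0] tendsto_const[of "integral {r..s} A"]]
    show ?thesis by simp
  qed
  moreover have "h n \<le> \<delta> / 4" for n using h(2)[of n] h0(4) by linarith
  ultimately show ?thesis using h(1) hlim unfolding r_def
    by (intro exI[of _ h] exI[of _ \<pi>0] conjI allI ballI) blast+
qed

text \<open>Difference quotients are known to converge only along one sequence. Their integrals
  converge to the integral of \<open>g\<close> by dominated convergence, and to an increment of
  \<open>\<gamma>\<close> as differences of averages. So \<open>\<gamma>\<close> is a primitive of
  the continuous \<open>g\<close> and differentiable in the full sense.\<close>

lemma geodesic_C1:
  "\<exists>\<pi>. \<forall>s\<in>{s0 - \<delta> / 2<..<s0 + \<delta> / 2}. (\<gamma> has_vector_derivative (\<pi> s /\<^sub>R (F (\<gamma> s))\<^sup>2)) (at s) \<and>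
    (\<pi> has_vector_derivative A s) (at s) \<and> norm (\<pi> s) = F (\<gamma> s)"
proof -
  define r u where "r = s0 - \<delta> / 2" and "u = s0 + \<delta> / 2"
  have ru: "r < u" "{r..u} \<subseteq> ball s0 \<delta>" using pos by (auto simp: r_def u_def dist_real_def)
  obtain h \<pi>0 where h: "\<And>n. 0 < h n" "\<And>n. h n \<le> \<delta> / 4" "h \<longlonglongrightarrow> 0"
    and lim: "\<And>s. s \<in> {r..u} \<Longrightarrow> (\<lambda>n. mom s (h n)) \<longlonglongrightarrow> \<pi>0 + integral {r..s} A"
    using momentum_limit unfolding r_def u_def by metis
  define \<pi> where "\<pi> s = \<pi>0 + integral {r..s} A" for s
  have contA: "continuous_on {r..u} A" by (rule continuous_on_subset[OF cont_A ru(2)])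
  have d\<pi>: "(\<pi> has_vector_derivative A s) (at s within {r..u})" if "s \<in> {r..u}" for s
    unfolding \<pi>_def using integral_has_vector_derivative[OF contA that]
    by (auto intro!: derivative_eq_intros)
  have cont\<pi>: "continuous_on {r..u} \<pi>"
    using d\<pi> has_vector_derivative_continuous continuous_on_eq_continuous_within by blast
  define g where "g s = \<pi> s /\<^sub>R (F (\<gamma> s))\<^sup>2" for s
  have contg: "continuous_on {r..u} g"
    unfolding g_def using F\<gamma>_pos ru(2)
    by (intro continuous_intros cont\<pi> continuous_on_subset[OF cont_F\<gamma>]) (force)+
  define v where "v n s = (\<gamma> (s + h n) - \<gamma> s) /\<^sub>R h n" for n s
  have mv: "mom s (h n) = (F (\<gamma> s))\<^sup>2 *\<^sub>R v n s" for s n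
    by (simp add: mom_def v_def divide_inverse)
  have vlim: "(\<lambda>n. v n s) \<longlonglongrightarrow> g s" if s: "s \<in> {r..u}" for s
  proof -
    have "(\<lambda>n. mom s (h n) /\<^sub>R (F (\<gamma> s))\<^sup>2) \<longlonglongrightarrow> g s"
      unfolding g_def \<pi>_def by (intro tendsto_intros lim s)
    moreover have "F (\<gamma> s) \<noteq> 0" using F\<gamma>_pos[of s] s ru(2) by auto
    ultimately show ?thesis by (simp add: mv)
  qed
  have shb: "s + h n \<in> ball s0 \<delta>" "s \<in> ball s0 \<delta>" if "s \<in> {r..u}" for s n
    using that h(1,2)[of n] pos by (auto simp: r_def u_def dist_real_def)
  have vb: "norm (v n s) \<le> 1 / f" if "s \<in> {r..u}" for s n
  proof -
    have "norm (v n s) = norm (\<gamma> (s + h n) - \<gamma> s) / h n" 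
      using h(1)[of n] by (simp add: v_def divide_inverse mult.commute)
    also have "\<dots> \<le> h n / f / h n"
      using \<gamma>_lip[OF shb(2,1)[OF that], of n] h(1)[of n] by (intro divide_right_mono) auto
    finally show ?thesis using h(1)[of n] by simp
  qed
  have cont_shift: "continuous_on {r..u} (\<lambda>s. \<gamma> (s + h n))" for n
  proof (rule continuous_on_compose2[OF cont_\<gamma>])
    show "(\<lambda>s. s + h n) ` {r..u} \<subseteq> ball s0 \<delta>" using shb by blast
  qed (intro continuous_intros)
  have contv: "continuous_on {r..u} (v n)" for n
    unfolding v_def by (intro continuous_intros continuous_on_subset[OF cont_\<gamma> ru(2)] cont_shift)
  have incr: "\<gamma> t - \<gamma> r = integral {r..t} g" if t: "t \<in> {r..u}" for t
  proof -
    have tsub: "{r..t} \<subseteq> {r..u}" using t by auto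
    have "(\<lambda>n. integral {r..t} (v n)) \<longlonglongrightarrow> integral {r..t} g"
    proof (rule dominated_convergence(2))
      show "v n integrable_on {r..t}" for n
        by (rule integrable_continuous_real[OF continuous_on_subset[OF contv tsub]])
      show "(\<lambda>_. 1 / f) integrable_on {r..t}" by (rule integrable_const_ivl)
    qed (use vb vlim tsub in auto)
    moreover have "(\<lambda>n. integral {r..t} (v n)) \<longlonglongrightarrow> \<gamma> t - \<gamma> r"
    proof -
      \<comment> \<open>Beyond \<open>u\<close> there must be room for the shift
        \<open>h n \<le> \<delta> / 4\<close>.\<close>
      define w where "w = s0 + 3 * \<delta> / 4"
      have wsub: "{r..w} \<subseteq> ball s0 \<delta>" using pos by (auto simp: r_def w_def dist_real_def)
      have contw: "continuous_on {r..w} \<gamma>" by (rule continuous_on_subset[OF cont_\<gamma> wsub])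
      have intw: "\<gamma> integrable_on {c..d}" if "r \<le> c" "d \<le> w" for c d
        by (rule integrable_continuous_real[OF continuous_on_subset[OF contw]]) (use that in auto)
      define \<Gamma> where "\<Gamma> c = integral {r..c} \<gamma>" for c
      have quot: "(\<lambda>n. (\<Gamma> (c + h n) - \<Gamma> c) /\<^sub>R h n) \<longlonglongrightarrow> \<gamma> c" if c: "c \<in> {r..u}" for c
      proof -
        have cw: "c \<in> {r..w}" "c < w" using c pos by (auto simp: u_def w_def)
        have "(\<Gamma> has_vector_derivative \<gamma> c) (at c within {r..w})"
          unfolding \<Gamma>_def by (rule integral_has_vector_derivative[OF contw cw(1)])
        then have L: "((\<lambda>y. (1 / norm (y - c)) *\<^sub>R (\<Gamma> y - (\<Gamma> c + (y - c) *\<^sub>R \<gamma> c))) \<longlongrightarrow> 0) (at c within {r..w})"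
          by (simp add: has_vector_derivative_def has_derivative_within)
        have "filterlim (\<lambda>n. c + h n) (at c within {r..w}) sequentially"
          unfolding filterlim_at
        proof (intro conjI always_eventually allI)
          show "(\<lambda>n. c + h n) \<longlonglongrightarrow> c" using tendsto_add[OF tendsto_const h(3), of c] by simp
          fix n
          show "c + h n \<noteq> c" using h(1)[of n] by simp
          show "c + h n \<in> {r..w}" using h(1,2)[of n] c pos by (simp add: w_def u_def r_def)
        qed
        then have "(\<lambda>n. (1 / norm (c + h n - c)) *\<^sub>R (\<Gamma> (c + h n) - (\<Gamma> c + (c + h n - c) *\<^sub>R \<gamma> c))) \<longlonglongrightarrow> 0"
          using filterlim_compose[OF L] by blast
        from tendsto_add[OF this tendsto_const[of "\<gamma> c"]]
        have "(\<lambda>n. (1 / h n) *\<^sub>R (\<Gamma> (c + h n) - (\<Gamma> c + h n *\<^sub>R \<gamma> c)) + \<gamma> c) \<longlonglongrightarrow> \<gamma> c"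
          using h(1) by (simp add: abs_of_pos)
        moreover have "(1 / h n) *\<^sub>R (\<Gamma> (c + h n) - (\<Gamma> c + h n *\<^sub>R \<gamma> c)) + \<gamma> c = (\<Gamma> (c + h n) - \<Gamma> c) /\<^sub>R h n" for n
          using h(1)[of n] by (simp add: algebra_simps divide_inverse)
        ultimately show ?thesis by simp
      qed
      have "integral {r..t} (v n) = (\<Gamma> (t + h n) - \<Gamma> t) /\<^sub>R h n - (\<Gamma> (r + h n) - \<Gamma> r) /\<^sub>R h n" for n
      proof -
        have hn: "t + h n \<le> w" "0 < h n" "r \<le> t" using t h(1,2)[of n] pos by (auto simp: u_def w_def)
        have "integral {r..t} (\<lambda>s. \<gamma> (s + h n)) = integral {r + h n..t + h n} \<gamma>"
          using integral_shift_real_ivl[of "r + h n" "h n" "t + h n" \<gamma>] by simp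
        also have "\<dots> = \<Gamma> (t + h n) - \<Gamma> (r + h n)"
          using Henstock_Kurzweil_Integration.integral_combine[of r "r + h n" "t + h n" \<gamma>] hn intw[of r "t + h n"]
          by (simp add: \<Gamma>_def algebra_simps)
        finally have sh: "integral {r..t} (\<lambda>s. \<gamma> (s + h n)) = \<Gamma> (t + h n) - \<Gamma> (r + h n)" .
        have "(\<lambda>s. \<gamma> (s + h n)) integrable_on {r..t}"
          by (rule integrable_continuous_real[OF continuous_on_subset[OF cont_shift tsub]])
        then have "integral {r..t} (\<lambda>s. \<gamma> (s + h n) - \<gamma> s) = \<Gamma> (t + h n) - \<Gamma> (r + h n) - \<Gamma> t"
          using intw[of r t] hn by (simp add: integral_diff sh \<Gamma>_def)
        moreover have "integral {r..t} (v n) = integral {r..t} (\<lambda>s. \<gamma> (s + h n) - \<gamma> s) /\<^sub>R h n"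
          unfolding v_def by (rule integral_cmul)
        ultimately show ?thesis by (simp add: \<Gamma>_def[of r] scaleR_diff_right)
      qed
      then show ?thesis using tendsto_diff[OF quot[OF t] quot[of r]] ru(1) by simp
    qed
    ultimately show ?thesis using LIMSEQ_unique by blast
  qed
  have "(\<gamma> has_vector_derivative g s) (at s)" "(\<pi> has_vector_derivative A s) (at s)" "norm (\<pi> s) = F (\<gamma> s)"
    if s: "s \<in> {r<..<u}" for s
  proof -
    have at: "at s within {r..u} = at s" using s by (intro at_within_interior) auto
    show "(\<pi> has_vector_derivative A s) (at s)" using d\<pi>[of s] s at by simp
    have "((\<lambda>t. \<gamma> r + integral {r..t} g) has_vector_derivative g s) (at s within {r..u})"
      using integral_has_vector_derivative[OF contg, of s] s by (auto intro!: derivative_eq_intros)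
    then have "(\<gamma> has_vector_derivative g s) (at s within {r..u})"
    proof (rule has_vector_derivative_transform[rotated 2])
      fix t assume "t \<in> {r..u}"
      then show "\<gamma> t = \<gamma> r + integral {r..t} g" using incr[of t] by (metis add_diff_cancel_left' diff_add_cancel add.commute)
    qed (use s in simp)
    then show "(\<gamma> has_vector_derivative g s) (at s)" using at by simp
    have "s \<in> {r..u}" using s by simp
    then have Fp: "0 < F (\<gamma> s)" using F\<gamma>_pos[of s] ru(2) by blast
    have n: "F (\<gamma> s) * norm (v n s) = F (\<gamma> s) * norm (\<gamma> (s + h n) - \<gamma> s) / h n" for n
      using h(1)[of n] by (simp add: v_def divide_inverse mult.commute)
    have s': "s \<in> {r..u}" using s by simp
    have up: "F (\<gamma> s) * norm (v n s) \<le> 1 + M / f\<^sup>2 * h n" for n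
      using divide_right_mono[OF chord_upper[OF shb(2,1)[OF s'], of n], of "h n"] h(1)[of n]
      by (simp add: n add_divide_distrib power2_eq_square)
    have lo: "1 - M / f\<^sup>2 * h n \<le> F (\<gamma> s) * norm (v n s)" for n
      using divide_right_mono[OF chord_lower[OF shb(2,1)[OF s'], of n], of "h n"] h(1)[of n]
      by (simp add: n diff_divide_distrib power2_eq_square)
    have "(\<lambda>n. 1 + M / f\<^sup>2 * h n) \<longlonglongrightarrow> 1 + M / f\<^sup>2 * 0" "(\<lambda>n. 1 - M / f\<^sup>2 * h n) \<longlonglongrightarrow> 1 - M / f\<^sup>2 * 0"
      by (intro tendsto_intros h(3))+
    then have lims: "(\<lambda>n. 1 + M / f\<^sup>2 * h n) \<longlonglongrightarrow> 1" "(\<lambda>n. 1 - M / f\<^sup>2 * h n) \<longlonglongrightarrow> 1" by simp_all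
    \<comment> \<open>The upper and the lower chord estimate squeeze this to 1, which fixes the
      length of \<open>\<pi>\<close>.\<close>
    have "(\<lambda>n. F (\<gamma> s) * norm (v n s)) \<longlonglongrightarrow> 1"
      by (rule tendsto_sandwich[OF always_eventually[OF allI[OF lo]] always_eventually[OF allI[OF up]] lims(2,1)])
    moreover have "(\<lambda>n. F (\<gamma> s) * norm (v n s)) \<longlonglongrightarrow> F (\<gamma> s) * norm (g s)"
      by (intro tendsto_intros vlim s')
    ultimately have "F (\<gamma> s) * norm (g s) = 1" using LIMSEQ_unique by blast
    moreover have "norm (g s) = norm (\<pi> s) / (F (\<gamma> s))\<^sup>2" by (simp add: g_def divide_inverse mult.commute)
    ultimately have "norm (\<pi> s) / F (\<gamma> s) = 1" using Fp by (simp add: power2_eq_square)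
    then show "norm (\<pi> s) = F (\<gamma> s)" using Fp by simp
  qed
  then show ?thesis unfolding g_def r_def u_def by blast
qed

end

section \<open>The Young function\<close>

locale young_function =
  fixes \<phi> :: "real \<Rightarrow> real" and l :: real
  assumes \<phi>_pos: "s > 0 \<Longrightarrow> \<phi> s > 0"
    and \<phi>_C1: "\<phi> C1_differentiable_on {0<..}"
    and l: "1 < l"
    and p_deriv_pos: "s > 0 \<Longrightarrow> deriv (\<lambda>r. \<phi> r * r) s > 0"
    and p_deriv_lower: "s > 0 \<Longrightarrow> l - 1 \<le> deriv (\<lambda>r. \<phi> r * r) s / \<phi> s"
begin

definition p where "p s = \<phi> s * s"
definition p' where "p' = deriv p"

lemma p_DERIV: "s > 0 \<Longrightarrow> (p has_real_derivative p' s) (at s)"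
  and cont_p': "continuous_on {0<..} p'"
proof -
  obtain D where D: "\<And>s. s > 0 \<Longrightarrow> (\<phi> has_real_derivative D s) (at s)" "continuous_on {0<..} D"
    using \<phi>_C1 unfolding C1_differentiable_on_def has_real_derivative_iff_has_vector_derivative by auto
  have d: "(p has_real_derivative (D s * s + \<phi> s)) (at s)" if "s > 0" for s
    unfolding p_def using D(1)[OF that] by (auto intro!: derivative_eq_intros)
  then have p': "p' s = D s * s + \<phi> s" if "s > 0" for s
    unfolding p'_def using DERIV_imp_deriv that by blast
  show "s > 0 \<Longrightarrow> (p has_real_derivative p' s) (at s)" using d p' by simp
  have "continuous_on {0<..} \<phi>"
  proof (rule DERIV_continuous_on)
    fix s :: real assume "s \<in> {0<..}"
    then show "(\<phi> has_real_derivative D s) (at s within {0<..})"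
      using D(1)[of s] by (auto intro: has_field_derivative_at_within)
  qed
  then have "continuous_on {0<..} (\<lambda>s. D s * s + \<phi> s)" by (intro continuous_intros D(2))
  then show "continuous_on {0<..} p'" by (rule continuous_on_cong[THEN iffD1, rotated 2]) (auto simp: p')
qed

text \<open>The factor \<open>s\<close> makes this hold whatever the value of \<open>\<phi>\<close>
  at 0.\<close>

lemma p_0 [simp]: "p 0 = 0" by (simp add: p_def)

lemma p_pos: "s > 0 \<Longrightarrow> p s > 0" using \<phi>_pos by (simp add: p_def)

lemma p_nonneg: "s \<ge> 0 \<Longrightarrow> p s \<ge> 0" using p_pos[of s] by (cases "s = 0") auto

lemma p'_pos: "s > 0 \<Longrightarrow> p' s > 0"
  using p_deriv_pos unfolding p'_def p_def[abs_def] .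

lemma p'_lower: assumes "s > 0" shows "(l - 1) * p s \<le> s * p' s"
proof -
  have "(l - 1) * \<phi> s \<le> p' s"
    using p_deriv_lower[OF assms] \<phi>_pos[OF assms] unfolding p'_def p_def[abs_def] by (simp add: field_simps)
  then have "s * ((l - 1) * \<phi> s) \<le> s * p' s" using assms by (intro mult_left_mono) auto
  then show ?thesis by (simp add: p_def mult_ac)
qed

lemma p_mono: assumes "0 \<le> s" "s \<le> t" shows "p s \<le> p t"
proof (cases "s = 0")
  case False
  show ?thesis
  proof (rule DERIV_nonneg_imp_nondecreasing[OF assms(2)])
    fix x assume "s \<le> x"
    then have "x > 0" using assms False by simp
    then show "\<exists>y. (p has_real_derivative y) (at x) \<and> 0 \<le> y"
      using p_DERIV[of x] p'_pos[of x] less_imp_le by blast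
  qed
qed (use p_nonneg[of t] assms in simp)

text \<open>\<open>p'_lower\<close> says that \<open>ln (p s) - (l - 1) * ln s\<close> is
  nondecreasing. As \<open>l > 1\<close>, the resulting bound makes \<open>p\<close> continuous at
  0.\<close>

lemma p_le_powr: assumes "0 < s" "s \<le> 1" shows "p s \<le> p 1 * s powr (l - 1)"
proof -
  have "ln (p s) - (l - 1) * ln s \<le> ln (p 1) - (l - 1) * ln 1"
  proof (rule DERIV_nonneg_imp_nondecreasing[OF assms(2)])
    fix x assume "s \<le> x"
    then have x: "x > 0" using assms by simp
    have "((\<lambda>s. ln (p s) - (l - 1) * ln s) has_real_derivative (p' x / p x - (l - 1) / x)) (at x)"
      using p_DERIV[OF x] p_pos[OF x] x by (auto intro!: derivative_eq_intros)
    moreover have "p' x / p x - (l - 1) / x \<ge> 0"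
      using p'_lower[OF x] p_pos[OF x] x by (simp add: divide_simps mult_ac)
    ultimately show "\<exists>y. ((\<lambda>s. ln (p s) - (l - 1) * ln s) has_real_derivative y) (at x) \<and> 0 \<le> y" by blast
  qed
  then have "exp (ln (p s)) \<le> exp (ln (p 1) + (l - 1) * ln s)" by simp
  then show ?thesis using p_pos[OF assms(1)] p_pos[of 1] assms(1) by (simp add: exp_add powr_def)
qed

lemma cont_p: "continuous_on {0..} p"
proof -
  have "continuous (at s within {0..}) p" if "s \<ge> 0" for s
  proof (cases "s = 0")
    case True
    have "(p \<longlongrightarrow> 0) (at_right 0)"
    proof (rule tendsto_sandwich[of "\<lambda>_. 0"])
      show "\<forall>\<^sub>F s in at_right 0. 0 \<le> p s" unfolding eventually_at_filter using p_nonneg by simp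
      have "\<forall>\<^sub>F s in at_right (0::real). s < 1" by (rule order_tendstoD(2)[OF tendsto_ident_at]) simp
      then show "\<forall>\<^sub>F s in at_right 0. p s \<le> p 1 * s powr (l - 1)"
        using eventually_at_right_less[of 0] by eventually_elim (auto intro: p_le_powr)
      have "((\<lambda>s. p 1 * s powr (l - 1)) \<longlongrightarrow> p 1 * 0 powr (l - 1)) (at_right 0)"
        using l by (intro tendsto_intros tendsto_powr') (auto simp: eventually_at_filter)
      then show "((\<lambda>s. p 1 * s powr (l - 1)) \<longlongrightarrow> 0) (at_right 0)" by simp
    qed simp
    moreover have "at 0 within {0..} = at_right (0::real)" by (rule at_within_Ici_at_right)
    ultimately show ?thesis using True by (simp add: continuous_within)
  next
    case False
    then show ?thesis using p_DERIV[of s] that by (auto intro: continuous_at_imp_continuous_at_within DERIV_isCont)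
  qed
  then show ?thesis by (simp add: continuous_on_eq_continuous_within)
qed

lemma p_integrable: "0 \<le> a \<Longrightarrow> p integrable_on {a..b}"
  by (rule integrable_continuous_real[OF continuous_on_subset[OF cont_p]]) auto

lemma Phi_eq: "0 \<le> s \<Longrightarrow> Phi \<phi> s = integral {0..s} p"
  by (simp add: Phi_def p_def[abs_def])

lemma Phi_diff: assumes "0 \<le> s" "s \<le> t" shows "Phi \<phi> t - Phi \<phi> s = integral {s..t} p"
  using Henstock_Kurzweil_Integration.integral_combine[of 0 s t p] p_integrable[of 0 t] assms
  by (simp add: Phi_eq)

lemma Phi_DERIV: "s > 0 \<Longrightarrow> (Phi \<phi> has_real_derivative p s) (at s)"
  and cont_Phi: "continuous_on {0..} (Phi \<phi>)"
proof -
  have d: "(Phi \<phi> has_real_derivative p s) (at s within {0..s + 1})" if "s \<ge> 0" for s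
  proof -
    have "((\<lambda>t. integral {0..t} p) has_real_derivative p s) (at s within {0..s + 1})"
      using that by (intro integral_has_real_derivative continuous_on_subset[OF cont_p]) auto
    then show ?thesis
      by (rule has_field_derivative_transform_within[of _ _ _ _ 1]) (use that in \<open>auto simp: Phi_eq\<close>)
  qed
  show "(Phi \<phi> has_real_derivative p s) (at s)" if "s > 0"
  proof -
    have "at s within {0..s + 1} = at s" using that by (intro at_within_interior) auto
    then show ?thesis using d[of s] that by simp
  qed
  have "continuous (at s within {0..}) (Phi \<phi>)" if "s \<ge> 0" for s
  proof -
    have "continuous (at s within {0..s + 1}) (Phi \<phi>)" using d[OF that] by (rule DERIV_continuous)
    moreover have "at s within {0..s + 1} = at s within {0..}"
      by (rule at_within_nhd[of _ "{..<s + 1}"]) (use that in auto)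
    ultimately show ?thesis by simp
  qed
  then show "continuous_on {0..} (Phi \<phi>)" by (simp add: continuous_on_eq_continuous_within)
qed

lemma Phi_0 [simp]: "Phi \<phi> 0 = 0" by (simp add: Phi_def)

text \<open>Convexity: the derivative \<open>p\<close> of \<open>Phi \<phi>\<close> is
  nondecreasing.\<close>

lemma Phi_tangent: assumes "0 \<le> s" "0 \<le> a" shows "Phi \<phi> s + p s * (a - s) \<le> Phi \<phi> a"
proof (cases "s \<le> a")
  case True
  have "integral {s..a} (\<lambda>_. p s) \<le> integral {s..a} p"
    using assms p_mono by (intro integral_le p_integrable) auto
  then show ?thesis using Phi_diff[OF assms(1) True] True by (simp add: mult.commute)
next
  case False
  have "integral {a..s} p \<le> integral {a..s} (\<lambda>_. p s)"
    using assms p_mono by (intro integral_le p_integrable) auto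
  then show ?thesis using Phi_diff[OF assms(2), of s] False by (simp add: algebra_simps)
qed

section \<open>The energy function of the speed and its inverse\<close>

definition G where "G s = s * p s - Phi \<phi> s"

lemma G_fun_eq: "0 \<le> s \<Longrightarrow> G_fun \<phi> s = G s"
  by (simp add: G_fun_def G_def p_def power2_eq_square)

lemma G_0 [simp]: "G 0 = 0" by (simp add: G_def)

lemma G_DERIV: "s > 0 \<Longrightarrow> (G has_real_derivative s * p' s) (at s)"
  unfolding G_def[abs_def] by (auto intro!: derivative_eq_intros p_DERIV Phi_DERIV)

lemma cont_G: "continuous_on {0..} G"
  unfolding G_def[abs_def] by (intro continuous_intros cont_p cont_Phi)

lemma G_strict_mono: assumes "0 \<le> s" "s < t" shows "G s < G t"
proof (rule DERIV_pos_imp_increasing_open[OF assms(2)])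
  show "continuous_on {s..t} G" using cont_G by (rule continuous_on_subset) (use assms in auto)
  fix x assume "s < x"
  then have "x > 0" using assms by simp
  then show "\<exists>y. (G has_real_derivative y) (at x) \<and> 0 < y" using G_DERIV p'_pos mult_pos_pos by blast
qed

text \<open>For \<open>s \<ge> 1\<close> the derivative \<open>s * p' s\<close> is at least
  \<open>(l - 1) * p 1 > 0\<close>, so \<open>G\<close> grows at least linearly and the intermediate
  value theorem applies.\<close>

lemma G_surj: assumes "0 \<le> w" shows "\<exists>s\<ge>0. G s = w"
proof -
  define c where "c = (l - 1) * p 1"
  have c: "c > 0" using l p_pos[of 1] by (simp add: c_def)
  have lower: "G 1 + c * (s - 1) \<le> G s" if "1 \<le> s" for s
  proof -
    have "G 1 - c * 1 \<le> G s - c * s"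
    proof (rule DERIV_nonneg_imp_nondecreasing[OF that])
      fix x :: real assume x: "1 \<le> x"
      have "((\<lambda>s. G s - c * s) has_real_derivative (x * p' x - c)) (at x)"
        using G_DERIV[of x] x by (auto intro!: derivative_eq_intros)
      moreover have "c \<le> (l - 1) * p x" using p_mono[of 1 x] x l by (simp add: c_def)
      then have "x * p' x - c \<ge> 0" using p'_lower[of x] x by simp
      ultimately show "\<exists>y. ((\<lambda>s. G s - c * s) has_real_derivative y) (at x) \<and> 0 \<le> y" by blast
    qed
    then show ?thesis by (simp add: algebra_simps)
  qed
  define b where "b = 1 + w / c"
  have b: "1 \<le> b" using assms c by (simp add: b_def)
  have "w \<le> G b" using lower[OF b] G_strict_mono[of 0 1] c by (simp add: b_def)
  then have "\<exists>s\<ge>0. s \<le> b \<and> G s = w"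
    using assms b by (intro IVT' continuous_on_subset[OF cont_G]) auto
  then show ?thesis by blast
qed

definition sp where "sp w = (THE s. 0 \<le> s \<and> G s = w)"

lemma G_inj: "0 \<le> s \<Longrightarrow> 0 \<le> t \<Longrightarrow> G s = G t \<Longrightarrow> s = t"
  using G_strict_mono[of s t] G_strict_mono[of t s] by (cases s t rule: linorder_cases) auto

lemma sp: assumes "0 \<le> w" shows "0 \<le> sp w" "G (sp w) = w"
proof -
  have "\<exists>!s. 0 \<le> s \<and> G s = w" using G_surj[OF assms] G_inj by blast
  from theI'[OF this] show "0 \<le> sp w" "G (sp w) = w" by (auto simp: sp_def)
qed

lemma sp_G: "0 \<le> s \<Longrightarrow> sp (G s) = s"
  using sp[of "G s"] G_inj G_strict_mono[of 0 s] by (cases "s = 0") fastforce+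

lemma sp_0 [simp]: "sp 0 = 0" using sp_G[of 0] by simp

lemma sp_mono: assumes "0 \<le> v" "v \<le> w" shows "sp v \<le> sp w"
  using G_strict_mono[of "sp w" "sp v"] sp[of v] sp[of w] assms by fastforce

lemma sp_pos: "0 < w \<Longrightarrow> 0 < sp w"
  using sp[of w] by (cases "sp w = 0") auto

lemma isCont_sp: assumes "0 < w" shows "isCont sp w"
proof -
  have s: "0 < sp w" by (rule sp_pos[OF assms])
  have "isCont sp (G (sp w))"
  proof (rule isCont_inverse_function[where f = G and d = "sp w / 2"])
    show "0 < sp w / 2" using s by simp
    show "\<And>z. \<bar>z - sp w\<bar> \<le> sp w / 2 \<Longrightarrow> sp (G z) = z" using s by (intro sp_G) linarith
    fix z assume "\<bar>z - sp w\<bar> \<le> sp w / 2"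
    then have "0 < z" using s by linarith
    then show "isCont G z" using G_DERIV DERIV_isCont by blast
  qed
  then show ?thesis using sp(2)[of w] assms by simp
qed

lemma sp_DERIV: assumes "0 < w" shows "(sp has_real_derivative inverse (sp w * p' (sp w))) (at w)"
proof (rule DERIV_inverse_function[where f = G and a = 0 and b = "w + 1"])
  show "(G has_real_derivative sp w * p' (sp w)) (at (sp w))" by (rule G_DERIV[OF sp_pos[OF assms]])
  show "sp w * p' (sp w) \<noteq> 0" using sp_pos[OF assms] p'_pos[OF sp_pos[OF assms]] by simp
qed (use assms sp isCont_sp in auto)

lemma cont_sp: "continuous_on {0..} sp"
proof -
  have "continuous (at w within {0..}) sp" if "w \<ge> 0" for w
  proof (cases "w = 0")
    case True
    have "\<exists>d>0. \<forall>x\<in>{0..}. dist x 0 < d \<longrightarrow> dist (sp x) (sp 0) < e" if "e > 0" for e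
    proof (intro exI[of _ "G (e/2)"] conjI ballI impI)
      show "0 < G (e/2)" using G_strict_mono[of 0 "e/2"] that by simp
      fix x :: real assume "x \<in> {0..}" "dist x 0 < G (e/2)"
      then have "sp x \<le> sp (G (e/2))" "0 \<le> sp x" by (auto intro!: sp_mono sp simp: dist_real_def)
      then show "dist (sp x) (sp 0) < e" using sp_G[of "e/2"] that by (simp add: dist_real_def)
    qed
    then show ?thesis using True by (simp add: continuous_within_eps_delta)
  next
    case False
    then show ?thesis using isCont_sp[of w] that by (auto intro: continuous_at_imp_continuous_at_within)
  qed
  then show ?thesis by (simp add: continuous_on_eq_continuous_within)
qed

lemma cont_sp_deriv: "continuous_on {0<..} (\<lambda>w. inverse (sp w * p' (sp w)))"
proof -
  have c: "continuous_on {0<..} sp" by (rule continuous_on_subset[OF cont_sp]) auto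
  have "continuous_on {0<..} (\<lambda>w. p' (sp w))"
    by (rule continuous_on_compose2[OF cont_p' c]) (use sp_pos in auto)
  then show ?thesis
    by (intro continuous_intros c) (use sp_pos p'_pos[OF sp_pos] in \<open>auto simp: less_le\<close>)
qed

text \<open>Moving at speed \<open>sp w\<close> through a region of potential \<open>w\<close> minimises the action per unit
  of length; the minimal value is \<open>Kw w\<close>.\<close>

definition Kw where "Kw w = p (sp w)"

lemma Kw_0 [simp]: "Kw 0 = 0" by (simp add: Kw_def)

lemma Kw_nonneg: "0 \<le> w \<Longrightarrow> 0 \<le> Kw w" by (simp add: Kw_def p_nonneg sp)

lemma Kw_pos: "0 < w \<Longrightarrow> 0 < Kw w" by (simp add: Kw_def p_pos sp_pos)

lemma Kw_mono: "0 \<le> v \<Longrightarrow> v \<le> w \<Longrightarrow> Kw v \<le> Kw w"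
  unfolding Kw_def by (intro p_mono sp_mono sp)

lemma cont_Kw: "continuous_on {0..} Kw"
  unfolding Kw_def[abs_def] by (rule continuous_on_compose2[OF cont_p cont_sp]) (use sp in auto)

text \<open>The factor \<open>p'\<close> cancels because \<open>G' = s * p'\<close>. The blow-up of
  \<open>1 / sp w\<close> at 0 is the reason why \<open>F\<close> is differentiated only where
  \<open>V > c\<close>.\<close>

lemma Kw_DERIV: assumes "0 < w" shows "(Kw has_real_derivative 1 / sp w) (at w)"
proof -
  have "(Kw has_real_derivative p' (sp w) * inverse (sp w * p' (sp w))) (at w)"
    unfolding Kw_def[abs_def] by (rule DERIV_chain2[OF p_DERIV[OF sp_pos[OF assms]] sp_DERIV[OF assms]])
  then show ?thesis using p'_pos[OF sp_pos[OF assms]] by (simp add: field_simps)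
qed

text \<open>The tangent of \<open>Phi \<phi>\<close> at \<open>s = sp w\<close> has the value
  \<open>p s * a - G s\<close> at \<open>a\<close>, and \<open>G s = w\<close>.\<close>

lemma young: assumes "0 \<le> a" "0 \<le> w" shows "Kw w * a \<le> Phi \<phi> a + w"
  using Phi_tangent[OF sp(1)[OF assms(2)] assms(1)] sp(2)[OF assms(2)]
  by (simp add: G_def Kw_def algebra_simps)

lemma young_eq: assumes "0 \<le> w" shows "Phi \<phi> (sp w) + w = Kw w * sp w"
  using sp(2)[OF assms] by (simp add: G_def Kw_def algebra_simps)

end

section \<open>Weak derivatives on the line\<close>

text \<open>The polynomial factor in \<open>1 / x\<close> makes this family closed under
  differentiation, all members being flat at 0.\<close>

definition flat :: "real poly \<Rightarrow> real \<Rightarrow> real" where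
  "flat p x = (if x > 0 then poly p (1 / x) * exp (- 1 / x) else 0)"

lemma poly_div_exp_tendsto_0: "((\<lambda>u. poly p u / exp u) \<longlongrightarrow> (0::real)) at_top"
proof -
  have "((\<lambda>u::real. \<Sum>i\<le>degree p. coeff p i * (u ^ i / exp u)) \<longlongrightarrow> (\<Sum>i\<le>degree p. coeff p i * 0)) at_top"
    by (intro tendsto_intros tendsto_power_div_exp_0)
  then show ?thesis by (simp add: poly_altdef sum_divide_distrib)
qed

lemma flat_uminus: "flat (- p) x = - flat p x"
  by (simp add: flat_def)

text \<open>In the variable \<open>u = 1 / x\<close> the derivative is
  \<open>u\<^sup>2 * (p u - p' u) * exp (- u)\<close>. At 0 the right-hand quotient becomes
  \<open>u * p u / exp u\<close> with \<open>u\<close> tending to infinity.\<close>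

lemma flat_deriv: "(flat p has_real_derivative flat ([:0, 0, 1:] * (p - pderiv p)) x) (at x)"
proof -
  consider "x > 0" | "x < 0" | "x = 0" by linarith
  then show ?thesis
  proof cases
    case 1
    have "((\<lambda>x. poly p (1 / x) * exp (- 1 / x)) has_real_derivative flat ([:0, 0, 1:] * (p - pderiv p)) x) (at x)"
      using 1 by (auto intro!: derivative_eq_intros DERIV_chain2[OF poly_DERIV]
          simp: flat_def algebra_simps power2_eq_square divide_simps)
    then show ?thesis
      by (rule has_field_derivative_transform_within_open[of _ _ _ "{0<..}"]) (use 1 in \<open>auto simp: flat_def\<close>)
  next
    case 2
    have "((\<lambda>x. 0) has_real_derivative flat ([:0, 0, 1:] * (p - pderiv p)) x) (at x)"
      using 2 by (simp add: flat_def)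
    then show ?thesis
      by (rule has_field_derivative_transform_within_open[of _ _ _ "{..<0}"]) (use 2 in \<open>auto simp: flat_def\<close>)
  next
    case 3
    have "((\<lambda>h. flat p h / h) \<longlongrightarrow> 0) (at_left 0)"
      by (rule tendsto_eventually) (auto simp: flat_def eventually_at_filter)
    moreover have "((\<lambda>h. flat p h / h) \<longlongrightarrow> 0) (at_right 0)"
    proof -
      have "((\<lambda>h. poly ([:0, 1:] * p) (inverse h) / exp (inverse h)) \<longlongrightarrow> 0) (at_right (0::real))"
        by (rule filterlim_compose[OF poly_div_exp_tendsto_0 filterlim_inverse_at_top_right])
      moreover have "\<forall>\<^sub>F h in at_right 0. poly ([:0, 1:] * p) (inverse h) / exp (inverse h) = flat p h / h"
        unfolding eventually_at_filter
        by (auto simp: flat_def exp_minus divide_simps)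
      ultimately show ?thesis by (rule Lim_transform_eventually)
    qed
    ultimately have "((\<lambda>h. flat p h / h) \<longlongrightarrow> 0) (at 0)" by (rule filterlim_split_at)
    then show ?thesis using 3 by (simp add: DERIV_def flat_def)
  qed
qed

lemma flat_nonneg_pos: "flat 1 x \<ge> 0" "x > 0 \<Longrightarrow> flat 1 x > 0" "x \<le> 0 \<Longrightarrow> flat p x = 0"
  by (auto simp: flat_def)

text \<open>\<open>test_functions\<close> asks for all iterated derivatives at once; an invariant
  that survives one differentiation provides them.\<close>

lemma smooth_coinduct:
  fixes f :: "real \<Rightarrow> real"
  assumes "P f" and step: "\<And>f. P f \<Longrightarrow> \<exists>f'. P f' \<and> (\<forall>x. (f has_real_derivative f' x) (at x))"
  shows "((deriv ^^ k) f) field_differentiable (at t)"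
proof -
  have "P ((deriv ^^ k) f)"
  proof (induction k)
    case (Suc k)
    then obtain f' where f': "P f'" "\<And>x. ((deriv ^^ k) f has_real_derivative f' x) (at x)" using step by blast
    then have "deriv ((deriv ^^ k) f) = f'" by (intro ext DERIV_imp_deriv)
    then show ?case using f'(1) by simp
  qed (use assms(1) in simp)
  then show ?thesis using step field_differentiable_def by blast
qed

text \<open>A class of functions, closed under differentiation, that contains the derivatives of the
  cutoff functions constructed below.\<close>

inductive bumpy :: "(real \<Rightarrow> real) \<Rightarrow> bool" where
  bumpy_prod: "bumpy (\<lambda>x. c * (flat p (k * (x - a)) * flat q (1 - k * (x - a))))"
| bumpy_add: "bumpy f \<Longrightarrow> bumpy g \<Longrightarrow> bumpy (\<lambda>x. f x + g x)"

lemma bumpy_deriv: "bumpy f \<Longrightarrow> \<exists>f'. bumpy f' \<and> (\<forall>x. (f has_real_derivative f' x) (at x))"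
proof (induction rule: bumpy.induct)
  case (bumpy_prod c p k a q)
  define p' where "p' = [:0, 0, 1:] * (p - pderiv p)"
  define q' where "q' = - ([:0, 0, 1:] * (q - pderiv q))"
  show ?case
  proof (intro exI conjI allI)
    show "bumpy (\<lambda>x. c * k * (flat p' (k * (x - a)) * flat q (1 - k * (x - a))) +
        c * k * (flat p (k * (x - a)) * flat q' (1 - k * (x - a))))"
      by (intro bumpy.intros)
    fix x
    show "((\<lambda>x. c * (flat p (k * (x - a)) * flat q (1 - k * (x - a)))) has_real_derivative
        c * k * (flat p' (k * (x - a)) * flat q (1 - k * (x - a))) +
        c * k * (flat p (k * (x - a)) * flat q' (1 - k * (x - a)))) (at x)"
    proof -
      have 1: "((\<lambda>x. flat p (k * (x - a))) has_real_derivative flat p' (k * (x - a)) * k) (at x)"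
        unfolding p'_def by (rule DERIV_chain2[OF flat_deriv]) (auto intro!: derivative_eq_intros)
      have 2: "((\<lambda>x. flat q (1 - k * (x - a))) has_real_derivative (- flat q' (1 - k * (x - a))) * (- k)) (at x)"
        unfolding q'_def flat_uminus minus_minus
        by (rule DERIV_chain2[OF flat_deriv]) (auto intro!: derivative_eq_intros)
      show ?thesis
        by (rule DERIV_cong[OF DERIV_cmult[OF DERIV_mult[OF 1 2]]]) (simp add: algebra_simps)
    qed
  qed
next
  case (bumpy_add f g)
  then obtain f' g' where "bumpy f'" "bumpy g'" "\<And>x. (f has_real_derivative f' x) (at x)"
    "\<And>x. (g has_real_derivative g' x) (at x)" by blast
  then show ?case
    by (intro exI[of _ "\<lambda>x. f' x + g' x"] conjI allI bumpy.bumpy_add DERIV_add)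
qed

text \<open>\<open>\<psi>\<close> is the difference of two translates of one smooth step, and
  \<open>\<rho>\<close> is the unit bump that is the derivative of a step. Both bumps lie to the
  right of \<open>a\<close> and \<open>b\<close>, so that \<open>\<psi>\<close> tends to the
  indicator of \<open>{a<..b}\<close> as \<open>\<epsilon>\<close> tends to 0.\<close>

lemma cutoff_exists:
  assumes "0 < \<epsilon>" "a \<le> b"
  shows "\<exists>\<psi> \<rho>. (\<forall>k t. ((deriv ^^ k) \<psi>) field_differentiable (at t)) \<and>
    (\<forall>t. (\<psi> has_real_derivative (\<rho> (t - a) - \<rho> (t - b))) (at t)) \<and>
    continuous_on UNIV \<rho> \<and> (\<forall>t. 0 \<le> \<rho> t) \<and> (\<forall>t. t \<notin> {0..\<epsilon>} \<longrightarrow> \<rho> t = 0) \<and>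
    (\<rho> has_integral 1) {0..\<epsilon>} \<and> (\<forall>t. \<psi> t \<in> {0..1}) \<and> (\<forall>t. t \<notin> {a..b + \<epsilon>} \<longrightarrow> \<psi> t = 0) \<and>
    (\<forall>t\<in>{a + \<epsilon>..b}. \<psi> t = (1::real))"
proof -
  define \<beta> where "\<beta> x = flat 1 x * flat 1 (1 - x)" for x
  have \<beta>: "\<beta> x \<ge> 0" "0 < x \<Longrightarrow> x < 1 \<Longrightarrow> \<beta> x > 0" "x \<notin> {0<..<1} \<Longrightarrow> \<beta> x = 0" for x
    by (auto simp: \<beta>_def flat_nonneg_pos not_less)
  have cont: "isCont \<beta> x" for x
    unfolding \<beta>_def by (intro continuous_intros isCont_o2[OF _ DERIV_isCont[OF flat_deriv]] DERIV_isCont[OF flat_deriv])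
  obtain S where S: "\<And>x. (S has_real_derivative \<beta> x) (at x)"
    using einterval_antiderivative[of "-\<infinity>" "\<infinity>" \<beta>] cont
    by (auto simp: has_real_derivative_iff_has_vector_derivative)
  have mono: "S x \<le> S y" if "x \<le> y" for x y
    using DERIV_nonneg_imp_nondecreasing[OF that] S \<beta>(1) by blast
  have contS: "continuous_on T S" for T
    using S DERIV_isCont continuous_at_imp_continuous_on by blast
  have S01: "S 0 < S 1"
    by (rule DERIV_pos_imp_increasing_open[OF zero_less_one _ contS]) (use S \<beta>(2) in blast)
  have S0: "S x = S 0" if "x \<le> 0" for x
  proof (cases "x = 0")
    case False
    have "S 0 = S x"
    proof (rule DERIV_isconst_end[OF _ contS])
      fix y :: real assume "y < 0"
      then show "(S has_real_derivative 0) (at y)" using S[of y] \<beta>(3)[of y] by simp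
    qed (use False that in simp)
    then show ?thesis by simp
  qed simp
  have S1: "S x = S 1" if "x \<ge> 1" for x
  proof (cases "x = 1")
    case False
    show "S x = S 1"
    proof (rule DERIV_isconst_end[OF _ contS])
      fix y :: real assume "1 < y"
      then show "(S has_real_derivative 0) (at y)" using S[of y] \<beta>(3)[of y] by simp
    qed (use False that in simp)
  qed simp
  define Z where "Z = S 1 - S 0"
  have Z: "Z > 0" using S01 by (simp add: Z_def)
  define \<sigma> where "\<sigma> x = (S x - S 0) / Z" for x
  have \<sigma>: "\<sigma> x \<in> {0..1}" "x \<le> 0 \<Longrightarrow> \<sigma> x = 0" "x \<ge> 1 \<Longrightarrow> \<sigma> x = 1" "x \<le> y \<Longrightarrow> \<sigma> x \<le> \<sigma> y" for x y
  proof -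
    show "\<sigma> x = 0" if "x \<le> 0" using S0[OF that] unfolding \<sigma>_def by simp
    show "\<sigma> x = 1" if "x \<ge> 1" proof -
      have "\<sigma> x = Z / Z" by (simp add: \<sigma>_def Z_def S1[OF that])
      then show ?thesis using Z by simp
    qed
    show "\<sigma> x \<le> \<sigma> y" if "x \<le> y" using mono[OF that] Z unfolding \<sigma>_def by (simp add: divide_right_mono)
    have "S 0 \<le> S x" using mono[of 0 x] S0[of x] by linarith
    moreover have "S x \<le> S 1" using mono[of x 1] S1[of x] by linarith
    ultimately show "\<sigma> x \<in> {0..1}" using Z by (auto simp: \<sigma>_def divide_simps Z_def)
  qed
  have d\<sigma>: "(\<sigma> has_real_derivative \<beta> x / Z) (at x)" for x
    using Z unfolding \<sigma>_def by (auto intro!: derivative_eq_intros S)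
  define \<rho> where "\<rho> t = \<beta> (t / \<epsilon>) / (Z * \<epsilon>)" for t
  define \<psi> where "\<psi> t = \<sigma> ((t - a) / \<epsilon>) - \<sigma> ((t - b) / \<epsilon>)" for t
  have d\<psi>: "(\<psi> has_real_derivative (\<rho> (t - a) - \<rho> (t - b))) (at t)" for t
    unfolding \<psi>_def \<rho>_def using assms(1)
    by (auto intro!: derivative_eq_intros DERIV_chain2[OF d\<sigma>])
  have "bumpy (\<lambda>t. (1 / (Z * \<epsilon>)) * (flat 1 ((1 / \<epsilon>) * (t - a)) * flat 1 (1 - (1 / \<epsilon>) * (t - a))) +
      (- 1 / (Z * \<epsilon>)) * (flat 1 ((1 / \<epsilon>) * (t - b)) * flat 1 (1 - (1 / \<epsilon>) * (t - b))))"
    by (intro bumpy.intros)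
  then have bump: "bumpy (\<lambda>t. \<rho> (t - a) - \<rho> (t - b))"
    by (simp add: \<rho>_def \<beta>_def diff_divide_distrib)
  \<comment> \<open>The plateau function \<open>\<psi>\<close> is not claimed to be
    \<open>bumpy\<close>; its derivative is, and the invariant has to admit both.\<close>
  have smooth: "((deriv ^^ k) \<psi>) field_differentiable (at t)" for k t
    by (rule smooth_coinduct[of "\<lambda>f. f = \<psi> \<or> bumpy f"]) (use d\<psi> bump bumpy_deriv in blast)+
  have "isCont (\<lambda>t. \<beta> (t / \<epsilon>)) t" for t
    by (rule isCont_o2[OF _ cont]) (use assms(1) in \<open>intro continuous_intros, simp\<close>)
  then have cont\<rho>: "continuous_on UNIV \<rho>"
    unfolding \<rho>_def using assms(1) Z
    by (intro continuous_at_imp_continuous_on ballI isCont_divide continuous_const) auto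
  have d\<rho>: "((\<lambda>t. \<sigma> (t / \<epsilon>)) has_real_derivative \<rho> t) (at t)" for t
  proof (rule DERIV_cong)
    show "((\<lambda>t. \<sigma> (t / \<epsilon>)) has_real_derivative \<beta> (t / \<epsilon>) / Z * (1 / \<epsilon>)) (at t)"
      by (rule DERIV_chain2[OF d\<sigma>]) (use assms(1) in \<open>auto intro!: derivative_eq_intros\<close>)
  qed (simp add: \<rho>_def)
  have "(\<rho> has_integral (\<sigma> (\<epsilon> / \<epsilon>) - \<sigma> (0 / \<epsilon>))) {0..\<epsilon>}"
    by (rule fundamental_theorem_of_calculus)
      (use assms(1) d\<rho> in \<open>auto simp: has_real_derivative_iff_has_vector_derivative[symmetric] intro: DERIV_subset\<close>)
  then have int: "(\<rho> has_integral 1) {0..\<epsilon>}" using \<sigma>(2)[of 0] \<sigma>(3)[of 1] assms(1) by simp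
  have props: "0 \<le> \<rho> t" "t \<notin> {0..\<epsilon>} \<Longrightarrow> \<rho> t = 0" "\<psi> t \<in> {0..1}" "t \<notin> {a..b + \<epsilon>} \<Longrightarrow> \<psi> t = 0"
    "t \<in> {a + \<epsilon>..b} \<Longrightarrow> \<psi> t = 1" for t
  proof -
    show "0 \<le> \<rho> t" using \<beta>(1) Z assms(1) by (simp add: \<rho>_def)
    show "\<rho> t = 0" if "t \<notin> {0..\<epsilon>}" using that assms(1) \<beta>(3)[of "t / \<epsilon>"] by (auto simp: \<rho>_def divide_simps)
    have "(t - b) / \<epsilon> \<le> (t - a) / \<epsilon>" using assms by (simp add: divide_right_mono)
    then have "\<sigma> ((t - b) / \<epsilon>) \<le> \<sigma> ((t - a) / \<epsilon>)" by (rule \<sigma>(4))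
    then show "\<psi> t \<in> {0..1}" using \<sigma>(1)[of "(t - b) / \<epsilon>"] \<sigma>(1)[of "(t - a) / \<epsilon>"] by (auto simp: \<psi>_def)
    show "\<psi> t = 0" if "t \<notin> {a..b + \<epsilon>}"
    proof (cases "t < a")
      case True
      then have "(t - a) / \<epsilon> \<le> 0" "(t - b) / \<epsilon> \<le> 0" using assms by (auto simp: divide_simps)
      then show ?thesis by (simp add: \<psi>_def \<sigma>(2))
    next
      case False
      then have "(t - a) / \<epsilon> \<ge> 1" "(t - b) / \<epsilon> \<ge> 1" using assms that by (auto simp: divide_simps)
      then show ?thesis by (simp add: \<psi>_def \<sigma>(3))
    qed
    show "\<psi> t = 1" if "t \<in> {a + \<epsilon>..b}"
    proof -
      have "(t - a) / \<epsilon> \<ge> 1" "(t - b) / \<epsilon> \<le> 0" using assms that by (auto simp: divide_simps)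
      then show ?thesis by (simp add: \<psi>_def \<sigma>)
    qed
  qed
  show ?thesis
    by (intro exI[of _ \<psi>] exI[of _ \<rho>] conjI allI impI ballI smooth d\<psi> cont\<rho> int props)
qed

lemma test_function_support:
  assumes "\<psi> \<in> test_functions I"
  shows "\<exists>K. compact K \<and> K \<subseteq> interior I \<and> (\<forall>t. t \<notin> K \<longrightarrow> \<psi> t = 0 \<and> deriv \<psi> t = 0)"
proof -
  obtain K where K: "compact K" "K \<subseteq> interior I" "\<And>t. t \<notin> K \<Longrightarrow> \<psi> t = 0"
    using assms by (auto simp: test_functions_def)
  have "deriv \<psi> t = 0" if "t \<notin> K" for t
  proof (rule DERIV_imp_deriv)
    have "((\<lambda>_. 0) has_real_derivative 0) (at t)" by simp
    then show "(\<psi> has_real_derivative 0) (at t)"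
      by (rule has_field_derivative_transform_within_open[of _ _ _ "- K"])
        (use K that in \<open>auto simp: open_closed compact_imp_closed\<close>)
  qed
  then show ?thesis using K by blast
qed

lemma test_function_deriv:
  assumes "\<psi> \<in> test_functions I"
  shows "(\<psi> has_real_derivative deriv \<psi> t) (at t)" "continuous_on T \<psi>" "continuous_on T (deriv \<psi>)"
proof -
  have d: "((deriv ^^ k) \<psi>) field_differentiable (at t)" for k t
    using assms by (simp add: test_functions_def)
  then show "(\<psi> has_real_derivative deriv \<psi> t) (at t)"
    using d[of 0 t] by (simp add: DERIV_deriv_iff_field_differentiable)
  show "continuous_on T \<psi>" "continuous_on T (deriv \<psi>)"
    using d[of 0] d[of 1]
    by (auto intro!: continuous_at_imp_continuous_on field_differentiable_imp_continuous_at)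
qed

section \<open>Integration by parts, and continuous functions as primitives of their weak
  derivatives\<close>

lemma set_integral_support:
  assumes "\<And>t. t \<in> I \<Longrightarrow> t \<notin> K \<Longrightarrow> f t = 0" "K \<subseteq> I"
  shows "(LINT t:I|M. f t) = (LINT t:K|M. f t)"
proof -
  have "(\<lambda>t. indicat_real I t *\<^sub>R f t) = (\<lambda>t. indicat_real K t *\<^sub>R f t)"
  proof
    fix t show "indicat_real I t *\<^sub>R f t = indicat_real K t *\<^sub>R f t"
      using assms by (cases "t \<in> I"; cases "t \<in> K") auto
  qed
  then show ?thesis unfolding set_lebesgue_integral_def by (rule arg_cong)
qed

lemma absolutely_integrable_continuous_scaleR:
  fixes g :: "real \<Rightarrow> 'a::euclidean_space"
  assumes "continuous_on {a..b} f" "g absolutely_integrable_on {a..b}"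
  shows "(\<lambda>t. f t *\<^sub>R g t) absolutely_integrable_on {a..b}"
proof (rule absolutely_integrable_bounded_measurable_product[of "\<lambda>x y. x *\<^sub>R y"])
  show "bilinear (\<lambda>(x::real) (y::'a). x *\<^sub>R y)"
    using bounded_bilinear_scaleR by (simp add: bilinear_conv_bounded_bilinear)
  show "f \<in> borel_measurable (lebesgue_on {a..b})"
    by (intro continuous_imp_measurable_on_sets_lebesgue assms) auto
  show "bounded (f ` {a..b})"
    by (intro compact_imp_bounded compact_continuous_image assms) auto
qed (use assms in auto)

lemma absolutely_integrable_scaleR_continuous:
  fixes g :: "real \<Rightarrow> 'a::euclidean_space"
  assumes "continuous_on {a..b} g" "continuous_on {a..b} f"
  shows "(\<lambda>t. f t *\<^sub>R g t) absolutely_integrable_on {a..b}"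
  by (intro absolutely_integrable_continuous_scaleR absolutely_integrable_continuous_real assms)

lemma compact_subset_Icc:
  fixes K :: "real set"
  assumes "compact K"
  obtains n :: nat where "K \<subseteq> {- real n<..<real n}"
proof -
  obtain B where B: "\<And>x. x \<in> K \<Longrightarrow> \<bar>x\<bar> \<le> B" using compact_imp_bounded[OF assms] by (auto simp: bounded_iff)
  obtain n where "B < real n" using reals_Archimedean2 by blast
  then show ?thesis using B that[of n] by (force simp: abs_le_iff)
qed

lemma L1_loc_mono: "J \<subseteq> I \<Longrightarrow> q \<in> L1_loc I \<Longrightarrow> q \<in> L1_loc J"
  by (auto simp: L1_loc_def)

lemma is_weak_deriv_subset:
  assumes "is_weak_deriv I q g" "J \<subseteq> I"
  shows "is_weak_deriv J q g"
  unfolding is_weak_deriv_def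
proof (intro conjI ballI)
  show "q \<in> L1_loc J" "g \<in> L1_loc J" using assms L1_loc_mono unfolding is_weak_deriv_def by blast+
  fix \<psi> assume \<psi>: "\<psi> \<in> test_functions J"
  then obtain K where K: "compact K" "K \<subseteq> interior J" "\<And>t. t \<notin> K \<Longrightarrow> \<psi> t = 0 \<and> deriv \<psi> t = 0"
    using test_function_support by metis
  have KJ: "K \<subseteq> J" using K(2) interior_subset by blast
  have "\<psi> \<in> test_functions I"
    using \<psi> interior_mono[OF assms(2)] unfolding test_functions_def by blast
  then have "(LINT t:I|lebesgue. deriv \<psi> t *\<^sub>R q t) = - (LINT t:I|lebesgue. \<psi> t *\<^sub>R g t)"
    using assms(1) by (simp add: is_weak_deriv_def)
  moreover have "(LINT t:I|lebesgue. f t) = (LINT t:J|lebesgue. f t)"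
    if "\<And>t. t \<notin> K \<Longrightarrow> f t = 0" for f :: "real \<Rightarrow> 'a"
    using set_integral_support[of I K f] set_integral_support[of J K f] that KJ assms(2) by auto
  ultimately show "(LINT t:J|lebesgue. deriv \<psi> t *\<^sub>R q t) = - (LINT t:J|lebesgue. \<psi> t *\<^sub>R g t)"
    using K(3) by simp
qed

text \<open>Integration by parts on the whole line: the support lies in the open interval from
  \<open>- n\<close> to \<open>n\<close>, so the boundary terms vanish. A smaller domain is handled
  by restriction.\<close>

lemma C1_is_weak_deriv:
  fixes q :: "real \<Rightarrow> 'a::euclidean_space"
  assumes d: "\<And>t. (q has_vector_derivative g t) (at t)" and contg: "continuous_on UNIV g"
  shows "is_weak_deriv I q g"
proof -
  have contq: "continuous_on UNIV q"
    by (intro continuous_at_imp_continuous_on ballI has_vector_derivative_continuous[OF d])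
  have L1: "f \<in> L1_loc UNIV" if "continuous_on UNIV f" for f :: "real \<Rightarrow> 'a"
    unfolding L1_loc_def
  proof (safe)
    fix K :: "real set" assume K: "compact K"
    then obtain n where n: "K \<subseteq> {- real n<..<real n}" by (rule compact_subset_Icc)
    have "f absolutely_integrable_on {- real n..real n}"
      by (intro absolutely_integrable_continuous_real continuous_on_subset[OF that]) auto
    then show "f absolutely_integrable_on K"
      by (rule set_integrable_subset) (use K n compact_imp_closed in \<open>force dest: lmeasurable_compact\<close>)+
  qed
  have "is_weak_deriv UNIV q g"
    unfolding is_weak_deriv_def
  proof (intro conjI ballI L1 contq contg)
    fix \<psi> :: "real \<Rightarrow> real" assume \<psi>: "\<psi> \<in> test_functions UNIV"
    obtain K where K: "compact K" "K \<subseteq> interior UNIV" "\<And>t. t \<notin> K \<Longrightarrow> \<psi> t = 0 \<and> deriv \<psi> t = 0"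
      using test_function_support[OF \<psi>] by metis
    obtain n where n: "K \<subseteq> {- real n<..<real n}" using compact_subset_Icc[OF K(1)] .
    define T where "T = {- real n..real n}"
    have KT: "K \<subseteq> T" using n by (force simp: T_def)
    have int: "(\<lambda>t. deriv \<psi> t *\<^sub>R q t) absolutely_integrable_on T" "(\<lambda>t. \<psi> t *\<^sub>R g t) absolutely_integrable_on T"
      unfolding T_def using test_function_deriv[OF \<psi>] continuous_on_subset[OF contq] continuous_on_subset[OF contg]
      by (intro absolutely_integrable_scaleR_continuous; blast)+
    have "((\<lambda>t. deriv \<psi> t *\<^sub>R q t + \<psi> t *\<^sub>R g t) has_integral (\<psi> (real n) *\<^sub>R q (real n) - \<psi> (- real n) *\<^sub>R q (- real n))) T"
      unfolding T_def
    proof (rule fundamental_theorem_of_calculus)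
      fix t
      have "((\<lambda>t. \<psi> t *\<^sub>R q t) has_vector_derivative (\<psi> t *\<^sub>R g t + deriv \<psi> t *\<^sub>R q t)) (at t)"
        by (rule has_vector_derivative_scaleR[OF test_function_deriv(1)[OF \<psi>] d])
      then show "((\<lambda>t. \<psi> t *\<^sub>R q t) has_vector_derivative (deriv \<psi> t *\<^sub>R q t + \<psi> t *\<^sub>R g t)) (at t within {- real n..real n})"
        by (simp add: add.commute has_vector_derivative_at_within)
    qed simp
    moreover have "\<psi> (real n) = 0" "\<psi> (- real n) = 0"
    proof -
      have "real n \<notin> K" "- real n \<notin> K" using n by auto
      then show "\<psi> (real n) = 0" "\<psi> (- real n) = 0" using K(3) by blast+
    qed
    ultimately have "integral T (\<lambda>t. deriv \<psi> t *\<^sub>R q t + \<psi> t *\<^sub>R g t) = 0" by (simp add: integral_unique)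
    then have "integral T (\<lambda>t. deriv \<psi> t *\<^sub>R q t) + integral T (\<lambda>t. \<psi> t *\<^sub>R g t) = 0"
      using int by (simp add: integral_add set_lebesgue_integral_eq_integral(1))
    then have "(LINT t:T|lebesgue. deriv \<psi> t *\<^sub>R q t) = - (LINT t:T|lebesgue. \<psi> t *\<^sub>R g t)"
      using int by (simp add: set_lebesgue_integral_eq_integral(2) add_eq_0_iff2)
    moreover have "(LINT t:UNIV|lebesgue. deriv \<psi> t *\<^sub>R q t) = (LINT t:T|lebesgue. deriv \<psi> t *\<^sub>R q t)"
      "(LINT t:UNIV|lebesgue. \<psi> t *\<^sub>R g t) = (LINT t:T|lebesgue. \<psi> t *\<^sub>R g t)"
      using KT K(3) by (intro set_integral_support; force)+
    ultimately show "(LINT t:UNIV|lebesgue. deriv \<psi> t *\<^sub>R q t) = - (LINT t:UNIV|lebesgue. \<psi> t *\<^sub>R g t)" by simp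
  qed
  then show ?thesis using is_weak_deriv_subset by blast
qed

text \<open>The kernels are supported to the right of \<open>c\<close>, which may therefore be the
  left end of the interval.\<close>

lemma mollifier_limit:
  fixes q :: "real \<Rightarrow> 'a::euclidean_space"
  assumes contq: "continuous_on {c..d} q" "c < d"
    and \<epsilon>: "\<And>n. 0 < \<epsilon> n" "\<And>n. c + \<epsilon> n \<le> d" "\<epsilon> \<longlonglongrightarrow> 0"
    and \<rho>: "\<And>n. continuous_on UNIV (\<rho> n)" "\<And>n t. 0 \<le> \<rho> n t" "\<And>n t. t \<notin> {0..\<epsilon> n} \<Longrightarrow> \<rho> n t = 0"
      "\<And>n. (\<rho> n has_integral 1) {0..\<epsilon> n}"
  shows "(\<lambda>n. integral {c..d} (\<lambda>t. \<rho> n (t - c) *\<^sub>R q t)) \<longlonglongrightarrow> q c"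
proof (rule tendstoI)
  fix e :: real assume e: "0 < e"
  obtain \<delta> where \<delta>: "0 < \<delta>" "\<And>t. t \<in> {c..d} \<Longrightarrow> dist t c < \<delta> \<Longrightarrow> dist (q t) (q c) < e / 2"
    using contq e unfolding continuous_on_iff by (metis atLeastAtMost_iff half_gt_zero less_imp_le order_refl)
  have "\<forall>\<^sub>F n in sequentially. \<epsilon> n < \<delta>" using \<epsilon>(3) \<delta>(1) by (rule order_tendstoD(2))
  then show "\<forall>\<^sub>F n in sequentially. dist (integral {c..d} (\<lambda>t. \<rho> n (t - c) *\<^sub>R q t)) (q c) < e"
  proof eventually_elim
    case (elim n)
    define r where "r t = \<rho> n (t - c)" for t
    have contr: "continuous_on T r" for T
      unfolding r_def by (intro continuous_on_compose2[OF \<rho>(1)] continuous_intros) auto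
    have "(r has_integral 1) {c..c + \<epsilon> n}"
      using has_integral_shift_real_ivl_iff[of r 1 c "c + \<epsilon> n" c] \<rho>(4)[of n] by (simp add: r_def comp_def)
    then have r1: "(r has_integral 1) {c..d}"
      by (rule has_integral_on_superset) (use \<epsilon>(2)[of n] \<rho>(3)[of _ n] in \<open>auto simp: r_def\<close>)
    have int1: "(\<lambda>t. r t *\<^sub>R q t) integrable_on {c..d}"
      by (intro integrable_continuous_real continuous_intros contr contq)
    have int2: "((\<lambda>t. r t *\<^sub>R q c) has_integral 1 *\<^sub>R q c) {c..d}" using r1 by (rule has_integral_scaleR_left)
    have "norm (integral {c..d} (\<lambda>t. r t *\<^sub>R q t - r t *\<^sub>R q c)) \<le> integral {c..d} (\<lambda>t. r t * (e / 2))"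
    proof (rule integral_norm_bound_integral)
      show "(\<lambda>t. r t * (e / 2)) integrable_on {c..d}"
        using has_integral_mult_left[OF r1, of "e / 2"] by blast
      show "norm (r t *\<^sub>R q t - r t *\<^sub>R q c) \<le> r t * (e / 2)" if t: "t \<in> {c..d}" for t
      proof (cases "t - c \<in> {0..\<epsilon> n}")
        case True
        then have "norm (q t - q c) \<le> e / 2" using \<delta>(2)[OF t] elim by (simp add: dist_norm dist_real_def)
        then have "r t * norm (q t - q c) \<le> r t * (e / 2)"
          using \<rho>(2) unfolding r_def by (intro mult_left_mono) auto
        then show ?thesis using \<rho>(2)[of n "t - c"]
          unfolding scaleR_diff_right[symmetric] norm_scaleR by (simp add: r_def)
      qed (simp add: r_def \<rho>(3))
    qed (intro integrable_diff int1 has_integral_integrable[OF int2])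
    also have "integral {c..d} (\<lambda>t. r t *\<^sub>R q t - r t *\<^sub>R q c) = integral {c..d} (\<lambda>t. r t *\<^sub>R q t) - q c"
      using int1 int2 by (simp add: integral_diff has_integral_integrable integral_unique)
    also have "integral {c..d} (\<lambda>t. r t * (e / 2)) = e / 2"
      using integral_unique[OF has_integral_mult_left[OF r1, of "e / 2"]] by simp
    finally show ?case using e by (simp add: r_def dist_norm)
  qed
qed

text \<open>Test with cutoffs tending to the indicator of \<open>{a<..b}\<close>. The masses of
  their derivatives concentrate at \<open>a\<close> and \<open>b\<close> and give
  \<open>q a - q b\<close>, while the other side converges to an integral of \<open>g\<close> by
  dominated convergence.\<close>

lemma weak_deriv_increment:
  fixes q :: "real \<Rightarrow> 'a::euclidean_space"
  assumes w: "is_weak_deriv I q g" and contq: "continuous_on I q" and ab: "a \<le> b" "{a..b} \<subseteq> interior I"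
  shows "q b - q a = integral {a..b} g"
proof -
  obtain e0 where e0: "0 < e0" "{a..b + e0} \<subseteq> interior I"
  proof -
    have "b \<in> interior I" using ab by auto
    then obtain e where "0 < e" "ball b e \<subseteq> interior I" using open_interior open_contains_ball by blast
    moreover have "t \<in> interior I" if "t \<in> {a..b + e / 2}" "0 < e" "ball b e \<subseteq> interior I" for t e
      using that ab(2) by (cases "t \<le> b") (force simp: dist_real_def)+
    ultimately show ?thesis by (intro that[of "e / 2"]) auto
  qed
  define T where "T = {a..b + e0}"
  have TI: "T \<subseteq> I" using e0 interior_subset unfolding T_def by blast
  define \<epsilon> where "\<epsilon> n = e0 / real (Suc n)" for n
  have \<epsilon>: "0 < \<epsilon> n" "\<epsilon> n \<le> e0" for n
    using e0 by (auto simp: \<epsilon>_def divide_simps mult_le_cancel_left1)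
  have \<epsilon>0: "\<epsilon> \<longlonglongrightarrow> 0" unfolding \<epsilon>_def using LIMSEQ_Suc[OF lim_const_over_n[of e0]] by simp
  have "\<forall>n. \<exists>\<psi> \<rho>. (\<forall>k t. ((deriv ^^ k) \<psi>) field_differentiable (at t)) \<and>
    (\<forall>t. (\<psi> has_real_derivative (\<rho> (t - a) - \<rho> (t - b))) (at t)) \<and>
    continuous_on UNIV \<rho> \<and> (\<forall>t. 0 \<le> \<rho> t) \<and> (\<forall>t. t \<notin> {0..\<epsilon> n} \<longrightarrow> \<rho> t = 0) \<and>
    (\<rho> has_integral 1) {0..\<epsilon> n} \<and> (\<forall>t. \<psi> t \<in> {0..1}) \<and> (\<forall>t. t \<notin> {a..b + \<epsilon> n} \<longrightarrow> \<psi> t = 0) \<and>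
    (\<forall>t\<in>{a + \<epsilon> n..b}. \<psi> t = (1::real))" using cutoff_exists[OF \<epsilon>(1) ab(1)] by blast
  then obtain \<psi> \<rho> where
    \<psi>: "\<And>n k t. ((deriv ^^ k) (\<psi> n)) field_differentiable (at t)"
      "\<And>n t. (\<psi> n has_real_derivative (\<rho> n (t - a) - \<rho> n (t - b))) (at t)"
      "\<And>n t. \<psi> n t \<in> {0..1}" "\<And>n t. t \<notin> {a..b + \<epsilon> n} \<Longrightarrow> \<psi> n t = 0"
      "\<And>n t. t \<in> {a + \<epsilon> n..b} \<Longrightarrow> \<psi> n t = 1"
    and \<rho>: "\<And>n. continuous_on UNIV (\<rho> n)" "\<And>n t. 0 \<le> \<rho> n t"
      "\<And>n t. t \<notin> {0..\<epsilon> n} \<Longrightarrow> \<rho> n t = 0" "\<And>n. (\<rho> n has_integral 1) {0..\<epsilon> n}"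
    by metis
  have test: "\<psi> n \<in> test_functions I" for n
  proof -
    have "{a..b + \<epsilon> n} \<subseteq> interior I" using \<epsilon>(2)[of n] e0(2) by (auto simp: subset_iff)
    then show ?thesis unfolding test_functions_def using \<psi>(1,4) by (auto intro!: exI[of _ "{a..b + \<epsilon> n}"])
  qed
  have deriv\<psi>: "deriv (\<psi> n) t = \<rho> n (t - a) - \<rho> n (t - b)" for n t by (rule DERIV_imp_deriv[OF \<psi>(2)])
  have supp: "\<psi> n t = 0" "deriv (\<psi> n) t = 0" if "t \<notin> T" for n t
    using \<psi>(4)[of t n] \<rho>(3)[of "t - a" n] \<rho>(3)[of "t - b" n] that \<epsilon>(2)[of n] ab(1) by (auto simp: T_def deriv\<psi>)
  have contT: "continuous_on T q" by (rule continuous_on_subset[OF contq TI])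
  have gT: "g absolutely_integrable_on T" using w TI unfolding is_weak_deriv_def L1_loc_def T_def by auto
  have int: "(\<lambda>t. deriv (\<psi> n) t *\<^sub>R q t) absolutely_integrable_on T" "(\<lambda>t. \<psi> n t *\<^sub>R g t) absolutely_integrable_on T" for n
    using contT gT test_function_deriv[OF test] unfolding T_def
    by (blast intro: absolutely_integrable_scaleR_continuous absolutely_integrable_continuous_scaleR)+
  have eq: "integral T (\<lambda>t. deriv (\<psi> n) t *\<^sub>R q t) = - integral T (\<lambda>t. \<psi> n t *\<^sub>R g t)" for n
  proof -
    have "(LINT t:I|lebesgue. deriv (\<psi> n) t *\<^sub>R q t) = - (LINT t:I|lebesgue. \<psi> n t *\<^sub>R g t)"
      using w test unfolding is_weak_deriv_def by blast
    then have "(LINT t:T|lebesgue. deriv (\<psi> n) t *\<^sub>R q t) = - (LINT t:T|lebesgue. \<psi> n t *\<^sub>R g t)"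
      using set_integral_support[of I T "\<lambda>t. deriv (\<psi> n) t *\<^sub>R q t"] set_integral_support[of I T "\<lambda>t. \<psi> n t *\<^sub>R g t"] supp TI
      by simp
    then show ?thesis using int[of n] by (simp add: set_lebesgue_integral_eq_integral(2))
  qed
  have "(\<lambda>n. integral T (\<lambda>t. deriv (\<psi> n) t *\<^sub>R q t)) \<longlonglongrightarrow> q a - q b"
  proof -
    have cont\<rho>: "continuous_on S (\<lambda>t. \<rho> n (t - c))" for S n c
      by (intro continuous_on_compose2[OF \<rho>(1)] continuous_intros) auto
    have i: "(\<lambda>t. \<rho> n (t - c) *\<^sub>R q t) integrable_on T" for n c
      using contT unfolding T_def by (intro integrable_continuous_real continuous_intros cont\<rho>)
    have "integral T (\<lambda>t. deriv (\<psi> n) t *\<^sub>R q t) =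
      integral {a..b + e0} (\<lambda>t. \<rho> n (t - a) *\<^sub>R q t) - integral {b..b + e0} (\<lambda>t. \<rho> n (t - b) *\<^sub>R q t)" for n
    proof -
      have "integral T (\<lambda>t. deriv (\<psi> n) t *\<^sub>R q t) =
        integral T (\<lambda>t. \<rho> n (t - a) *\<^sub>R q t) - integral T (\<lambda>t. \<rho> n (t - b) *\<^sub>R q t)"
        using i by (simp add: deriv\<psi> scaleR_diff_left integral_diff)
      also have "integral T (\<lambda>t. \<rho> n (t - b) *\<^sub>R q t) = integral {b..b + e0} (\<lambda>t. \<rho> n (t - b) *\<^sub>R q t)"
      proof -
        have "(\<lambda>t. \<rho> n (t - b) *\<^sub>R q t) = (\<lambda>t. if t \<in> {b..b + e0} then \<rho> n (t - b) *\<^sub>R q t else 0)"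
          using \<rho>(3)[of _ n] \<epsilon>(2)[of n] by (intro ext) auto
        then have "integral T (\<lambda>t. \<rho> n (t - b) *\<^sub>R q t) = integral T (\<lambda>t. if t \<in> {b..b + e0} then \<rho> n (t - b) *\<^sub>R q t else 0)"
          by (rule arg_cong)
        also have "\<dots> = integral {b..b + e0} (\<lambda>t. \<rho> n (t - b) *\<^sub>R q t)"
          unfolding integral_restrict_Int using ab(1) e0(1) by (intro arg_cong2[of _ _ _ _ integral]) (auto simp: T_def)
        finally show ?thesis .
      qed
      finally show ?thesis by (simp add: T_def)
    qed
    moreover have "(\<lambda>n. integral {a..b + e0} (\<lambda>t. \<rho> n (t - a) *\<^sub>R q t)) \<longlonglongrightarrow> q a"
      by (rule mollifier_limit[where \<epsilon> = \<epsilon>])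
        (use contT[unfolded T_def] e0(1) ab(1) \<epsilon> \<epsilon>0 \<rho> in \<open>auto simp: add_mono\<close>)
    moreover have "(\<lambda>n. integral {b..b + e0} (\<lambda>t. \<rho> n (t - b) *\<^sub>R q t)) \<longlonglongrightarrow> q b"
      by (rule mollifier_limit[where \<epsilon> = \<epsilon>])
        (use continuous_on_subset[OF contT[unfolded T_def]] e0(1) ab(1) \<epsilon> \<epsilon>0 \<rho> in auto)
    ultimately show ?thesis by (simp add: tendsto_diff)
  qed
  moreover have "(\<lambda>n. integral T (\<lambda>t. \<psi> n t *\<^sub>R g t)) \<longlonglongrightarrow> integral T (\<lambda>t. if t \<in> {a<..b} then g t else 0)"
  proof (rule dominated_convergence(2))
    show "(\<lambda>t. \<psi> n t *\<^sub>R g t) integrable_on T" for n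
      using int(2) by (rule set_lebesgue_integral_eq_integral(1))
    show "(\<lambda>t. norm (g t)) integrable_on T" using gT by (simp add: absolutely_integrable_on_def)
    show "norm (\<psi> n t *\<^sub>R g t) \<le> norm (g t)" for n t
      using \<psi>(3)[of n t] by (simp add: mult_left_le_one_le)
    fix t assume "t \<in> T"
    consider "t \<le> a" | "a < t" "t \<le> b" | "b < t" by linarith
    then show "(\<lambda>n. \<psi> n t *\<^sub>R g t) \<longlonglongrightarrow> (if t \<in> {a<..b} then g t else 0)"
    proof cases
      case 1
      \<comment> \<open>At \<open>t = a\<close> the value follows by continuity from the left, where
        the cutoff vanishes.\<close>
      have "\<psi> n t = 0" for n
      proof (cases "t = a")
        case True
        have "continuous_on UNIV (\<psi> n)" by (rule test_function_deriv(2)[OF test])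
        then have "((\<psi> n) \<longlongrightarrow> \<psi> n a) (at_left a)"
          by (simp add: continuous_on_eq_continuous_at continuous_at_imp_continuous_within flip: continuous_within)
        moreover have "((\<psi> n) \<longlongrightarrow> 0) (at_left a)"
          by (rule tendsto_eventually) (auto simp: eventually_at_filter \<psi>(4))
        ultimately show ?thesis using True tendsto_unique[OF trivial_limit_at_left_real] by blast
      qed (use 1 \<psi>(4) in auto)
      then show ?thesis using 1 by simp
    next
      case 2
      have "\<forall>\<^sub>F n in sequentially. \<epsilon> n < t - a" using \<epsilon>0 2 by (intro order_tendstoD(2)) auto
      then have "\<forall>\<^sub>F n in sequentially. \<psi> n t *\<^sub>R g t = g t"
        by eventually_elim (use 2 \<psi>(5)[of t] in auto)
      then show ?thesis using 2 by (simp add: tendsto_eventually)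
    next
      case 3
      have "\<forall>\<^sub>F n in sequentially. \<epsilon> n < t - b" using \<epsilon>0 3 by (intro order_tendstoD(2)) auto
      then have "\<forall>\<^sub>F n in sequentially. \<psi> n t *\<^sub>R g t = 0"
        by eventually_elim (use 3 \<psi>(4)[of t] in auto)
      then show ?thesis using 3 by (simp add: tendsto_eventually)
    qed
  qed
  moreover have "integral T (\<lambda>t. if t \<in> {a<..b} then g t else 0) = integral {a..b} g"
  proof -
    have "integral T (\<lambda>t. if t \<in> {a<..b} then g t else 0) = integral {a<..b} g"
      unfolding integral_restrict_Int using e0(1) by (intro arg_cong2[of _ _ _ _ integral]) (auto simp: T_def)
    also have "\<dots> = integral {a..b} g"
      by (rule integral_subset_negligible)
        (auto intro!: negligible_subset[OF negligible_sing[of a]])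
    finally show ?thesis .
  qed
  ultimately have "(\<lambda>n. - integral T (\<lambda>t. \<psi> n t *\<^sub>R g t)) \<longlonglongrightarrow> q a - q b"
    "(\<lambda>n. - integral T (\<lambda>t. \<psi> n t *\<^sub>R g t)) \<longlonglongrightarrow> - integral {a..b} g"
    by (simp_all add: eq tendsto_minus)
  then have "q a - q b = - integral {a..b} g" using LIMSEQ_unique by blast
  then show ?thesis by (metis minus_diff_eq minus_minus)
qed

text \<open>At almost every point of an interval the right-sided averages of \<open>h\<close>
  converge to its value, and these averages vanish. Countably many intervals with rational ends
  cover \<open>U\<close>.\<close>

lemma negligible_nonzero_of_zero_integrals:
  fixes h :: "real \<Rightarrow> 'a::euclidean_space"
  assumes "open U"
    and h: "\<And>a b. a \<le> b \<Longrightarrow> {a..b} \<subseteq> U \<Longrightarrow> h integrable_on {a..b} \<and> integral {a..b} h = 0"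
  shows "\<exists>N. negligible N \<and> (\<forall>t\<in>U - N. h t = 0)"
proof -
  have "\<exists>N. negligible N \<and> (\<forall>t\<in>{a<..<b} - N. h t = 0)" if ab: "a < b" "{a..b} \<subseteq> U" for a b
  proof -
    define f where "f t = (if t \<in> {a..b} then h t else 0)" for t
    have "f integrable_on {c..d}" for c d
    proof (cases "max a c \<le> min b d")
      case True
      have "{max a c..min b d} \<subseteq> U" using ab(2) by (auto simp: subset_iff)
      then show ?thesis unfolding f_def integrable_restrict_Int using h[OF True] by (simp add: Int_atLeastAtMost)
    next
      case False
      then have "{c..d} \<inter> {a..b} = {}" by auto
      then have "f t = 0" if "t \<in> {c..d}" for t using that by (auto simp: f_def)
      then show ?thesis using integrable_cong[of "{c..d}" f "\<lambda>_. 0"] integrable_0 by blast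
    qed
    then have "\<And>c d. f integrable_on cbox c d" by simp
    then obtain N where N: "negligible N" "\<And>x e. x \<notin> N \<Longrightarrow> 0 < e \<Longrightarrow>
        \<exists>d>0. \<forall>s. 0 < s \<and> s < d \<longrightarrow> norm (integral (cbox x (x + s *\<^sub>R One)) f /\<^sub>R s ^ DIM(real) - f x) < e"
      using integrable_ccontinuous_explicit[of f] by metis
    have "h x = 0" if x: "x \<in> {a<..<b} - N" for x
    proof (rule ccontr)
      assume "h x \<noteq> 0"
      then obtain d where d: "0 < d" "\<And>s. 0 < s \<Longrightarrow> s < d \<Longrightarrow>
          norm (integral (cbox x (x + s *\<^sub>R One)) f /\<^sub>R s ^ DIM(real) - f x) < norm (h x)"
        using N(2)[of x "norm (h x)"] x by auto
      define s where "s = min (d / 2) (b - x)"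
      have s: "0 < s" "s < d" "x + s \<le> b" using d(1) x by (auto simp: s_def)
      have "integral (cbox x (x + s *\<^sub>R One)) f = integral {x..x + s} h"
        using x s by (auto intro!: integral_cong simp: f_def)
      also have "\<dots> = 0" using h[of x "x + s"] x s ab(2) by (auto simp: subset_iff)
      finally have "norm (f x) < norm (h x)" using d(2)[of s] s by simp
      then show False using x by (simp add: f_def)
    qed
    then show ?thesis using N(1) by blast
  qed
  then obtain N where N: "\<And>a b. a < b \<Longrightarrow> {a..b} \<subseteq> U \<Longrightarrow> negligible (N a b) \<and> (\<forall>t\<in>{a<..<b} - N a b. h t = 0)"
    by metis
  define S where "S = {(a, b). a \<in> \<rat> \<and> b \<in> \<rat> \<and> a < b \<and> {a..b} \<subseteq> U}"
  have "S \<subseteq> \<rat> \<times> \<rat>" by (auto simp: S_def)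
  then have "countable S" using countable_rat countable_subset countable_SIGMA by metis
  then have "negligible (\<Union>((\<lambda>(a, b). N a b) ` S))"
    using N by (intro negligible_countable_Union) (auto simp: S_def)
  moreover have "h t = 0" if t: "t \<in> U - \<Union>((\<lambda>(a, b). N a b) ` S)" for t
  proof -
    obtain e where e: "0 < e" "ball t e \<subseteq> U" using assms(1) t open_contains_ball by (metis DiffD1)
    obtain a where a: "a \<in> \<rat>" "t - e < a" "a < t" using Rats_dense_in_real[of "t - e" t] e by auto
    obtain b where b: "b \<in> \<rat>" "t < b" "b < t + e" using Rats_dense_in_real[of t "t + e"] e by auto
    have "{a..b} \<subseteq> U" using e(2) a b by (force simp: dist_real_def)
    then have "(a, b) \<in> S" using a b by (auto simp: S_def)
    then show ?thesis using N[of a b] t a b by (auto simp: S_def)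
  qed
  ultimately show ?thesis by blast
qed

lemma L1_loc_integrable: "g \<in> L1_loc I \<Longrightarrow> {a..b} \<subseteq> I \<Longrightarrow> g absolutely_integrable_on {a..b}"
  by (auto simp: L1_loc_def)

text \<open>\<open>weak_deriv\<close> is an arbitrary choice; this is what allows an action to be
  computed from any convenient representative.\<close>

lemma weak_deriv_unique:
  assumes g: "is_weak_deriv I q g1" "is_weak_deriv I q g2" and "continuous_on I q"
  shows "\<exists>N. negligible N \<and> (\<forall>t\<in>interior I - N. g1 t = g2 t)"
proof -
  have "\<exists>N. negligible N \<and> (\<forall>t\<in>interior I - N. g1 t - g2 t = 0)"
  proof (rule negligible_nonzero_of_zero_integrals)
    fix a b :: real assume ab: "a \<le> b" "{a..b} \<subseteq> interior I"
    then have "{a..b} \<subseteq> I" using interior_subset by blast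
    then have "g1 integrable_on {a..b}" "g2 integrable_on {a..b}"
      using g L1_loc_integrable set_lebesgue_integral_eq_integral(1) unfolding is_weak_deriv_def by blast+
    then show "(\<lambda>t. g1 t - g2 t) integrable_on {a..b} \<and> integral {a..b} (\<lambda>t. g1 t - g2 t) = 0"
      using weak_deriv_increment[OF g(1) assms(3) ab] weak_deriv_increment[OF g(2) assms(3) ab]
      by (simp add: integrable_diff integral_diff)
  qed simp
  then show ?thesis by simp
qed

lemma is_weak_deriv_weak_deriv: "is_weak_deriv I q g \<Longrightarrow> is_weak_deriv I q (weak_deriv I q)"
  unfolding weak_deriv_def by (rule someI[of "is_weak_deriv I q"])

text \<open>The action of a competitor uses a weak derivative on the whole line, while
  \<open>W1_Phi_loc\<close> provides one on each compact interval. Off a countable union of null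
  sets the pieces agree, so choosing the index \<open>k t\<close> at time \<open>t\<close> glues
  them.\<close>

lemma is_weak_deriv_exhaust:
  fixes q :: "real \<Rightarrow> 'a::euclidean_space"
  assumes w: "\<And>n. is_weak_deriv {- real n..real n} q (g n)" and contq: "continuous_on UNIV q"
  shows "\<exists>g. is_weak_deriv UNIV q g"
proof -
  have "\<exists>N. negligible N \<and> (\<forall>t\<in>{- real m<..<real m} - N. g m t = g n t)" if "m \<le> n" for m n
  proof -
    have "is_weak_deriv {- real m..real m} q (g n)"
      by (rule is_weak_deriv_subset[OF w]) (use that in auto)
    from weak_deriv_unique[OF w this continuous_on_subset[OF contq]] show ?thesis
      by (simp add: interior_atLeastAtMost_real)
  qed
  then obtain N where N: "\<And>m n. m \<le> n \<Longrightarrow> negligible (N m n) \<and> (\<forall>t\<in>{- real m<..<real m} - N m n. g m t = g n t)"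
    by metis
  define N' where "N' = \<Union>((\<lambda>(m, n). N m n) ` {(m, n). m \<le> n})"
  have N': "negligible N'" unfolding N'_def using N by (intro negligible_countable_Union) auto
  have agree: "g m t = g n t" if "t \<notin> N'" "\<bar>t\<bar> < real m" "\<bar>t\<bar> < real n" for m n t
  proof -
    have *: "g i t = g j t" if ij: "i \<le> j" "\<bar>t\<bar> < real i" for i j
    proof -
      have "t \<notin> N i j" using \<open>t \<notin> N'\<close> ij(1) by (auto simp: N'_def)
      then show ?thesis using N[OF ij(1)] ij(2) by (simp add: abs_less_iff)
    qed
    show ?thesis
    proof (cases "m \<le> n")
      case False
      then show ?thesis using *[of n m] that(3) by simp
    qed (rule *[OF _ that(2)])
  qed
  define k where "k t = nat \<lceil>\<bar>t\<bar>\<rceil> + 1" for t :: real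
  have k: "\<bar>t\<bar> < real (k t)" for t unfolding k_def by linarith
  define G where "G t = g (k t) t" for t
  have GN: "G t = g n t" if "t \<notin> N'" "\<bar>t\<bar> < real n" for n t
    unfolding G_def by (rule agree[OF that(1) k that(2)])
  have int_eq: "integral K (\<lambda>t. f t *\<^sub>R G t) = integral K (\<lambda>t. f t *\<^sub>R g n t)"
    if "K \<subseteq> {- real n<..<real n}" for K n f
    by (rule integral_spike[OF N']) (use GN[of _ n] that in \<open>auto simp: abs_less_iff subset_iff\<close>)
  have L1G: "G \<in> L1_loc UNIV"
    unfolding L1_loc_def
  proof safe
    fix K :: "real set" assume K: "compact K"
    then obtain n where n: "K \<subseteq> {- real n<..<real n}" by (rule compact_subset_Icc)
    then have "K \<subseteq> {- real n..real n}" by force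
    then have "g n absolutely_integrable_on K"
      using w[of n] K unfolding is_weak_deriv_def L1_loc_def by blast
    then show "G absolutely_integrable_on K"
      by (rule absolutely_integrable_spike[OF _ N']) (use GN[of _ n] n in \<open>auto simp: abs_less_iff subset_iff\<close>)
  qed
  have L1q: "q \<in> L1_loc UNIV"
    unfolding L1_loc_def
  proof safe
    fix K :: "real set" assume K: "compact K"
    then obtain n where "K \<subseteq> {- real n<..<real n}" by (rule compact_subset_Icc)
    then have "K \<subseteq> {- real n..real n}" by force
    then show "q absolutely_integrable_on K" using w[of n] K unfolding is_weak_deriv_def L1_loc_def by blast
  qed
  have "is_weak_deriv UNIV q G"
    unfolding is_weak_deriv_def
  proof (intro conjI ballI L1G L1q)
    fix \<psi> :: "real \<Rightarrow> real" assume \<psi>: "\<psi> \<in> test_functions UNIV"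
    obtain K where K: "compact K" "\<And>t. t \<notin> K \<Longrightarrow> \<psi> t = 0 \<and> deriv \<psi> t = 0"
      using test_function_support[OF \<psi>] by metis
    obtain n where n: "K \<subseteq> {- real n<..<real n}" using compact_subset_Icc[OF K(1)] .
    \<comment> \<open>One unit of margin puts the closed interval \<open>T'\<close> inside the open
      interval on which \<open>G\<close> agrees with \<open>g (Suc n)\<close> almost
      everywhere.\<close>
    define T where "T = {- real (Suc n)..real (Suc n)}"
    define T' where "T' = {- real n..real n}"
    have sub: "K \<subseteq> T'" "T' \<subseteq> T" "T' \<subseteq> {- real (Suc n)<..<real (Suc n)}" using n by (force simp: T'_def T_def)+
    have "\<psi> \<in> test_functions T"
    proof -
      have "interior T = {- real (Suc n)<..<real (Suc n)}" by (simp add: T_def interior_atLeastAtMost_real)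
      then have "K \<subseteq> interior T" using sub by simp
      then show ?thesis using \<psi> K unfolding test_functions_def by blast
    qed
    then have eq: "(LINT t:T|lebesgue. deriv \<psi> t *\<^sub>R q t) = - (LINT t:T|lebesgue. \<psi> t *\<^sub>R g (Suc n) t)"
      using w[of "Suc n"] unfolding T_def is_weak_deriv_def by blast
    have move: "(LINT t:UNIV|lebesgue. f t) = (LINT t:T'|lebesgue. f t)" "(LINT t:T|lebesgue. f t) = (LINT t:T'|lebesgue. f t)"
      if "\<And>t. t \<notin> K \<Longrightarrow> f t = 0" for f :: "real \<Rightarrow> 'a"
      using that sub by (intro set_integral_support; blast)+
    have "(\<lambda>t. \<psi> t *\<^sub>R g (Suc n) t) absolutely_integrable_on T'"
      unfolding T'_def
    proof (rule absolutely_integrable_continuous_scaleR[OF test_function_deriv(2)[OF \<psi>]])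
      show "g (Suc n) absolutely_integrable_on {- real n..real n}"
        using w[of "Suc n"] by (intro L1_loc_integrable[of _ "{- real (Suc n)..real (Suc n)}"]) (auto simp: is_weak_deriv_def)
    qed
    moreover have "(\<lambda>t. \<psi> t *\<^sub>R G t) absolutely_integrable_on T'"
      unfolding T'_def
      by (rule absolutely_integrable_continuous_scaleR[OF test_function_deriv(2)[OF \<psi>] L1_loc_integrable[OF L1G]]) simp
    ultimately have "(LINT t:T'|lebesgue. \<psi> t *\<^sub>R G t) = (LINT t:T'|lebesgue. \<psi> t *\<^sub>R g (Suc n) t)"
      using int_eq[OF sub(3)] by (simp add: set_lebesgue_integral_eq_integral(2))
    then show "(LINT t:UNIV|lebesgue. deriv \<psi> t *\<^sub>R q t) = - (LINT t:UNIV|lebesgue. \<psi> t *\<^sub>R G t)"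
      using eq move K(2) by simp
  qed
  then show ?thesis by blast
qed

lemma W1_Phi_loc_weak_deriv:
  fixes q :: "real \<Rightarrow> 'a::euclidean_space"
  assumes "q \<in> W1_Phi_loc \<phi>"
  shows "is_weak_deriv UNIV q (weak_deriv UNIV q)"
proof -
  have contq: "continuous_on UNIV q" and W: "\<And>a b. a < b \<Longrightarrow> q \<in> W1_Phi \<phi> {a..b}"
    using assms by (auto simp: W1_Phi_loc_def)
  have "\<exists>g. is_weak_deriv {- real n..real n} q g" for n
  proof -
    \<comment> \<open>\<open>Suc n\<close> is used because \<open>W1_Phi_loc\<close> speaks of
      nondegenerate intervals, and \<open>n = 0\<close> would give a single point.\<close>
    obtain g where "is_weak_deriv {- real (Suc n)..real (Suc n)} q g"
      using W[of "- real (Suc n)" "real (Suc n)"] by (auto simp: W1_Phi_def)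
    then show ?thesis using is_weak_deriv_subset[of _ q g "{- real n..real n}"] by fastforce
  qed
  then obtain g where "\<And>n. is_weak_deriv {- real n..real n} q (g n)" by metis
  then obtain g' where "is_weak_deriv UNIV q g'" using is_weak_deriv_exhaust contq by metis
  then show ?thesis by (rule is_weak_deriv_weak_deriv)
qed

lemma continuous_in_L_Phi:
  fixes q :: "real \<Rightarrow> 'a::euclidean_space"
  assumes "continuous_on {0..} (Phi \<phi>)" "continuous_on {a..b} q"
  shows "q \<in> L_Phi \<phi> {a..b}"
proof -
  have "q \<in> L1_loc {a..b}"
    unfolding L1_loc_def
  proof safe
    fix K assume "compact K" "K \<subseteq> {a..b}"
    then show "q absolutely_integrable_on K"
      using set_integrable_subset[OF absolutely_integrable_continuous_real[OF assms(2)]] lmeasurable_compact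
        fmeasurableD by blast
  qed
  moreover have "(\<integral>\<^sup>+t\<in>{a..b}. ennreal (Phi \<phi> (norm (q t) / 1)) \<partial>lebesgue) < \<infinity>"
  proof -
    have "continuous_on {a..b} (\<lambda>t. Phi \<phi> (norm (q t)))"
      by (rule continuous_on_compose2[OF assms(1)]) (auto intro!: continuous_intros assms(2))
    then have "bounded ((\<lambda>t. Phi \<phi> (norm (q t))) ` {a..b})"
      by (intro compact_imp_bounded compact_continuous_image) auto
    then obtain B where "\<forall>x\<in>(\<lambda>t. Phi \<phi> (norm (q t))) ` {a..b}. norm x \<le> B" unfolding bounded_iff by blast
    then have B: "\<bar>Phi \<phi> (norm (q t))\<bar> \<le> B" if "t \<in> {a..b}" for t using that by simp
    have "(\<integral>\<^sup>+t\<in>{a..b}. ennreal (Phi \<phi> (norm (q t) / 1)) \<partial>lebesgue) \<le> (\<integral>\<^sup>+t\<in>{a..b}. ennreal B \<partial>lebesgue)"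
      using B by (intro nn_integral_mono) (auto simp: indicator_def abs_le_iff intro!: ennreal_leI)
    also have "\<dots> = ennreal B * emeasure lebesgue {a..b}" by (rule nn_integral_cmult_indicator) simp
    also have "\<dots> < \<infinity>" by (simp add: ennreal_mult_less_top emeasure_lborel_Icc_eq)
    finally show ?thesis .
  qed
  ultimately show ?thesis unfolding L_Phi_def by (intro CollectI conjI exI[of _ 1]) auto
qed

lemma C1_in_W1_Phi_loc:
  fixes q :: "real \<Rightarrow> 'a::euclidean_space"
  assumes "continuous_on {0..} (Phi \<phi>)"
    and "\<And>t. (q has_vector_derivative g t) (at t)" and "continuous_on UNIV g"
  shows "q \<in> W1_Phi_loc \<phi>"
proof -
  have "continuous_on UNIV q"
    by (intro continuous_at_imp_continuous_on ballI has_vector_derivative_continuous[OF assms(2)])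
  then show ?thesis
    unfolding W1_Phi_loc_def W1_Phi_def
    using continuous_in_L_Phi[OF assms(1)] C1_is_weak_deriv[OF assms(2,3)] assms(3) continuous_on_subset
    by blast
qed

section \<open>Lengths of curves and approach to a set\<close>

context conformal_metric
begin

text \<open>Inscribed segments are compared with short subarcs. On such a segment \<open>F\<close>
  is at most \<open>F (q r0) + \<epsilon>\<close>, where \<open>r0\<close> minimises
  \<open>F\<close> along the subarc, so the minimum can be pulled into the integral. The slack
  \<open>\<epsilon>\<close> costs at most \<open>\<epsilon>\<close> times the Euclidean length and
  is removed at the end.\<close>

lemma jdist_curve:
  fixes q g :: "real \<Rightarrow> 'a"
  assumes ab: "a \<le> b" and contq: "continuous_on {a..b} q" and g: "g absolutely_integrable_on {a..b}"
    and incr: "\<And>s t. a \<le> s \<Longrightarrow> s \<le> t \<Longrightarrow> t \<le> b \<Longrightarrow> q t - q s = integral {s..t} g"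
  shows "jdist F (q a) (q b) \<le> integral {a..b} (\<lambda>t. F (q t) * norm (g t))"
proof -
  have contFq: "continuous_on {a..b} (\<lambda>t. F (q t))"
    by (rule continuous_on_compose2[OF cont_F contq]) auto
  have ng: "(\<lambda>t. norm (g t)) absolutely_integrable_on {a..b}" using g by (rule absolutely_integrable_norm[unfolded comp_def])
  have prod: "(\<lambda>t. f t * norm (g t)) integrable_on {s..t}"
    if "continuous_on {a..b} f" "a \<le> s" "t \<le> b" for f s t
  proof -
    have "(\<lambda>t. f t * norm (g t)) absolutely_integrable_on {a..b}"
      using absolutely_integrable_continuous_scaleR[OF that(1) ng] by simp
    then have "(\<lambda>t. f t * norm (g t)) integrable_on {a..b}" by (rule set_lebesgue_integral_eq_integral(1))
    then show ?thesis by (rule integrable_subinterval_real) (use that in auto)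
  qed
  define N where "N = integral {a..b} (\<lambda>t. norm (g t))"
  have N: "0 \<le> N" unfolding N_def by (rule integral_nonneg) (use prod[of "\<lambda>_. 1" a b] in auto)
  have approx: "jdist F (q a) (q b) \<le> integral {a..b} (\<lambda>t. (F (q t) + \<epsilon>) * norm (g t))" if \<epsilon>: "0 < \<epsilon>" for \<epsilon>
  proof -
    define f where "f t = F (q t) + \<epsilon>" for t
    have contf: "continuous_on {a..b} f" unfolding f_def by (intro continuous_intros contFq)
    have "bounded (q ` {a..b})" by (intro compact_imp_bounded compact_continuous_image contq) auto
    then obtain R where "\<forall>x\<in>q ` {a..b}. norm x \<le> R" unfolding bounded_iff by blast
    then have R: "q t \<in> cball 0 R" if "t \<in> {a..b}" for t using that by simp
    have "uniformly_continuous_on (cball 0 R) F"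
      by (intro compact_uniformly_continuous continuous_on_subset[OF cont_F]) auto
    then obtain d1 where d1: "0 < d1" "\<And>x y. x \<in> cball 0 R \<Longrightarrow> y \<in> cball 0 R \<Longrightarrow> dist y x < d1 \<Longrightarrow> dist (F y) (F x) < \<epsilon>"
      using \<epsilon> unfolding uniformly_continuous_on_def by metis
    have "uniformly_continuous_on {a..b} q" by (intro compact_uniformly_continuous contq) auto
    then obtain d2 where d2: "0 < d2" "\<And>s t. s \<in> {a..b} \<Longrightarrow> t \<in> {a..b} \<Longrightarrow> dist t s < d2 \<Longrightarrow> dist (q t) (q s) < d1 / 2"
      using d1(1) unfolding uniformly_continuous_on_def by (metis half_gt_zero)
    define L where "L t = integral {a..t} (\<lambda>t. f t * norm (g t))" for t
    have "jdist F (q a) (q b) - jdist F (q a) (q a) \<le> L b - L a"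
    proof (rule increment_le_of_local[OF ab d2(1)])
      fix t t' assume t: "a \<le> t" "t \<le> t'" "t' \<le> b" "t' - t < d2"
      have sub: "{t..t'} \<subseteq> {a..b}" using t by auto
      obtain r0 where r0: "r0 \<in> {t..t'}" "\<And>r. r \<in> {t..t'} \<Longrightarrow> f r0 \<le> f r"
        using continuous_attains_inf[of "{t..t'}" f] continuous_on_subset[OF contf sub] t by auto
      have "jdist F (q t) (q t') \<le> f r0 * norm (q t' - q t)"
      proof (rule jdist_seg)
        fix w assume w: "w \<in> closed_segment (q t) (q t')"
        have "closed_segment (q t) (q t') \<subseteq> cball 0 R" using R[of t] R[of t'] t by (intro closed_segment_subset) auto
        then have wR: "w \<in> cball 0 R" using w by blast
        have "dist (q t') (q t) < d1 / 2" using t by (intro d2(2)) (auto simp: dist_real_def)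
        moreover have "dist w (q t) \<le> dist (q t') (q t)"
          using segment_bound(1)[OF w] by (simp add: dist_norm)
        moreover have "dist (q t) (q r0) < d1 / 2" using t r0(1) by (intro d2(2)) (auto simp: dist_real_def)
        ultimately have "dist w (q r0) < d1" using dist_triangle[of w "q r0" "q t"] by linarith
        then have "dist (F w) (F (q r0)) < \<epsilon>" using wR R[of r0] r0(1) t by (intro d1(2)) auto
        then show "F w \<le> f r0" unfolding f_def dist_real_def by linarith
      qed
      also have "norm (q t' - q t) \<le> integral {t..t'} (\<lambda>t. norm (g t))"
        unfolding incr[OF t(1-3)] using prod[of "\<lambda>_. 1" t t'] t g
        by (intro integral_norm_bound_integral integrable_subinterval_real[OF set_lebesgue_integral_eq_integral(1)[OF g] sub]) auto
      also have "f r0 * integral {t..t'} (\<lambda>t. norm (g t)) = integral {t..t'} (\<lambda>t. f r0 * norm (g t))" by simp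
      also have "\<dots> \<le> integral {t..t'} (\<lambda>t. f t * norm (g t))"
        using prod[of "\<lambda>_. f r0" t t'] prod[OF contf, of t t'] t r0
        by (intro integral_le) (auto intro: mult_right_mono)
      also have "\<dots> = L t' - L t"
        unfolding L_def using Henstock_Kurzweil_Integration.integral_combine[of a t t' "\<lambda>t. f t * norm (g t)"]
          prod[OF contf, of a t'] t by simp
      finally have "jdist F (q t) (q t') \<le> L t' - L t" 
        using F_nonneg[of "q r0"] \<epsilon> by (simp add: f_def mult_left_mono)
      then show "jdist F (q a) (q t') - jdist F (q a) (q t) \<le> L t' - L t"
        using jdist_triangle[of "q a" "q t'" "q t"] by linarith
    qed
    then show ?thesis by (simp add: L_def f_def)
  qed
  show ?thesis
  proof (rule field_le_epsilon)
    fix e :: real assume e: "0 < e"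
    define \<epsilon> where "\<epsilon> = e / (N + 1)"
    have \<epsilon>: "0 < \<epsilon>" "\<epsilon> * N \<le> e" using e N by (auto simp: \<epsilon>_def field_simps)
    have "jdist F (q a) (q b) \<le> integral {a..b} (\<lambda>t. F (q t) * norm (g t) + \<epsilon> * norm (g t))"
      using approx[OF \<epsilon>(1)] by (simp add: distrib_right)
    also have "\<dots> = integral {a..b} (\<lambda>t. F (q t) * norm (g t)) + \<epsilon> * N"
      using prod[OF contFq, of a b] prod[of "\<lambda>_. \<epsilon>" a b] by (simp add: integral_add N_def)
    finally show "jdist F (q a) (q b) \<le> integral {a..b} (\<lambda>t. F (q t) * norm (g t)) + e" using \<epsilon>(2) by linarith
  qed
qed

text \<open>Around each parameter the constants of \<open>geodesic_patch\<close> come from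
  compactness of a small ball in \<open>U\<close>. The local momenta agree because each is
  \<open>F\<^sup>2\<close> times the derivative of \<open>\<gamma>\<close>.\<close>

lemma geodesic_smooth:
  assumes U: "open U" "\<And>x. x \<in> U \<Longrightarrow> GDERIV F x :> DF x" "continuous_on U DF" "\<And>x. x \<in> U \<Longrightarrow> 0 < F x"
    and geo: "\<And>s t. s \<in> {a<..<b} \<Longrightarrow> t \<in> {a<..<b} \<Longrightarrow> jdist F (\<gamma> s) (\<gamma> t) = \<bar>s - t\<bar>"
    and \<gamma>U: "\<And>s. s \<in> {a<..<b} \<Longrightarrow> \<gamma> s \<in> U"
  shows "\<exists>\<pi>. \<forall>s\<in>{a<..<b}. (\<gamma> has_vector_derivative (\<pi> s /\<^sub>R (F (\<gamma> s))\<^sup>2)) (at s) \<and>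
    (\<pi> has_vector_derivative (DF (\<gamma> s) /\<^sub>R F (\<gamma> s))) (at s) \<and> norm (\<pi> s) = F (\<gamma> s)"
proof -
  have local: "\<exists>d>0. \<exists>\<pi>. \<forall>s\<in>{s0 - d<..<s0 + d}. (\<gamma> has_vector_derivative (\<pi> s /\<^sub>R (F (\<gamma> s))\<^sup>2)) (at s) \<and>
    (\<pi> has_vector_derivative (DF (\<gamma> s) /\<^sub>R F (\<gamma> s))) (at s) \<and> norm (\<pi> s) = F (\<gamma> s)"
    if s0: "s0 \<in> {a<..<b}" for s0
  proof -
    define x0 where "x0 = \<gamma> s0"
    obtain \<rho> where \<rho>: "0 < \<rho>" "cball x0 \<rho> \<subseteq> U"
      using U(1) \<gamma>U[OF s0] open_contains_cball unfolding x0_def by blast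
    obtain xm where xm: "xm \<in> cball x0 \<rho>" "\<And>x. x \<in> cball x0 \<rho> \<Longrightarrow> F xm \<le> F x"
      using continuous_attains_inf[of "cball x0 \<rho>" F] continuous_on_subset[OF cont_F] \<rho>(1) by auto
    define f where "f = F xm"
    have f: "0 < f" "\<And>x. x \<in> cball x0 \<rho> \<Longrightarrow> f \<le> F x" using xm U(4) \<rho>(2) by (auto simp: f_def)
    obtain B where B: "\<And>x. x \<in> cball x0 \<rho> \<Longrightarrow> F x \<le> B" using F_bound by blast
    have contDF: "continuous_on (cball x0 \<rho>) DF" by (rule continuous_on_subset[OF U(3) \<rho>(2)])
    then have "bounded (DF ` cball x0 \<rho>)" by (intro compact_imp_bounded compact_continuous_image) auto
    then obtain M where M: "0 < M" "\<And>x. x \<in> cball x0 \<rho> \<Longrightarrow> norm (DF x) \<le> M" by (auto simp: bounded_pos)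
    have lip: "\<bar>F x - F y\<bar> \<le> M * norm (x - y)" if "x \<in> cball x0 \<rho>" "y \<in> cball x0 \<rho>" for x y
    proof -
      have "norm (F x - F y) \<le> M * norm (x - y)"
      proof (rule differentiable_bound[of "cball x0 \<rho>" F "\<lambda>x h. h \<bullet> DF x"])
        fix x assume x: "x \<in> cball x0 \<rho>"
        then have "(F has_derivative (\<lambda>h. h \<bullet> DF x)) (at x)"
          using U(2) \<rho>(2) unfolding gderiv_def by blast
        then show "(F has_derivative (\<lambda>h. h \<bullet> DF x)) (at x within cball x0 \<rho>)"
          by (rule has_derivative_at_withinI)
        show "onorm (\<lambda>h. h \<bullet> DF x) \<le> M"
        proof (rule onorm_bound)
          fix h have "norm (h \<bullet> DF x) \<le> norm h * norm (DF x)" by (simp add: Cauchy_Schwarz_ineq2)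
          also have "\<dots> \<le> norm h * M" using M(2)[OF x] by (intro mult_left_mono) auto
          finally show "norm (h \<bullet> DF x) \<le> M * norm h" by (simp add: mult.commute)
        qed (use M in simp)
      qed (use that in auto)
      then show ?thesis by simp
    qed
    \<comment> \<open>Moving by \<open>\<rho> / 4\<close> inside the ball costs at least
      \<open>f * \<rho> / 4\<close>, so this \<open>\<delta>\<close> confines the arc to the
      patch.\<close>
    define \<delta> where "\<delta> = min (f * \<rho> / 4) (min (s0 - a) (b - s0))"
    have \<delta>: "0 < \<delta>" "ball s0 \<delta> \<subseteq> {a<..<b}" "\<delta> \<le> f * \<rho> / 4"
    proof -
      show "\<delta> \<le> f * \<rho> / 4" unfolding \<delta>_def by (rule min.cobounded1)
      show "0 < \<delta>" "ball s0 \<delta> \<subseteq> {a<..<b}" using f(1) \<rho>(1) s0 unfolding \<delta>_def by (auto simp: dist_real_def)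
    qed
    have near: "\<gamma> s \<in> cball x0 (\<rho> / 4)" if s: "s \<in> ball s0 \<delta>" for s
    proof (rule ccontr)
      assume "\<not> ?thesis"
      then have "\<rho> / 4 \<le> min \<rho> (dist x0 (\<gamma> s))" using \<rho>(1) by simp
      then have "f * (\<rho> / 4) \<le> f * min \<rho> (dist x0 (\<gamma> s))" using f(1) by (intro mult_left_mono) auto
      also have "\<dots> \<le> jdist F x0 (\<gamma> s)" using f \<rho>(1) by (intro jdist_lower) auto
      also have "\<dots> = \<bar>s0 - s\<bar>" unfolding x0_def using geo[OF s0, of s] \<delta>(2) s by blast
      also have "\<dots> < f * \<rho> / 4" using s \<delta>(3) by (simp add: dist_real_def)
      finally show False by simp
    qed
    interpret geodesic_patch F DF \<gamma> s0 \<delta> \<rho> f M B x0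
    proof unfold_locales
      show "0 < \<delta>" "0 < \<rho>" "0 < f" "0 \<le> M" using \<delta> \<rho> f M by auto
      show "x \<in> cball x0 \<rho> \<Longrightarrow> f \<le> F x" for x by (rule f(2))
      show "x \<in> cball x0 \<rho> \<Longrightarrow> F x \<le> B" for x by (rule B)
      show "x \<in> cball x0 \<rho> \<Longrightarrow> y \<in> cball x0 \<rho> \<Longrightarrow> \<bar>F x - F y\<bar> \<le> M * norm (x - y)" for x y by (rule lip)
      show "x \<in> cball x0 \<rho> \<Longrightarrow> GDERIV F x :> DF x" for x using U(2) \<rho>(2) by blast
      show "continuous_on (cball x0 \<rho>) DF" by (rule contDF)
      show "s \<in> ball s0 \<delta> \<Longrightarrow> t \<in> ball s0 \<delta> \<Longrightarrow> jdist F (\<gamma> s) (\<gamma> t) = \<bar>s - t\<bar>" for s t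
        using geo \<delta>(2) by blast
      show "s \<in> ball s0 \<delta> \<Longrightarrow> \<gamma> s \<in> cball x0 (\<rho> / 4)" for s by (rule near)
    qed
    show ?thesis using geodesic_C1 \<delta>(1) unfolding A_def by (intro exI[of _ "\<delta> / 2"]) simp
  qed
  define \<pi> where "\<pi> s = (F (\<gamma> s))\<^sup>2 *\<^sub>R vector_derivative \<gamma> (at s)" for s
  have "(\<gamma> has_vector_derivative (\<pi> s0 /\<^sub>R (F (\<gamma> s0))\<^sup>2)) (at s0) \<and>
    (\<pi> has_vector_derivative (DF (\<gamma> s0) /\<^sub>R F (\<gamma> s0))) (at s0) \<and> norm (\<pi> s0) = F (\<gamma> s0)"
    if s0: "s0 \<in> {a<..<b}" for s0
  proof -
    obtain d0 \<pi>' where d0: "d0 > 0" and loc0: "\<forall>s\<in>{s0 - d0<..<s0 + d0}. (\<gamma> has_vector_derivative (\<pi>' s /\<^sub>R (F (\<gamma> s))\<^sup>2)) (at s) \<and>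
      (\<pi>' has_vector_derivative (DF (\<gamma> s) /\<^sub>R F (\<gamma> s))) (at s) \<and> norm (\<pi>' s) = F (\<gamma> s)"
      using local[OF s0] by blast
    define d where "d = min d0 (min (s0 - a) (b - s0))"
    have d: "d > 0" "{s0 - d<..<s0 + d} \<subseteq> {a<..<b}" using d0 s0 by (auto simp: d_def)
    have loc: "(\<gamma> has_vector_derivative (\<pi>' s /\<^sub>R (F (\<gamma> s))\<^sup>2)) (at s)"
      "(\<pi>' has_vector_derivative (DF (\<gamma> s) /\<^sub>R F (\<gamma> s))) (at s)" "norm (\<pi>' s) = F (\<gamma> s)"
      if "s \<in> {s0 - d<..<s0 + d}" for s
    proof -
      have "s \<in> {s0 - d0<..<s0 + d0}" using that by (auto simp: d_def)
      with loc0 show "(\<gamma> has_vector_derivative (\<pi>' s /\<^sub>R (F (\<gamma> s))\<^sup>2)) (at s)"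
        "(\<pi>' has_vector_derivative (DF (\<gamma> s) /\<^sub>R F (\<gamma> s))) (at s)" "norm (\<pi>' s) = F (\<gamma> s)" by blast+
    qed
    have eq: "\<pi> s = \<pi>' s" if s: "s \<in> {s0 - d<..<s0 + d}" for s
    proof -
      have "F (\<gamma> s) \<noteq> 0" using U(4)[OF \<gamma>U] s d(2) by fastforce
      then show ?thesis unfolding \<pi>_def vector_derivative_at[OF loc(1)[OF s]] by simp
    qed
    have s0': "s0 \<in> {s0 - d<..<s0 + d}" using d by simp
    have "(\<pi> has_vector_derivative (DF (\<gamma> s0) /\<^sub>R F (\<gamma> s0))) (at s0)"
      by (rule has_vector_derivative_transform_within_open[OF loc(2)[OF s0'] _ s0']) (auto simp: eq)
    then show ?thesis using loc[OF s0'] eq[OF s0'] by simp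
  qed
  then show ?thesis by blast
qed

text \<open>Converts the Euclidean approach to a well, which is what competitors satisfy, into
  approach in \<open>jdist\<close>; \<open>F\<close> is bounded near the compact set.\<close>

lemma jdist_compact_near:
  assumes "compact A" "A \<noteq> {}" "0 < \<eta>"
  shows "\<exists>\<delta>>0. \<forall>z. infdist z A < \<delta> \<longrightarrow> (\<exists>x\<in>A. jdist F x z < \<eta>)"
proof -
  obtain R where R: "A \<subseteq> cball 0 R" using compact_imp_bounded[OF assms(1)] by (auto simp: bounded_iff subset_iff)
  obtain B where B: "0 \<le> B" "\<And>x. x \<in> cball 0 (R + 1) \<Longrightarrow> F x \<le> B" using F_bound by blast
  define \<delta> where "\<delta> = min 1 (\<eta> / (B + 1))"
  have \<delta>: "0 < \<delta>" "\<delta> \<le> 1" "\<delta> \<le> \<eta> / (B + 1)" using assms(3) B(1) by (auto simp: \<delta>_def)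
  show ?thesis
  proof (intro exI[of _ \<delta>] conjI allI impI)
    fix z assume z: "infdist z A < \<delta>"
    obtain x where x: "x \<in> A" "infdist z A = dist z x"
      using infdist_attains_inf[OF compact_imp_closed[OF assms(1)] assms(2)] by blast
    have "norm z \<le> norm x + dist z x" by (metis dist_norm norm_triangle_sub)
    then have "x \<in> cball 0 (R + 1)" "z \<in> cball 0 (R + 1)" using x z R \<delta>(2) by auto
    then have "jdist F x z \<le> B * norm (z - x)" by (intro jdist_cball[OF B(2)])
    also have "\<dots> \<le> B * \<delta>" using x z B(1) by (intro mult_left_mono) (auto simp: dist_norm)
    also have "\<dots> \<le> B * (\<eta> / (B + 1))" using \<delta> B(1) by (intro mult_left_mono) auto
    also have "\<dots> < \<eta>" using assms(3) B(1) by (simp add: field_simps)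
    finally show "\<exists>x\<in>A. jdist F x z < \<eta>" using x by blast
  qed (rule \<delta>(1))
qed

text \<open>Where \<open>F\<close> degenerates, small \<open>jdist\<close> does not by itself
  control the Euclidean distance. With the assumption on the zero set, \<open>jdist F x\<close> has
  a positive minimum on the compact set of bounded points at distance at least \<open>\<eta>\<close>
  from \<open>A\<close>.\<close>

lemma infdist_small_of_jdist:
  assumes A: "x \<in> A" "\<And>z. jdist F x z = 0 \<Longrightarrow> z \<in> A"
    and bdd: "\<And>z. jdist F x z \<le> 1 \<Longrightarrow> norm z \<le> R" and "0 < \<eta>"
  shows "\<exists>\<delta>>0. \<forall>z. jdist F x z < \<delta> \<longrightarrow> infdist z A < \<eta>"
proof -
  define T where "T = {z \<in> cball 0 R. \<eta> \<le> infdist z A}"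
  have "closed {z. \<eta> \<le> infdist z A}" by (intro closed_Collect_le continuous_intros continuous_on_infdist)
  then have "compact (cball 0 R \<inter> {z. \<eta> \<le> infdist z A})" by (rule compact_Int_closed[OF compact_cball])
  moreover have "T = cball 0 R \<inter> {z. \<eta> \<le> infdist z A}" unfolding T_def by auto
  ultimately have T: "compact T" by simp
  show ?thesis
  proof (cases "T = {}")
    case True
    have "infdist z A < \<eta>" if "jdist F x z < 1" for z
    proof (rule ccontr)
      assume "\<not> ?thesis"
      then have "z \<in> T" using bdd[of z] that by (auto simp: T_def)
      then show False using True by simp
    qed
    then show ?thesis by (intro exI[of _ 1]) auto
  next
    case False
    have "continuous_on T (\<lambda>z. jdist F x z)" by (intro continuous_on_jdist continuous_intros)
    then obtain z0 where z0: "z0 \<in> T" "\<And>z. z \<in> T \<Longrightarrow> jdist F x z0 \<le> jdist F x z"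
      using continuous_attains_inf[OF T False] by blast
    have "z0 \<notin> A" using z0(1) \<open>0 < \<eta>\<close> by (auto simp: T_def)
    then have "0 < jdist F x z0" using A(2)[of z0] jdist_nonneg[of x z0] by fastforce
    moreover have "infdist z A < \<eta>" if "jdist F x z < min 1 (jdist F x z0)" for z
    proof (rule ccontr)
      assume "\<not> ?thesis"
      then have "z \<in> T" using bdd[of z] that by (auto simp: T_def)
      then show False using z0(2) that by fastforce
    qed
    ultimately show ?thesis by (intro exI[of _ "min 1 (jdist F x z0)"]) auto
  qed
qed

end

section \<open>Time change and extension\<close>

lemma einterval_between: "x \<in> einterval \<alpha> \<omega> \<Longrightarrow> y \<in> einterval \<alpha> \<omega> \<Longrightarrow> x \<le> z \<Longrightarrow> z \<le> y \<Longrightarrow> z \<in> einterval \<alpha> \<omega>"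
  by (cases \<alpha>; cases \<omega>) (auto simp: einterval_iff)

text \<open>\<open>\<tau>\<close>, a primitive of \<open>1 / e\<close>, is time as a function of the
  parameter, and \<open>\<sigma>\<close> is its inverse. The ends \<open>\<alpha>\<close> and
  \<open>\<omega>\<close> are the infimum and the supremum of \<open>\<tau>\<close>, infinite when
  \<open>1 / e\<close> is not integrable near 0 or \<open>D\<close>.\<close>

lemma time_change:
  fixes e :: "real \<Rightarrow> real"
  assumes D: "0 < D" and e: "\<And>s. s \<in> {0<..<D} \<Longrightarrow> 0 < e s" "continuous_on {0<..<D} e"
  shows "\<exists>(\<alpha>::ereal) \<omega> \<sigma>. \<alpha> < \<omega> \<and>
    (\<forall>t\<in>einterval \<alpha> \<omega>. \<sigma> t \<in> {0<..<D} \<and> (\<sigma> has_real_derivative e (\<sigma> t)) (at t)) \<and>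
    (\<forall>s\<in>{0<..<D}. \<exists>t\<in>einterval \<alpha> \<omega>. \<sigma> t = s) \<and>
    (\<forall>t\<in>einterval \<alpha> \<omega>. \<forall>u\<in>einterval \<alpha> \<omega>. t < u \<longrightarrow> \<sigma> t < \<sigma> u)"
proof -
  have "isCont (\<lambda>s. 1 / e s) s" if s: "s \<in> {0<..<D}" for s
  proof -
    have "isCont e s" using e(2) s by (simp add: continuous_on_eq_continuous_at)
    then show ?thesis using e(1)[OF s] by (intro continuous_intros) auto
  qed
  then obtain \<tau> where "\<forall>x. ereal 0 < ereal x \<longrightarrow> ereal x < ereal D \<longrightarrow> (\<tau> has_vector_derivative 1 / e x) (at x)"
    using einterval_antiderivative[of "ereal 0" "ereal D" "\<lambda>s. 1 / e s"] D by auto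
  then have d\<tau>: "(\<tau> has_real_derivative 1 / e s) (at s)" if "s \<in> {0<..<D}" for s
    using that by (simp add: has_real_derivative_iff_has_vector_derivative)
  have mono: "\<tau> s < \<tau> s'" if "s \<in> {0<..<D}" "s' \<in> {0<..<D}" "s < s'" for s s'
  proof (rule DERIV_pos_imp_increasing[OF that(3)])
    fix x assume "s \<le> x" "x \<le> s'"
    then have x: "x \<in> {0<..<D}" using that by auto
    then show "\<exists>y. (\<tau> has_real_derivative y) (at x) \<and> 0 < y" using d\<tau>[OF x] e(1)[OF x] by (intro exI[of _ "1 / e x"]) auto
  qed
  have inj: "s = s'" if "s \<in> {0<..<D}" "s' \<in> {0<..<D}" "\<tau> s = \<tau> s'" for s s'
    using mono[of s s'] mono[of s' s] that by (cases s s' rule: linorder_cases) auto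
  define \<alpha> where "\<alpha> = (INF s\<in>{0<..<D}. ereal (\<tau> s))"
  define \<omega> where "\<omega> = (SUP s\<in>{0<..<D}. ereal (\<tau> s))"
  have range: "\<tau> s \<in> einterval \<alpha> \<omega>" if s: "s \<in> {0<..<D}" for s
  proof -
    have s2: "s / 2 \<in> {0<..<D}" "(s + D) / 2 \<in> {0<..<D}" using s by auto
    have "\<alpha> \<le> ereal (\<tau> (s / 2))" unfolding \<alpha>_def by (rule INF_lower[OF s2(1)])
    also have "\<dots> < ereal (\<tau> s)" using mono[OF s2(1) s] s by simp
    finally have 1: "\<alpha> < ereal (\<tau> s)" .
    have "ereal (\<tau> s) < ereal (\<tau> ((s + D) / 2))" using mono[OF s s2(2)] s by simp
    also have "\<dots> \<le> \<omega>" unfolding \<omega>_def by (rule SUP_upper[OF s2(2)])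
    finally show ?thesis using 1 by (simp add: einterval_def)
  qed
  have between: "\<exists>s1\<in>{0<..<D}. \<exists>s2\<in>{0<..<D}. \<tau> s1 < t \<and> t < \<tau> s2" if "t \<in> einterval \<alpha> \<omega>" for t
    using that by (auto simp: einterval_def \<alpha>_def \<omega>_def INF_less_iff less_SUP_iff)
  have onto: "\<exists>s\<in>{0<..<D}. \<tau> s = t" if t: "t \<in> einterval \<alpha> \<omega>" for t
  proof -
    obtain s1 s2 where s: "s1 \<in> {0<..<D}" "s2 \<in> {0<..<D}" "\<tau> s1 < t" "t < \<tau> s2" using between[OF t] by blast
    have "s1 \<le> s2" using mono[OF s(2,1)] s(3,4) by fastforce
    moreover have "isCont \<tau> x" if "s1 \<le> x \<and> x \<le> s2" for x
      using d\<tau>[of x] s that DERIV_isCont by fastforce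
    ultimately obtain x where "s1 \<le> x" "x \<le> s2" "\<tau> x = t" using IVT[of \<tau> s1 t s2] s by auto
    then show ?thesis using s by auto
  qed
  define \<sigma> where "\<sigma> t = (THE s. s \<in> {0<..<D} \<and> \<tau> s = t)" for t
  have \<sigma>\<tau>: "\<sigma> (\<tau> s) = s" if "s \<in> {0<..<D}" for s
    unfolding \<sigma>_def using that inj by (intro the_equality) auto
  have \<sigma>: "\<sigma> t \<in> {0<..<D}" "\<tau> (\<sigma> t) = t" if "t \<in> einterval \<alpha> \<omega>" for t
    using onto[OF that] \<sigma>\<tau> by auto
  have cont\<sigma>: "isCont \<sigma> t" if t: "t \<in> einterval \<alpha> \<omega>" for t
  proof -
    define x where "x = \<sigma> t"
    define d where "d = min x (D - x) / 2"
    have x: "x \<in> {0<..<D}" using \<sigma>[OF t] by (simp add: x_def)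
    have d: "0 < d" "\<And>z. \<bar>z - x\<bar> \<le> d \<Longrightarrow> z \<in> {0<..<D}"
    proof -
      show "0 < d" using x by (simp add: d_def)
      fix z assume "\<bar>z - x\<bar> \<le> d"
      moreover have "d \<le> x / 2" "d \<le> (D - x) / 2" by (auto simp: d_def)
      ultimately have "0 < z" "z < D" using x by (auto simp: abs_le_iff)
      then show "z \<in> {0<..<D}" by simp
    qed
    have "isCont \<sigma> (\<tau> x)"
    proof (rule isCont_inverse_function[where f = \<tau> and d = d])
      show "\<And>z. \<bar>z - x\<bar> \<le> d \<Longrightarrow> \<sigma> (\<tau> z) = z" using d(2) \<sigma>\<tau> by blast
      show "\<And>z. \<bar>z - x\<bar> \<le> d \<Longrightarrow> isCont \<tau> z" using d(2) d\<tau> DERIV_isCont by blast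
    qed (rule d(1))
    then show ?thesis using \<sigma>(2)[OF t] by (simp add: x_def)
  qed
  have d\<sigma>: "(\<sigma> has_real_derivative e (\<sigma> t)) (at t)" if t: "t \<in> einterval \<alpha> \<omega>" for t
  proof -
    obtain s1 s2 where s: "s1 \<in> {0<..<D}" "s2 \<in> {0<..<D}" "\<tau> s1 < t" "t < \<tau> s2" using between[OF t] by blast
    have "(\<sigma> has_real_derivative inverse (1 / e (\<sigma> t))) (at t)"
    proof (rule DERIV_inverse_function[where f = \<tau> and a = "\<tau> s1" and b = "\<tau> s2"])
      show "(\<tau> has_real_derivative 1 / e (\<sigma> t)) (at (\<sigma> t))" by (rule d\<tau>[OF \<sigma>(1)[OF t]])
      show "1 / e (\<sigma> t) \<noteq> 0" using e(1)[OF \<sigma>(1)[OF t]] by simp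
      fix y assume "\<tau> s1 < y" "y < \<tau> s2"
      then have "y \<in> einterval \<alpha> \<omega>"
        using einterval_between[OF range[OF s(1)] range[OF s(2)]] by simp
      then show "\<tau> (\<sigma> y) = y" by (rule \<sigma>(2))
    qed (use s cont\<sigma>[OF t] in auto)
    then show ?thesis by simp
  qed
  have m\<sigma>: "\<sigma> t < \<sigma> u" if "t \<in> einterval \<alpha> \<omega>" "u \<in> einterval \<alpha> \<omega>" "t < u" for t u
  proof (rule ccontr)
    assume "\<not> \<sigma> t < \<sigma> u"
    then have "\<sigma> u < \<sigma> t \<or> \<sigma> u = \<sigma> t" by auto
    then have "u \<le> t" using mono[OF \<sigma>(1)[OF that(2)] \<sigma>(1)[OF that(1)]] \<sigma>(2)[OF that(1)] \<sigma>(2)[OF that(2)] by auto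
    then show False using that by simp
  qed
  have "D / 2 \<in> {0<..<D}" using D by simp
  then have lt: "\<alpha> < \<omega>" using range[of "D / 2"] by (auto simp: einterval_def)
  have "\<forall>t\<in>einterval \<alpha> \<omega>. \<sigma> t \<in> {0<..<D} \<and> (\<sigma> has_real_derivative e (\<sigma> t)) (at t)"
    by (intro ballI conjI \<sigma>(1) d\<sigma>)
  moreover have "\<forall>s\<in>{0<..<D}. \<exists>t\<in>einterval \<alpha> \<omega>. \<sigma> t = s"
    using \<sigma>\<tau> range by (intro ballI) (rule_tac x = "\<tau> s" in bexI, auto)
  moreover have "\<forall>t\<in>einterval \<alpha> \<omega>. \<forall>u\<in>einterval \<alpha> \<omega>. t < u \<longrightarrow> \<sigma> t < \<sigma> u"
    by (intro ballI impI m\<sigma>)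
  ultimately show ?thesis using lt by (intro exI conjI)
qed

text \<open>The speed is \<open>h (q0 t)\<close> and \<open>h\<close> vanishes on \<open>A\<close>
  and \<open>B\<close>, so the velocity tends to 0 at a finite end and resting there is a C1
  continuation.\<close>

lemma C1_extension:
  fixes q0 Q :: "real \<Rightarrow> 'a::euclidean_space" and h :: "'a \<Rightarrow> real"
  assumes lt: "\<alpha> < \<omega>"
    and d: "\<And>t. t \<in> einterval \<alpha> \<omega> \<Longrightarrow> (q0 has_vector_derivative Q t) (at t)"
    and contQ: "continuous_on (einterval \<alpha> \<omega>) Q"
    and speed: "\<And>t. t \<in> einterval \<alpha> \<omega> \<Longrightarrow> norm (Q t) = h (q0 t)"
    and bound: "\<And>t. t \<in> einterval \<alpha> \<omega> \<Longrightarrow> h (q0 t) \<le> C"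
    and conth: "continuous_on UNIV h"
    and AB: "closed A" "closed B" "A \<noteq> {}" "B \<noteq> {}" "\<And>x. x \<in> A \<union> B \<Longrightarrow> h x = 0"
    and left: "\<And>\<eta>. 0 < \<eta> \<Longrightarrow> \<exists>T\<in>einterval \<alpha> \<omega>. \<forall>t\<in>einterval \<alpha> \<omega>. t < T \<longrightarrow> infdist (q0 t) A < \<eta>"
    and right: "\<And>\<eta>. 0 < \<eta> \<Longrightarrow> \<exists>T\<in>einterval \<alpha> \<omega>. \<forall>t\<in>einterval \<alpha> \<omega>. T < t \<longrightarrow> infdist (q0 t) B < \<eta>"
  shows "\<exists>q. (\<forall>t\<in>einterval \<alpha> \<omega>. q t = q0 t) \<and> (\<forall>t. ereal t \<le> \<alpha> \<longrightarrow> q t \<in> A) \<and> (\<forall>t. \<omega> \<le> ereal t \<longrightarrow> q t \<in> B) \<and>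
    (\<forall>t. (q has_vector_derivative (if t \<in> einterval \<alpha> \<omega> then Q t else 0)) (at t)) \<and>
    continuous_on UNIV (\<lambda>t. if t \<in> einterval \<alpha> \<omega> then Q t else 0) \<and>
    (\<forall>t. \<exists>s\<in>closure (einterval \<alpha> \<omega>). q t = q s)"
proof -
  define I where "I = einterval \<alpha> \<omega>"
  have I: "open I" "convex I" "I \<noteq> {}"
  proof -
    show "open I" "I \<noteq> {}" using einterval_nonempty[OF lt] by (auto simp: I_def)
    have "is_interval I" unfolding is_interval_1 I_def using einterval_between by blast
    then show "convex I" by (rule is_interval_convex)
  qed
  obtain t0 where t0: "t0 \<in> I" using I(3) by blast
  have C: "0 \<le> C" using bound[of t0] speed[of t0] t0 norm_ge_zero[of "Q t0"] unfolding I_def by linarith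
  have lip: "C-lipschitz_on I q0"
  proof (rule lipschitz_onI)
    fix x y assume xy: "x \<in> I" "y \<in> I"
    have "norm (q0 x - q0 y) \<le> C * norm (x - y)"
    proof (rule differentiable_bound[OF I(2), of q0 "\<lambda>t s. s *\<^sub>R Q t"])
      fix t assume t: "t \<in> I"
      show "(q0 has_derivative (\<lambda>s. s *\<^sub>R Q t)) (at t within I)"
        using d[of t] t unfolding I_def has_vector_derivative_def by (blast intro: has_derivative_at_withinI)
      have "norm (Q t) \<le> C" using speed[of t] bound[of t] t unfolding I_def by simp
      then show "onorm (\<lambda>s. s *\<^sub>R Q t) \<le> C"
        by (intro onorm_le) (simp add: mult_left_mono mult.commute[of C])
    qed (use xy in auto)
    then show "dist (q0 x) (q0 y) \<le> C * dist x y" by (simp add: dist_norm)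
  qed (rule C)
  then obtain g where g: "C-lipschitz_on (closure I) g" "\<And>t. t \<in> I \<Longrightarrow> g t = q0 t"
    using lipschitz_extend_closure by blast
  \<comment> \<open>Projection onto the closed interval: it fixes the closure of \<open>I\<close>
    and sends every time beyond a finite end to that end.\<close>
  define \<kappa> where "\<kappa> = closest_point (closure I)"
  have cl: "closed (closure I)" "convex (closure I)" "closure I \<noteq> {}" using I by (auto intro: convex_closure)
  define q where "q t = g (\<kappa> t)" for t
  have qI: "q t = q0 t" if "t \<in> I" for t
    using that g(2) closure_subset[of I] by (auto simp: q_def \<kappa>_def closest_point_self)
  have "continuous_on UNIV \<kappa>" unfolding \<kappa>_def by (rule continuous_on_closest_point[OF cl(2,1,3)])
  then have contq: "continuous_on UNIV q"
    unfolding q_def by (rule continuous_on_compose2[OF lipschitz_on_continuous_on[OF g(1)]])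
      (auto simp: \<kappa>_def intro: closest_point_in_set[OF cl(1,3)])
  have endpoint: "g a \<in> E" if E: "closed E" "E \<noteq> {}" and a: "a \<in> closure I"
    and near: "\<And>d \<eta>. 0 < d \<Longrightarrow> 0 < \<eta> \<Longrightarrow> \<exists>x\<in>I. \<bar>x - a\<bar> < d \<and> infdist (q0 x) E < \<eta>" for E a
  proof -
    have "infdist (g a) E \<le> 0 + \<eta>" if \<eta>: "0 < \<eta>" for \<eta>
    proof -
      obtain x where x: "x \<in> I" "\<bar>x - a\<bar> < \<eta> / 2 / (C + 1)" "infdist (q0 x) E < \<eta> / 2"
        using near[of "\<eta> / 2 / (C + 1)" "\<eta> / 2"] \<eta> C by auto
      have "dist (g a) (g x) \<le> C * dist a x"
        using lipschitz_onD[OF g(1) a] x(1) closure_subset[of I] by blast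
      also have "\<dots> \<le> (C + 1) * (\<eta> / 2 / (C + 1))"
        using x(2) C by (intro mult_mono) (auto simp: dist_real_def abs_minus_commute)
      also have "\<dots> = \<eta> / 2"
      proof -
        have "C + 1 \<noteq> 0" using C by linarith
        then show ?thesis by (simp del: divide_divide_eq_left)
      qed
      finally show ?thesis using infdist_triangle[of "g a" E "g x"] x(3) g(2)[OF x(1)] by simp
    qed
    then have "infdist (g a) E \<le> 0" by (rule field_le_epsilon)
    then show ?thesis using in_closed_iff_infdist_zero[OF E] infdist_nonneg[of "g a" E] by simp
  qed
  have qA: "q t = q s" "q t \<in> A" if t: "ereal t \<le> \<alpha>" and s: "ereal s \<le> \<alpha>" for s t
  proof -
    obtain a where a: "\<alpha> = ereal a" using t lt by (cases \<alpha>) auto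
    have dense: "\<exists>x\<in>I. \<bar>x - a\<bar> < d \<and> x < T" if "0 < d" "T \<in> I" for d T
    proof -
      have "\<alpha> < min (ereal T) (ereal (a + d))" using that a by (auto simp: I_def einterval_iff)
      then obtain x where "x \<in> einterval \<alpha> (min (ereal T) (ereal (a + d)))" using einterval_nonempty by blast
      then have x: "a < x" "x < T" "x < a + d" using a by (auto simp: einterval_iff)
      have "ereal x < \<omega>" using x(2) that(2) unfolding I_def einterval_iff
        by (meson ereal_less_eq(3) le_less_trans less_imp_le)
      then have "x \<in> I" using x(1) a by (simp add: I_def einterval_iff)
      then show ?thesis using x by (intro bexI[of _ x]) auto
    qed
    have acl: "a \<in> closure I" unfolding closure_approachable
      using dense[OF _ t0] by (auto simp: dist_real_def)
    have "closure I \<subseteq> {a..}" by (rule closure_minimal) (auto simp: I_def einterval_iff a)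
    then have "\<kappa> t' = a" if "ereal t' \<le> \<alpha>" for t'
      unfolding \<kappa>_def using that a acl cl
      by (intro closest_point_unique[symmetric]) (auto simp: dist_real_def subset_iff)
    then have "q t = g a" "q s = g a" using t s by (auto simp: q_def)
    moreover have "g a \<in> A"
    proof (rule endpoint[OF AB(1,3) acl])
      fix d \<eta> :: real assume "0 < d" "0 < \<eta>"
      then obtain T where T: "T \<in> I" "\<And>t. t \<in> I \<Longrightarrow> t < T \<Longrightarrow> infdist (q0 t) A < \<eta>"
        using left unfolding I_def by metis
      then show "\<exists>x\<in>I. \<bar>x - a\<bar> < d \<and> infdist (q0 x) A < \<eta>" using dense[OF \<open>0 < d\<close> T(1)] by blast
    qed
    ultimately show "q t = q s" "q t \<in> A" by simp_all
  qed
  have qB: "q t = q s" "q t \<in> B" if t: "\<omega> \<le> ereal t" and s: "\<omega> \<le> ereal s" for s t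
  proof -
    obtain b where b: "\<omega> = ereal b" using t lt by (cases \<omega>) auto
    have dense: "\<exists>x\<in>I. \<bar>x - b\<bar> < d \<and> T < x" if "0 < d" "T \<in> I" for d T
    proof -
      have "max (ereal T) (ereal (b - d)) < \<omega>" using that b by (auto simp: I_def einterval_iff)
      then obtain x where "x \<in> einterval (max (ereal T) (ereal (b - d))) \<omega>" using einterval_nonempty by blast
      then have x: "x < b" "T < x" "b - d < x" using b by (auto simp: einterval_iff)
      have "\<alpha> < ereal x" using x(2) that(2) unfolding I_def einterval_iff
        by (meson ereal_less_eq(3) less_le_trans less_imp_le)
      then have "x \<in> I" using x(1) b by (simp add: I_def einterval_iff)
      then show ?thesis using x by (intro bexI[of _ x]) auto
    qed
    have bcl: "b \<in> closure I" unfolding closure_approachable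
      using dense[OF _ t0] by (auto simp: dist_real_def)
    have "closure I \<subseteq> {..b}" by (rule closure_minimal) (auto simp: I_def einterval_iff b)
    then have "\<kappa> t' = b" if "\<omega> \<le> ereal t'" for t'
      unfolding \<kappa>_def using that b bcl cl
      by (intro closest_point_unique[symmetric]) (auto simp: dist_real_def subset_iff)
    then have "q t = g b" "q s = g b" using t s by (auto simp: q_def)
    moreover have "g b \<in> B"
    proof (rule endpoint[OF AB(2,4) bcl])
      fix d \<eta> :: real assume "0 < d" "0 < \<eta>"
      then obtain T where T: "T \<in> I" "\<And>t. t \<in> I \<Longrightarrow> T < t \<Longrightarrow> infdist (q0 t) B < \<eta>"
        using right unfolding I_def by metis
      then show "\<exists>x\<in>I. \<bar>x - b\<bar> < d \<and> infdist (q0 x) B < \<eta>" using dense[OF \<open>0 < d\<close> T(1)] by blast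
    qed
    ultimately show "q t = q s" "q t \<in> B" by simp_all
  qed
  define R where "R t = (if t \<in> I then Q t else 0)" for t
  have speedR: "norm (R t) = h (q t)" for t
  proof (cases "t \<in> I")
    case True
    then show ?thesis using speed qI by (simp add: R_def I_def)
  next
    case False
    then have "ereal t \<le> \<alpha> \<or> \<omega> \<le> ereal t" by (auto simp: I_def einterval_iff not_less)
    then have "q t \<in> A \<union> B" using qA(2) qB(2) by blast
    then show ?thesis using False AB(5) by (simp add: R_def)
  qed
  have conthq: "continuous_on UNIV (\<lambda>t. h (q t))" by (rule continuous_on_compose2[OF conth contq]) auto
  have contR: "continuous_on UNIV R"
  proof (rule continuous_at_imp_continuous_on, rule ballI)
    fix t
    show "isCont R t"
    proof (cases "t \<in> I")
      case True
      have "continuous_on I R" using contQ by (simp add: R_def I_def cong: continuous_on_cong)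
      then show ?thesis using True I(1) by (simp add: continuous_on_eq_continuous_at)
    next
      case False
      \<comment> \<open>The norm of \<open>R\<close> is the continuous function
        \<open>h (q t)\<close>; at a zero of \<open>R\<close> this already gives continuity of
        \<open>R\<close>, with no limit of \<open>Q\<close> to be computed.\<close>
      have "isCont (\<lambda>t. h (q t)) t" using conthq by (simp add: continuous_on_eq_continuous_at)
      then have L: "((\<lambda>s. norm (R s)) \<longlongrightarrow> norm (R t)) (at t)" by (simp add: speedR isCont_def)
      have R0: "R t = 0" using False by (simp add: R_def)
      show ?thesis unfolding isCont_def R0
        by (rule tendsto_norm_zero_cancel) (rule L[unfolded R0 norm_zero])
    qed
  qed
  \<comment> \<open>For an infinite end \<open>real_of_ereal\<close> returns 0, so 0 is then
    excluded as well. A finite exceptional set is harmless for the fundamental theorem that recovers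
    the derivative everywhere.\<close>
  have dq: "(q has_vector_derivative R t) (at t)" if t: "t \<notin> {real_of_ereal \<alpha>, real_of_ereal \<omega>}" for t
  proof -
    consider "t \<in> I" | "ereal t < \<alpha>" | "\<omega> < ereal t"
    proof -
      have "ereal t \<noteq> \<alpha>" "ereal t \<noteq> \<omega>" using t by auto
      then have "(\<alpha> < ereal t \<or> ereal t < \<alpha>) \<and> (ereal t < \<omega> \<or> \<omega> < ereal t)" by (auto simp: neq_iff)
      then have "t \<in> I \<or> ereal t < \<alpha> \<or> \<omega> < ereal t" unfolding I_def einterval_iff by blast
      then show ?thesis using that by blast
    qed
    then show ?thesis
    proof cases
      case 1
      then have "(q0 has_vector_derivative R t) (at t)" using d by (simp add: R_def I_def)
      then show ?thesis by (rule has_vector_derivative_transform_within_open[OF _ I(1) 1]) (simp add: qI)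
    next
      case 2
      then obtain a where a: "\<alpha> = ereal a" using lt by (cases \<alpha>) auto
      have "R t = 0" using 2 by (auto simp: R_def I_def einterval_iff)
      have "((\<lambda>_. q t) has_vector_derivative 0) (at t)" by simp
      then have "(q has_vector_derivative 0) (at t)"
        by (rule has_vector_derivative_transform_within_open[of _ _ _ "{..<a}"])
          (use 2 a in \<open>auto intro!: qA(1) less_imp_le\<close>)
      then show ?thesis using \<open>R t = 0\<close> by simp
    next
      case 3
      then obtain b where b: "\<omega> = ereal b" using lt by (cases \<omega>) auto
      have "R t = 0" using 3 by (auto simp: R_def I_def einterval_iff)
      have "((\<lambda>_. q t) has_vector_derivative 0) (at t)" by simp
      then have "(q has_vector_derivative 0) (at t)"
        by (rule has_vector_derivative_transform_within_open[of _ _ _ "{b<..}"])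
          (use 3 b in \<open>auto intro!: qB(1) less_imp_le\<close>)
      then show ?thesis using \<open>R t = 0\<close> by simp
    qed
  qed
  have "(q has_vector_derivative R t) (at t)" for t
  proof -
    have int: "(R has_integral (q x - q (t - 1))) {t - 1..x}" if "t - 1 \<le> x" for x
    proof (rule fundamental_theorem_of_calculus_interior_strong)
      show "finite {real_of_ereal \<alpha>, real_of_ereal \<omega>}" by simp
      show "continuous_on {t - 1..x} q" using contq by (rule continuous_on_subset) simp
    qed (use dq that in auto)
    have "((\<lambda>x. q (t - 1) + integral {t - 1..x} R) has_vector_derivative R t) (at t within {t - 1..t + 1})"
      using integral_has_vector_derivative[OF continuous_on_subset[OF contR], of "t - 1" "t + 1" t]
      by (auto intro!: derivative_eq_intros)
    then have "(q has_vector_derivative R t) (at t within {t - 1..t + 1})"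
    proof (rule has_vector_derivative_transform[rotated 2])
      fix x assume "x \<in> {t - 1..t + 1}"
      then show "q x = q (t - 1) + integral {t - 1..x} R" using integral_unique[OF int[of x]] by simp
    qed simp
    moreover have "at t within {t - 1..t + 1} = at t" by (rule at_within_interior) simp
    ultimately show ?thesis by simp
  qed
  moreover have "\<forall>t. \<exists>s\<in>closure I. q t = q s"
  proof
    fix t
    have "\<kappa> t \<in> closure I" unfolding \<kappa>_def by (rule closest_point_in_set[OF cl(1,3)])
    then show "\<exists>s\<in>closure I. q t = q s" by (intro bexI[of _ "\<kappa> t"]) (auto simp: q_def \<kappa>_def closest_point_self)
  qed
  ultimately show ?thesis using qI qA(2) qB(2) contR
    unfolding R_def I_def by (intro exI[of _ q] conjI) blast+
qed

section \<open>Double-well potentials\<close>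

lemma Liminf_eq_0_less:
  fixes f :: "'b \<Rightarrow> real"
  assumes "Liminf G (\<lambda>t. ereal (f t)) = 0" "0 < \<delta>"
  shows "\<not> eventually (\<lambda>t. \<delta> \<le> f t) G"
proof
  assume "eventually (\<lambda>t. \<delta> \<le> f t) G"
  then have "eventually (\<lambda>t. ereal \<delta> \<le> ereal (f t)) G" by simp
  then have "ereal \<delta> \<le> Liminf G (\<lambda>t. ereal (f t))" by (rule Liminf_bounded)
  then show False using assms by (simp add: zero_ereal_def)
qed

locale double_well = young_function \<phi> l for \<phi> l +
  fixes V :: "'a::euclidean_space \<Rightarrow> real" and am ap :: 'a and rbar cstar c :: real
  assumes V_C1: "C1_scalar_field V"
    and ne: "am \<noteq> ap" and V_am: "V am = 0" and V_ap: "V ap = 0"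
    and rbar: "dist am ap = 2 * rbar"
    and V_out: "x \<notin> ball am rbar \<Longrightarrow> x \<notin> ball ap rbar \<Longrightarrow> cstar \<le> V x"
    and c: "0 \<le> c" "c < cstar"
begin

definition Am where "Am = {x. V x \<le> c} \<inter> ball am rbar"
definition Ap where "Ap = {x. V x \<le> c} \<inter> ball ap rbar"
definition U where "U = {x. c < V x}"

text \<open>Truncating the potential from below at \<open>c\<close> removes the constraint \<open>V \<ge> c\<close>: inside the sublevel
  set the metric degenerates, and only the last exit from it matters.\<close>

definition W where "W x = max 0 (V x - c)"
definition F where "F x = Kw (W x)"
definition DF where "DF x = gradient V x /\<^sub>R sp (V x - c)"

lemma V_GDERIV: "GDERIV V x :> gradient V x"
  and cont_grad: "continuous_on UNIV (gradient V)"
  using V_C1 by (auto simp: C1_scalar_field_def)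

lemma cont_V: "continuous_on T V"
  using V_GDERIV unfolding gderiv_def
  by (blast intro: continuous_at_imp_continuous_on has_derivative_continuous)

lemma rbar_pos: "0 < rbar"
  using rbar ne zero_less_dist_iff[of am ap] by linarith

lemma W_nonneg: "0 \<le> W x" by (simp add: W_def)

lemma cont_W: "continuous_on T W"
  unfolding W_def[abs_def] by (intro continuous_intros cont_V)

lemma F_pos_iff: "0 < F x \<longleftrightarrow> c < V x"
proof (cases "c < V x")
  case True
  then show ?thesis by (simp add: F_def W_def Kw_pos)
qed (simp add: F_def W_def max_absorb1)

sublocale conformal_metric F
proof
  show "continuous_on UNIV F"
    unfolding F_def[abs_def] by (rule continuous_on_compose2[OF cont_Kw cont_W]) (auto simp: W_nonneg)
  show "0 \<le> F x" for x by (simp add: F_def Kw_nonneg W_nonneg)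
qed

lemma open_U: "open U"
  unfolding U_def by (intro open_Collect_less cont_V continuous_intros)

lemma F_grad: assumes "x \<in> U" shows "GDERIV F x :> DF x"
proof -
  have pos: "0 < V x - c" using assms by (simp add: U_def)
  have "GDERIV (\<lambda>x. V x - c) x :> gradient V x"
    using V_GDERIV[of x] unfolding gderiv_def by (auto intro!: derivative_eq_intros)
  from GDERIV_DERIV_compose[OF this Kw_DERIV[OF pos]]
  have "((\<lambda>x. Kw (V x - c)) has_derivative (\<lambda>h. h \<bullet> DF x)) (at x)"
    by (simp add: gderiv_def DF_def divide_inverse)
  then have "(F has_derivative (\<lambda>h. h \<bullet> DF x)) (at x)"
    by (rule has_derivative_transform_within_open[OF _ open_U assms]) (simp add: F_def W_def U_def max_absorb2)
  then show ?thesis by (simp add: gderiv_def)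
qed

lemma cont_DF: "continuous_on U DF"
proof -
  have "continuous_on U (\<lambda>x. sp (V x - c))"
    by (rule continuous_on_compose2[OF cont_sp]) (auto simp: U_def intro!: continuous_intros cont_V)
  then show ?thesis unfolding DF_def[abs_def]
  proof (intro continuous_intros continuous_on_subset[OF cont_grad] ballI)
    fix x assume "x \<in> U"
    then have "0 < sp (V x - c)" by (intro sp_pos) (simp add: U_def)
    then show "sp (V x - c) \<noteq> 0" by simp
  qed auto
qed

section \<open>Geometry of the two wells\<close>

lemma level: "V x \<le> c \<Longrightarrow> x \<in> Am \<union> Ap"
  using V_out[of x] c by (auto simp: Am_def Ap_def)

text \<open>The sublevel set stays off the sphere around \<open>b\<close>: the centres are
  \<open>2 * rbar\<close> apart, so a point of that sphere is outside the other open ball, and there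
  \<open>V \<ge> cstar > c\<close>. Hence the open ball may be replaced by the closed one.\<close>

lemma compact_well:
  assumes b: "b \<in> {am, ap}" shows "compact ({x. V x \<le> c} \<inter> ball b rbar)"
proof -
  obtain b' where b': "{am, ap} = {b, b'}" "dist b b' = 2 * rbar"
    using b rbar by (metis dist_commute doubleton_eq_iff empty_iff insert_iff)
  have eq: "{x. V x \<le> c} \<inter> ball b rbar = cball b rbar \<inter> {x. V x \<le> c}"
  proof -
    have "x \<in> ball b rbar" if "V x \<le> c" "x \<in> cball b rbar" for x
    proof (rule ccontr)
      assume "x \<notin> ball b rbar"
      moreover have "x \<notin> ball b' rbar"
        using that(2) b'(2) dist_triangle[of b b' x] by (auto simp: dist_commute)
      ultimately have "cstar \<le> V x" using V_out b'(1) by (metis insert_commute doubleton_eq_iff)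
      then show False using that(1) c by simp
    qed
    then show ?thesis by auto
  qed
  show ?thesis unfolding eq by (intro compact_Int_closed closed_Collect_le cont_V continuous_intros) auto
qed

lemma Am: "compact Am" "am \<in> Am" "Am \<noteq> {}"
  and Ap: "compact Ap" "ap \<in> Ap" "Ap \<noteq> {}"
proof -
  show "compact Am" "compact Ap" using compact_well unfolding Am_def Ap_def by simp_all
  show "am \<in> Am" "ap \<in> Ap" using c V_am V_ap rbar_pos by (simp_all add: Am_def Ap_def)
  then show "Am \<noteq> {}" "Ap \<noteq> {}" by auto
qed

lemma Ap_far: "y \<in> Ap \<Longrightarrow> rbar < dist am y"
  using rbar dist_triangle[of am ap y] by (auto simp: Ap_def dist_commute)

text \<open>The gap between \<open>c\<close> and \<open>cstar\<close> provides the constant: outside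
  both balls \<open>V - c\<close> is at least \<open>cstar - c\<close>, and \<open>Kw\<close> is
  monotone.\<close>

lemma F_far: "\<exists>f>0. \<exists>R. \<forall>w. R \<le> norm w \<longrightarrow> f \<le> F w"
proof -
  have pos: "0 < Kw (cstar - c)" using c by (simp add: Kw_pos)
  have far: "Kw (cstar - c) \<le> F w" if w: "norm am + norm ap + rbar \<le> norm w" for w :: 'a
  proof -
  have "norm w \<le> norm am + dist am w" "norm w \<le> norm ap + dist ap w"
    by (metis dist_commute dist_norm norm_triangle_sub)+
  moreover have "0 \<le> norm am" "0 \<le> norm ap" by simp_all
  ultimately have "rbar \<le> dist am w" "rbar \<le> dist ap w" using w by linarith+
  then have "cstar \<le> V w" by (intro V_out) auto
  then show ?thesis using c unfolding F_def W_def by (intro Kw_mono) auto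
  qed
  then show ?thesis using pos by blast
qed

text \<open>\<open>Am\<close> is compact in an open ball, so between its farthest point and the
  sphere of radius \<open>rbar\<close> there is a closed shell free of both wells. \<open>F\<close>
  has a positive minimum there, and every path between the wells crosses it.\<close>

lemma gap: "\<exists>\<eta>>0. \<forall>x\<in>Am. \<forall>y\<in>Ap. \<eta> \<le> jdist F x y"
proof -
  obtain xm where xm: "xm \<in> Am" "\<And>x. x \<in> Am \<Longrightarrow> dist am x \<le> dist am xm"
    using continuous_attains_sup[OF Am(1,3) continuous_on_dist[OF continuous_on_const continuous_on_id], of am] by auto
  define r1 where "r1 = (dist am xm + rbar) / 2"
  have r1: "dist am xm < r1" "r1 < rbar" using xm(1) by (auto simp: r1_def Am_def)
  define T where "T = {w. r1 \<le> dist am w} \<inter> cball am rbar"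
  have T: "compact T"
    unfolding T_def by (intro closed_Int_compact closed_Collect_le continuous_intros) auto
  have pos: "0 < F w" if w: "w \<in> T" for w
  proof (rule ccontr)
    assume "\<not> 0 < F w"
    then have "w \<in> Am \<union> Ap" using F_pos_iff level by auto
    then show False using w xm(2)[of w] r1 Ap_far[of w] by (auto simp: T_def)
  qed
  obtain f where f: "0 < f" "\<And>w. w \<in> T \<Longrightarrow> f \<le> F w"
  proof (cases "T = {}")
    case True
    then show ?thesis using that[of 1] by simp
  next
    case False
    then obtain w0 where "w0 \<in> T" "\<And>w. w \<in> T \<Longrightarrow> F w0 \<le> F w"
      using continuous_attains_inf[OF T False continuous_on_subset[OF cont_F]] by blast
    then show ?thesis using that[of "F w0"] pos by blast
  qed
  have "f * (rbar - r1) \<le> jdist F x y" if "x \<in> Am" "y \<in> Ap" for x y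
  proof -
    have "f * \<bar>max r1 (min rbar (dist am x)) - max r1 (min rbar (dist am y))\<bar> \<le> jdist F x y"
      by (rule jdist_shell) (use f r1 in \<open>auto simp: T_def\<close>)
    moreover have "max r1 (min rbar (dist am x)) = r1" using xm(2)[OF that(1)] r1 by auto
    moreover have "max r1 (min rbar (dist am y)) = rbar" using Ap_far[OF that(2)] r1 by auto
    ultimately show ?thesis using r1 by simp
  qed
  then show ?thesis using f r1 by (intro exI[of _ "f * (rbar - r1)"]) auto
qed

text \<open>Between suitable times \<open>t1\<close> and \<open>t2\<close> Young's inequality bounds
  the action below by the length, and the length is at least the distance of \<open>q t1\<close> and
  \<open>q t2\<close>, which lie within \<open>e / 2\<close> of the two wells.\<close>

lemma J_lower_bound:
  assumes q: "q \<in> Gamma_class \<phi> V c Am Ap" and D: "\<And>x y. x \<in> Am \<Longrightarrow> y \<in> Ap \<Longrightarrow> D \<le> jdist F x y"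
  shows "ennreal D \<le> J_fun \<phi> V c UNIV q"
proof (rule ennreal_le_epsilon)
  fix e :: real assume e: "0 < e"
  have qW: "q \<in> W1_Phi_loc \<phi>" and Vq: "\<And>t. c \<le> V (q t)"
    and lim: "Liminf at_bot (\<lambda>t. ereal (infdist (q t) Am)) = 0" "Liminf at_top (\<lambda>t. ereal (infdist (q t) Ap)) = 0"
    using q by (auto simp: Gamma_class_def)
  have contq: "continuous_on UNIV q" using qW by (simp add: W1_Phi_loc_def)
  define g where "g = weak_deriv UNIV q"
  have w: "is_weak_deriv UNIV q g" unfolding g_def by (rule W1_Phi_loc_weak_deriv[OF qW])
  obtain \<delta>1 where \<delta>1: "0 < \<delta>1" "\<And>z. infdist z Am < \<delta>1 \<Longrightarrow> \<exists>x\<in>Am. jdist F x z < e / 2"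
    using jdist_compact_near[OF Am(1,3), of "e / 2"] e by auto
  obtain \<delta>2 where \<delta>2: "0 < \<delta>2" "\<And>z. infdist z Ap < \<delta>2 \<Longrightarrow> \<exists>x\<in>Ap. jdist F x z < e / 2"
    using jdist_compact_near[OF Ap(1,3), of "e / 2"] e by auto
  \<comment> \<open>Taking \<open>t1 \<le> 0 \<le> t2\<close> puts the two times in order; the lower
    limits provide such times arbitrarily far out.\<close>
  obtain t1 where t1: "t1 \<le> 0" "infdist (q t1) Am < \<delta>1"
    using Liminf_eq_0_less[OF lim(1) \<delta>1(1)] unfolding eventually_at_bot_linorder by (meson not_le)
  obtain t2 where t2: "0 \<le> t2" "infdist (q t2) Ap < \<delta>2"
    using Liminf_eq_0_less[OF lim(2) \<delta>2(1)] unfolding eventually_at_top_linorder by (meson not_le)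
  obtain x y where xy: "x \<in> Am" "jdist F x (q t1) < e / 2" "y \<in> Ap" "jdist F y (q t2) < e / 2"
    using \<delta>1(2)[OF t1(2)] \<delta>2(2)[OF t2(2)] by blast
  have t12: "t1 \<le> t2" using t1 t2 by simp
  have gint: "g absolutely_integrable_on {t1..t2}"
    using w by (intro L1_loc_integrable[of _ UNIV]) (auto simp: is_weak_deriv_def)
  have contFq: "continuous_on {t1..t2} (\<lambda>t. F (q t))"
    by (rule continuous_on_compose2[OF cont_F continuous_on_subset[OF contq]]) auto
  have "(\<lambda>t. F (q t) * norm (g t)) absolutely_integrable_on {t1..t2}"
    using absolutely_integrable_continuous_scaleR[OF contFq absolutely_integrable_norm[OF gint, unfolded comp_def]] by simp
  then have int: "(\<lambda>t. F (q t) * norm (g t)) integrable_on {t1..t2}" by (rule set_lebesgue_integral_eq_integral(1))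
  have "jdist F (q t1) (q t2) \<le> integral {t1..t2} (\<lambda>t. F (q t) * norm (g t))"
    by (rule jdist_curve[OF t12 continuous_on_subset[OF contq] gint])
      (auto intro: weak_deriv_increment[OF w contq])
  moreover have "D \<le> jdist F x (q t1) + jdist F (q t1) (q t2) + jdist F y (q t2)"
    using D[OF xy(1,3)] jdist_triangle[of x y "q t1"] jdist_triangle[of "q t1" y "q t2"] jdist_sym[of y "q t2"] by linarith
  ultimately have "D \<le> integral {t1..t2} (\<lambda>t. F (q t) * norm (g t)) + e" using xy by linarith
  then have "ennreal D \<le> ennreal (integral {t1..t2} (\<lambda>t. F (q t) * norm (g t))) + ennreal e"
    using e integral_nonneg[OF int] F_nonneg by (simp add: ennreal_leI flip: ennreal_plus)
  also have "ennreal (integral {t1..t2} (\<lambda>t. F (q t) * norm (g t))) =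
      (\<integral>\<^sup>+t\<in>{t1..t2}. ennreal (F (q t) * norm (g t)) \<partial>lebesgue)"
    unfolding nn_integral_completion
    by (rule nn_integral_has_integral_lebesgue'[symmetric]) (use F_nonneg int in \<open>auto intro: integrable_integral\<close>)
  also have "\<dots> \<le> (\<integral>\<^sup>+t\<in>UNIV. ennreal (Phi \<phi> (norm (g t)) + V (q t) - c) \<partial>lebesgue)"
  proof (rule nn_integral_mono)
    fix t
    have "F (q t) * norm (g t) \<le> Phi \<phi> (norm (g t)) + V (q t) - c"
      using young[of "norm (g t)" "W (q t)"] Vq[of t] by (simp add: F_def W_def)
    then show "ennreal (F (q t) * norm (g t)) * indicator {t1..t2} t \<le>
        ennreal (Phi \<phi> (norm (g t)) + V (q t) - c) * indicator UNIV t"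
      by (cases "t \<in> {t1..t2}") (auto intro: ennreal_leI)
  qed
  finally show "ennreal D \<le> J_fun \<phi> V c UNIV q + ennreal e" unfolding J_fun_def g_def by simp
qed

end

text \<open>The data delivered by the construction: \<open>R\<close> is the velocity of the curve,
  already continued by rest to the whole line, and \<open>\<pi>\<close> is its momentum. The
  continuation makes \<open>q\<close> itself the competitor that bounds \<open>m_val\<close> from
  above.\<close>

locale connection = double_well \<phi> l V am ap rbar cstar c
  for \<phi> l and V :: "'a::euclidean_space \<Rightarrow> real" and am ap rbar cstar c +
  fixes \<alpha> \<omega> :: ereal and D :: real and \<sigma> :: "real \<Rightarrow> real" and q R \<pi> :: "real \<Rightarrow> 'a"
  assumes lt: "\<alpha> < \<omega>"
    and D: "0 \<le> D" "x \<in> Am \<Longrightarrow> y \<in> Ap \<Longrightarrow> D \<le> jdist F x y"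
    and d\<sigma>: "t \<in> einterval \<alpha> \<omega> \<Longrightarrow> (\<sigma> has_real_derivative Kw (W (q t)) * sp (W (q t))) (at t)"
    and \<sigma>_lim: "((\<sigma> \<circ> real_of_ereal) \<longlongrightarrow> 0) (at_right \<alpha>)" "((\<sigma> \<circ> real_of_ereal) \<longlongrightarrow> D) (at_left \<omega>)"
    and dq: "(q has_vector_derivative R t) (at t)" and cont_R: "continuous_on UNIV R"
    and qU: "t \<in> einterval \<alpha> \<omega> \<Longrightarrow> q t \<in> U"
    and rest: "t \<notin> einterval \<alpha> \<omega> \<Longrightarrow> R t = 0 \<and> V (q t) = c"
    and d\<pi>: "t \<in> einterval \<alpha> \<omega> \<Longrightarrow> (\<pi> has_vector_derivative gradient V (q t)) (at t)"
    and R_eq: "t \<in> einterval \<alpha> \<omega> \<Longrightarrow> R t = (sp (W (q t)) / F (q t)) *\<^sub>R \<pi> t"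
    and norm_\<pi>: "t \<in> einterval \<alpha> \<omega> \<Longrightarrow> norm (\<pi> t) = F (q t)"
    and bdd: "bounded (q ` einterval \<alpha> \<omega>)"
    and left: "0 < \<eta> \<Longrightarrow> \<exists>T\<in>einterval \<alpha> \<omega>. \<forall>t<T. infdist (q t) Am < \<eta>"
    and right: "0 < \<eta> \<Longrightarrow> \<exists>T\<in>einterval \<alpha> \<omega>. \<forall>t>T. infdist (q t) Ap < \<eta>"
begin

section \<open>Verification of the clauses of a minimal connection\<close>

abbreviation I where "I \<equiv> einterval \<alpha> \<omega>"

lemma cont_q: "continuous_on T q"
  by (intro continuous_at_imp_continuous_on ballI has_vector_derivative_continuous[OF dq])

lemma vd_q: "vector_derivative q (at t) = R t"
  by (rule vector_derivative_at[OF dq])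

lemma W_q: assumes "t \<in> I" shows "W (q t) = V (q t) - c" "0 < W (q t)" "0 < sp (W (q t))" "0 < F (q t)"
proof -
  show W: "W (q t) = V (q t) - c" "0 < W (q t)" using qU[OF assms] by (auto simp: U_def W_def)
  show "0 < sp (W (q t))" by (rule sp_pos[OF W(2)])
  show "0 < F (q t)" using W(2) by (simp add: F_def Kw_pos)
qed

lemma speed: "norm (R t) = sp (W (q t))"
proof (cases "t \<in> I")
  case True
  then show ?thesis using W_q[OF True] by (simp add: R_eq norm_\<pi>)
next
  case False
  then show ?thesis using rest by (simp add: W_def)
qed

text \<open>Both sides point in the same direction, and their lengths agree because
  \<open>p (sp w) = Kw w\<close>.\<close>

lemma momentum: assumes "t \<in> I" shows "\<phi> (norm (R t)) *\<^sub>R R t = \<pi> t"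
proof -
  have "\<phi> (sp (W (q t))) * sp (W (q t)) = F (q t)" by (simp add: F_def Kw_def p_def)
  then show ?thesis using W_q[OF assms] by (simp add: speed) (simp add: R_eq[OF assms])
qed

lemma solves: "solves_EL \<phi> V I q"
  unfolding solves_EL_def vd_q
proof
  fix t assume t: "t \<in> I"
  show "((\<lambda>s. \<phi> (norm (R s)) *\<^sub>R R s) has_vector_derivative gradient V (q t)) (at t)"
    by (rule has_vector_derivative_transform_within_open[OF d\<pi>[OF t] open_einterval t]) (simp add: momentum)
qed

lemma energy_eq: assumes "t \<in> I" shows "energy \<phi> V q t = - c"
proof -
  have "G_fun \<phi> (norm (R t)) = W (q t)" using W_nonneg sp by (simp add: speed G_fun_eq)
  then show ?thesis using W_q[OF assms] by (simp add: energy_def vd_q)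
qed

text \<open>Every point of the closure is a limit point of it, so the derivative within the closure
  is unique, also at an endpoint, and equals \<open>R\<close>.\<close>

lemma C1_curve: "C1_curve_on (closure I) q"
  unfolding C1_curve_on_def
proof (intro conjI ballI)
  fix t
  show "q differentiable (at t within closure I)"
    using differentiableI_vector[OF dq] by (rule differentiable_at_withinI)
next
  have "vector_derivative q (at t within closure I) = R t" if t: "t \<in> closure I" for t
  proof (rule vector_derivative_within)
    have "t islimpt I" using t interior_limit_point[of t I] by (auto simp: closure_def interior_open)
    then have "t islimpt closure I" using closure_subset islimpt_subset by blast
    then show "at t within closure I \<noteq> bot" by (simp add: trivial_limit_within)
    show "(q has_vector_derivative R t) (at t within closure I)" using dq by (rule has_vector_derivative_at_within)
  qed
  then show "continuous_on (closure I) (\<lambda>t. vector_derivative q (at t within closure I))"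
    using continuous_on_subset[OF cont_R, of "closure I"] by (simp cong: continuous_on_cong)
qed

text \<open>The Euler-Lagrange equation only differentiates the momentum. Solving for the velocity
  gives \<open>R t = r (u t) *\<^sub>R \<pi> t\<close> with \<open>u t = V (q t) - c\<close>, which
  is positive on \<open>I\<close>, and \<open>r\<close> is continuously differentiable away from
  0.\<close>

lemma C2_curve: "C2_curve_on I q"
  unfolding C2_curve_on_def vd_q C1_differentiable_on_def
proof (rule conjI)
  have "continuous_on I R" using cont_R by (rule continuous_on_subset) simp
  then show "\<exists>D. (\<forall>x\<in>I. (q has_vector_derivative D x) (at x)) \<and> continuous_on I D" using dq by blast
next
  define r where "r w = sp w / Kw w" for w
  define r' where "r' w = (inverse (sp w * p' (sp w)) * Kw w - sp w * (1 / sp w)) / (Kw w * Kw w)" for w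
  define u where "u t = V (q t) - c" for t
  define u' where "u' t = R t \<bullet> gradient V (q t)" for t
  have u: "0 < u t" "W (q t) = u t" if "t \<in> I" for t using W_q[OF that] by (auto simp: u_def)
  have dr: "(r has_real_derivative r' w) (at w)" if "0 < w" for w
    unfolding r_def r'_def using Kw_pos[OF that] by (intro DERIV_divide sp_DERIV Kw_DERIV that) simp
  have du: "(u has_real_derivative u' t) (at t)" for t
  proof -
    have "((\<lambda>t. V (q t)) has_derivative (\<lambda>s. (s *\<^sub>R R t) \<bullet> gradient V (q t))) (at t)"
      using has_derivative_compose[OF dq[unfolded has_vector_derivative_def] V_GDERIV[unfolded gderiv_def]] .
    then have "((\<lambda>t. V (q t)) has_real_derivative u' t) (at t)"
      by (simp add: has_field_derivative_def u'_def mult_commute_abs)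
    then show ?thesis unfolding u_def by (auto intro!: derivative_eq_intros)
  qed
  define R' where "R' t = r (u t) *\<^sub>R gradient V (q t) + (r' (u t) * u' t) *\<^sub>R \<pi> t" for t
  have "(R has_vector_derivative R' t) (at t)" if t: "t \<in> I" for t
  proof -
    have "((\<lambda>t. r (u t)) has_real_derivative r' (u t) * u' t) (at t)"
      by (rule DERIV_chain2[OF dr[OF u(1)[OF t]] du])
    from has_vector_derivative_scaleR[OF this d\<pi>[OF t]]
    have "((\<lambda>t. r (u t) *\<^sub>R \<pi> t) has_vector_derivative R' t) (at t)" by (simp add: R'_def)
    then show ?thesis
      by (rule has_vector_derivative_transform_within_open[OF _ open_einterval t])
        (simp add: R_eq u(2) r_def F_def)
  qed
  moreover have "continuous_on I R'"
  proof -
    have cu: "continuous_on I u" unfolding u_def by (intro continuous_intros continuous_on_compose2[OF cont_V[of UNIV] cont_q]) auto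
    have cg: "continuous_on I (\<lambda>t. gradient V (q t))" by (rule continuous_on_compose2[OF cont_grad cont_q]) auto
    have csp: "continuous_on {0<..} sp" by (rule continuous_on_subset[OF cont_sp]) auto
    have cK: "continuous_on {0<..} Kw" by (rule continuous_on_subset[OF cont_Kw]) auto
    have nz: "Kw w \<noteq> 0" "sp w \<noteq> 0" if "w \<in> {0<..}" for w using that Kw_pos[of w] sp_pos[of w] by auto
    have cr: "continuous_on {0<..} r" unfolding r_def using nz by (intro continuous_intros csp cK) auto
    have cr': "continuous_on {0<..} r'" unfolding r'_def using nz
      by (intro continuous_on_divide continuous_on_diff continuous_on_mult csp cK cont_sp_deriv continuous_on_const) auto
    have c\<pi>: "continuous_on I \<pi>"
      using d\<pi> by (intro continuous_at_imp_continuous_on ballI has_vector_derivative_continuous)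
    have ru: "continuous_on I (\<lambda>t. r (u t))" "continuous_on I (\<lambda>t. r' (u t))"
      using u(1) by (auto intro!: continuous_on_compose2[OF cr cu] continuous_on_compose2[OF cr' cu])
    show ?thesis unfolding R'_def u'_def
      by (intro continuous_intros ru cg c\<pi> continuous_on_subset[OF cont_R]) auto
  qed
  ultimately show "\<exists>D. (\<forall>x\<in>I. (R has_vector_derivative D x) (at x)) \<and> continuous_on I D" by blast
qed

lemma L_infinity: "q \<in> L_infinity I"
proof -
  have "q \<in> borel_measurable (lebesgue_on I)"
    by (rule continuous_imp_measurable_on_sets_lebesgue[OF cont_q]) simp
  moreover obtain C where "\<And>t. t \<in> I \<Longrightarrow> norm (q t) \<le> C" using bdd by (auto simp: bounded_iff)
  then have "AE t in lebesgue_on I. norm (q t) \<le> C" by (intro AE_I2) simp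
  ultimately show ?thesis unfolding L_infinity_def by blast
qed

lemma limit_left: "((\<lambda>t. infdist (q (real_of_ereal t)) Am) \<longlongrightarrow> 0) (at_right \<alpha>)"
proof (rule tendstoI)
  fix \<eta> :: real assume "0 < \<eta>"
  then obtain T where T: "T \<in> I" "\<And>t. t < T \<Longrightarrow> infdist (q t) Am < \<eta>" using left by blast
  have "dist (infdist (q (real_of_ereal z)) Am) 0 < \<eta>" if "\<alpha> < z" "z < ereal T" for z
    using that T(2)[of "real_of_ereal z"] by (cases z) (auto simp: dist_real_def abs_of_nonneg[OF infdist_nonneg])
  moreover have "\<alpha> < ereal T" using T(1) by (simp add: einterval_iff)
  ultimately show "\<forall>\<^sub>F t in at_right \<alpha>. dist (infdist (q (real_of_ereal t)) Am) 0 < \<eta>"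
    unfolding eventually_at_right[OF lt] by blast
qed

lemma limit_right: "((\<lambda>t. infdist (q (real_of_ereal t)) Ap) \<longlongrightarrow> 0) (at_left \<omega>)"
proof (rule tendstoI)
  fix \<eta> :: real assume "0 < \<eta>"
  then obtain T where T: "T \<in> I" "\<And>t. T < t \<Longrightarrow> infdist (q t) Ap < \<eta>" using right by blast
  have "dist (infdist (q (real_of_ereal z)) Ap) 0 < \<eta>" if "ereal T < z" "z < \<omega>" for z
    using that T(2)[of "real_of_ereal z"] by (cases z) (auto simp: dist_real_def abs_of_nonneg[OF infdist_nonneg])
  moreover have "ereal T < \<omega>" using T(1) by (simp add: einterval_iff)
  ultimately show "\<forall>\<^sub>F t in at_left \<omega>. dist (infdist (q (real_of_ereal t)) Ap) 0 < \<eta>"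
    unfolding eventually_at_left[OF lt] by blast
qed

lemma weak_deriv_AE: "AE t in lebesgue. t \<in> interior S \<longrightarrow> weak_deriv S q t = R t"
proof -
  have w: "is_weak_deriv S q R" by (rule C1_is_weak_deriv[OF dq cont_R])
  obtain N where N: "negligible N" "\<And>t. t \<in> interior S - N \<Longrightarrow> weak_deriv S q t = R t"
    using weak_deriv_unique[OF is_weak_deriv_weak_deriv[OF w] w cont_q] by blast
  have "AE t in lebesgue. t \<notin> N" using N(1) by (intro AE_not_in) (simp add: negligible_iff_null_sets)
  then show ?thesis by (rule AE_mp) (use N(2) in auto)
qed

text \<open>Equality in Young's inequality makes the integrand the derivative of
  \<open>\<sigma>\<close>, which runs from 0 to \<open>D\<close>; at rest the integrand vanishes.
  \<open>S\<close> is \<open>I\<close> for the connection and the line for the competitor. Being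
  open, it determines the weak derivative almost everywhere.\<close>

lemma action: assumes "interior S = S" "I \<subseteq> S" shows "J_fun \<phi> V c S q = ennreal D"
proof -
  define f where "f t = Kw (W (q t)) * sp (W (q t))" for t
  have f0: "0 \<le> f t" for t unfolding f_def by (intro mult_nonneg_nonneg Kw_nonneg sp W_nonneg)
  have "continuous_on UNIV (\<lambda>t. W (q t))" by (rule continuous_on_compose2[OF cont_W[of UNIV] cont_q]) auto
  then have "continuous_on UNIV f" unfolding f_def
    by (intro continuous_on_mult continuous_on_compose2[OF cont_Kw] continuous_on_compose2[OF cont_sp]) (auto simp: W_nonneg)
  then have cf: "isCont f t" for t by (simp add: continuous_on_eq_continuous_at)
  have FTC: "set_integrable lborel I f" "(LBINT x=\<alpha>..\<omega>. f x) = D - 0"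
    by (rule interval_integral_FTC_nonneg[of \<alpha> \<omega> \<sigma> f 0 D];
        use lt d\<sigma> cf f0 \<sigma>_lim in \<open>simp add: einterval_iff f_def\<close>)+
  have "J_fun \<phi> V c S q = (\<integral>\<^sup>+t. ennreal (indicator I t *\<^sub>R f t) \<partial>lebesgue)"
    unfolding J_fun_def
  proof (rule nn_integral_cong_AE, rule AE_mp[OF weak_deriv_AE[of S]], rule AE_I2, rule impI)
    fix t assume wd: "t \<in> interior S \<longrightarrow> weak_deriv S q t = R t"
    consider "t \<in> I" | "t \<in> S" "t \<notin> I" | "t \<notin> S" by blast
    then show "ennreal (Phi \<phi> (norm (weak_deriv S q t)) + V (q t) - c) * indicator S t = ennreal (indicator I t *\<^sub>R f t)"
    proof cases
      case 1
      then have "Phi \<phi> (norm (weak_deriv S q t)) + V (q t) - c = f t"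
        using wd assms young_eq[OF W_nonneg[of "q t"]] W_q[OF 1] by (auto simp: f_def speed)
      then show ?thesis using 1 assms(2) by auto
    next
      case 2
      then have "weak_deriv S q t = 0" "V (q t) = c" using wd assms(1) rest[OF 2(2)] by auto
      then show ?thesis using 2 by simp
    next
      case 3
      then have "t \<notin> I" using assms(2) by blast
      then show ?thesis using 3 by simp
    qed
  qed
  also have "\<dots> = (\<integral>\<^sup>+t. ennreal (indicator I t *\<^sub>R f t) \<partial>lborel)" by (rule nn_integral_completion)
  also have "\<dots> = ennreal (LINT t|lborel. indicator I t *\<^sub>R f t)"
    using FTC(1) f0 unfolding set_integrable_def by (intro nn_integral_eq_integral) auto
  also have "(LINT t|lborel. indicator I t *\<^sub>R f t) = D"
    using FTC(2) less_imp_le[OF lt] by (simp add: interval_lebesgue_integral_def set_lebesgue_integral_def)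
  finally show ?thesis .
qed

lemma q_in_Gamma: "q \<in> Gamma_class \<phi> V c Am Ap"
proof -
  have 1: "((\<lambda>t. infdist (q t) Am) \<longlongrightarrow> 0) at_bot"
  proof (rule tendstoI)
    fix \<eta> :: real assume "0 < \<eta>"
    then show "\<forall>\<^sub>F t in at_bot. dist (infdist (q t) Am) 0 < \<eta>"
      using left[of \<eta>] infdist_nonneg[of _ Am] unfolding eventually_at_bot_dense by auto
  qed
  have 2: "((\<lambda>t. infdist (q t) Ap) \<longlongrightarrow> 0) at_top"
  proof (rule tendstoI)
    fix \<eta> :: real assume "0 < \<eta>"
    then show "\<forall>\<^sub>F t in at_top. dist (infdist (q t) Ap) 0 < \<eta>"
      using right[of \<eta>] infdist_nonneg[of _ Ap] unfolding eventually_at_top_dense by auto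
  qed
  have "Liminf at_bot (\<lambda>t. ereal (infdist (q t) Am)) = 0" "Liminf at_top (\<lambda>t. ereal (infdist (q t) Ap)) = 0"
    using 1 2 by (auto intro!: lim_imp_Liminf simp: zero_ereal_def)
  moreover have "q \<in> W1_Phi_loc \<phi>" by (rule C1_in_W1_Phi_loc[OF cont_Phi dq cont_R])
  moreover have "c \<le> V (q t)" for t using qU[of t] rest[of t] by (cases "t \<in> I") (auto simp: U_def)
  ultimately show ?thesis by (simp add: Gamma_class_def)
qed

lemma m_val_eq: "m_val \<phi> V c Am Ap = ennreal D"
proof (rule antisym)
  show "m_val \<phi> V c Am Ap \<le> ennreal D"
    unfolding m_val_def using action[of UNIV] by (intro INF_lower2[OF q_in_Gamma]) simp
  show "ennreal D \<le> m_val \<phi> V c Am Ap"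
    unfolding m_val_def by (intro INF_greatest J_lower_bound D(2))
qed

lemma minimal: "minimal_connection \<phi> V c Am Ap \<alpha> \<omega> q"
  unfolding minimal_connection_def Let_def
proof (intro conjI ballI L_infinity C1_curve C2_curve solves limit_left limit_right energy_eq)
  show "c < V (q t)" if "t \<in> I" for t using qU[OF that] by (simp add: U_def)
  show "J_fun \<phi> V c I q = m_val \<phi> V c Am Ap" using action[of I] by (simp add: m_val_eq interior_open)
qed

end

section \<open>Existence of a connection\<close>

context double_well
begin

text \<open>The geodesic joins a closest pair of points of the two compact wells. This choice both
  makes \<open>D\<close> a lower bound for all competitors and keeps the geodesic out of the wells
  in between.\<close>

lemma connection_exists:
  "\<exists>(\<alpha>::ereal) \<omega> D \<sigma> q R \<pi>. connection \<phi> l V am ap rbar cstar c \<alpha> \<omega> D \<sigma> q R \<pi>"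
proof -
  have "\<exists>z0\<in>Am \<times> Ap. \<forall>z\<in>Am \<times> Ap. jdist F (fst z0) (snd z0) \<le> jdist F (fst z) (snd z)"
    by (rule continuous_attains_inf[OF compact_Times[OF Am(1) Ap(1)] _
          continuous_on_jdist[OF continuous_on_fst[OF continuous_on_id] continuous_on_snd[OF continuous_on_id]]])
      (use Am(3) Ap(3) in auto)
  then obtain z0 where z0: "z0 \<in> Am \<times> Ap" "\<And>z. z \<in> Am \<times> Ap \<Longrightarrow> jdist F (fst z0) (snd z0) \<le> jdist F (fst z) (snd z)"
    by blast
  define x0 y0 where "x0 = fst z0" and "y0 = snd z0"
  have xy0: "x0 \<in> Am" "y0 \<in> Ap" using z0(1) by (auto simp: x0_def y0_def)
  define D where "D = jdist F x0 y0"
  have Dmin: "D \<le> jdist F x y" if "x \<in> Am" "y \<in> Ap" for x y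
    using z0(2)[of "(x, y)"] that by (simp add: D_def x0_def y0_def)
  obtain \<eta>0 where \<eta>0: "0 < \<eta>0" "\<forall>x\<in>Am. \<forall>y\<in>Ap. \<eta>0 \<le> jdist F x y" using gap by blast
  then have D: "0 < D" using xy0 unfolding D_def by force
  obtain f R0 where far: "0 < f" "\<And>w. R0 \<le> norm w \<Longrightarrow> f \<le> F w" using F_far by blast
  obtain \<gamma> where \<gamma>: "\<And>s. s \<in> {0..D} \<Longrightarrow> jdist F x0 (\<gamma> s) = s" "\<And>s. s \<in> {0..D} \<Longrightarrow> jdist F (\<gamma> s) y0 = D - s"
    "\<And>s t. s \<in> {0..D} \<Longrightarrow> t \<in> {0..D} \<Longrightarrow> jdist F (\<gamma> s) (\<gamma> t) = \<bar>s - t\<bar>"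
    using geodesic_exists[OF far, where x = x0 and y = y0] unfolding D_def[symmetric] by blast
  \<comment> \<open>An intermediate point in a well would be closer to an endpoint in the opposite
    well than \<open>D\<close>.\<close>
  have \<gamma>U: "\<gamma> s \<in> U" if s: "s \<in> {0<..<D}" for s
  proof (rule ccontr)
    assume "\<gamma> s \<notin> U"
    then have "\<gamma> s \<in> Am \<union> Ap" using level by (auto simp: U_def)
    then show False
      using Dmin[OF _ xy0(2), of "\<gamma> s"] Dmin[OF xy0(1), of "\<gamma> s"] \<gamma>(1)[of s] \<gamma>(2)[of s] s by auto
  qed
  obtain \<pi>0 where \<pi>0: "\<And>s. s \<in> {0<..<D} \<Longrightarrow> (\<gamma> has_vector_derivative (\<pi>0 s /\<^sub>R (F (\<gamma> s))\<^sup>2)) (at s)"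
    "\<And>s. s \<in> {0<..<D} \<Longrightarrow> (\<pi>0 has_vector_derivative (DF (\<gamma> s) /\<^sub>R F (\<gamma> s))) (at s)"
    "\<And>s. s \<in> {0<..<D} \<Longrightarrow> norm (\<pi>0 s) = F (\<gamma> s)"
  proof -
    have "\<exists>\<pi>. \<forall>s\<in>{0<..<D}. (\<gamma> has_vector_derivative (\<pi> s /\<^sub>R (F (\<gamma> s))\<^sup>2)) (at s) \<and>
      (\<pi> has_vector_derivative (DF (\<gamma> s) /\<^sub>R F (\<gamma> s))) (at s) \<and> norm (\<pi> s) = F (\<gamma> s)"
    proof (rule geodesic_smooth[OF open_U F_grad cont_DF])
      show "x \<in> U \<Longrightarrow> 0 < F x" for x by (simp add: F_pos_iff U_def)
      show "s \<in> {0<..<D} \<Longrightarrow> t \<in> {0<..<D} \<Longrightarrow> jdist F (\<gamma> s) (\<gamma> t) = \<bar>s - t\<bar>" for s t by (rule \<gamma>(3)) auto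
      show "s \<in> {0<..<D} \<Longrightarrow> \<gamma> s \<in> U" for s by (rule \<gamma>U)
    qed
    then show ?thesis using that by blast
  qed
  \<comment> \<open>In the distance parameter the speed is \<open>1 / F\<close>; the factor
    \<open>F * sp W\<close> turns it into \<open>sp W\<close>.\<close>
  define e where "e s = Kw (W (\<gamma> s)) * sp (W (\<gamma> s))" for s
  have cont_\<gamma>: "continuous_on {0<..<D} \<gamma>"
    using \<pi>0(1) by (intro continuous_at_imp_continuous_on ballI has_vector_derivative_continuous)
  have "continuous_on {0<..<D} (\<lambda>s. W (\<gamma> s))" by (rule continuous_on_compose2[OF cont_W[of UNIV] cont_\<gamma>]) auto
  then have cont_e: "continuous_on {0<..<D} e" unfolding e_def
    by (intro continuous_on_mult continuous_on_compose2[OF cont_Kw] continuous_on_compose2[OF cont_sp]) (auto simp: W_nonneg)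
  have Wpos: "0 < W (\<gamma> s)" "W (\<gamma> s) = V (\<gamma> s) - c" if "s \<in> {0<..<D}" for s
    using \<gamma>U[OF that] by (auto simp: U_def W_def)
  have e_pos: "0 < e s" if "s \<in> {0<..<D}" for s
    unfolding e_def by (intro mult_pos_pos Kw_pos sp_pos Wpos that)
  obtain \<alpha> \<omega> :: ereal and \<sigma> where lt: "\<alpha> < \<omega>"
    and \<sigma>: "\<And>t. t \<in> einterval \<alpha> \<omega> \<Longrightarrow> \<sigma> t \<in> {0<..<D}"
    and d\<sigma>: "\<And>t. t \<in> einterval \<alpha> \<omega> \<Longrightarrow> (\<sigma> has_real_derivative e (\<sigma> t)) (at t)"
    and onto: "\<And>s. s \<in> {0<..<D} \<Longrightarrow> \<exists>t\<in>einterval \<alpha> \<omega>. \<sigma> t = s"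
    and mono: "\<And>t u. t \<in> einterval \<alpha> \<omega> \<Longrightarrow> u \<in> einterval \<alpha> \<omega> \<Longrightarrow> t < u \<Longrightarrow> \<sigma> t < \<sigma> u"
  proof -
    have "\<exists>(\<alpha>::ereal) \<omega> \<sigma>. \<alpha> < \<omega> \<and>
      (\<forall>t\<in>einterval \<alpha> \<omega>. \<sigma> t \<in> {0<..<D} \<and> (\<sigma> has_real_derivative e (\<sigma> t)) (at t)) \<and>
      (\<forall>s\<in>{0<..<D}. \<exists>t\<in>einterval \<alpha> \<omega>. \<sigma> t = s) \<and>
      (\<forall>t\<in>einterval \<alpha> \<omega>. \<forall>u\<in>einterval \<alpha> \<omega>. t < u \<longrightarrow> \<sigma> t < \<sigma> u)"
      by (rule time_change[OF D _ cont_e]) (rule e_pos)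
    then obtain \<alpha> \<omega> :: ereal and \<sigma> where tc: "\<alpha> < \<omega>"
      "\<forall>t\<in>einterval \<alpha> \<omega>. \<sigma> t \<in> {0<..<D} \<and> (\<sigma> has_real_derivative e (\<sigma> t)) (at t)"
      "\<forall>s\<in>{0<..<D}. \<exists>t\<in>einterval \<alpha> \<omega>. \<sigma> t = s"
      "\<forall>t\<in>einterval \<alpha> \<omega>. \<forall>u\<in>einterval \<alpha> \<omega>. t < u \<longrightarrow> \<sigma> t < \<sigma> u" by (elim exE conjE)
    show ?thesis by (rule that[OF tc(1)]) (use tc(2-4) in blast)+
  qed
  define I where "I = einterval \<alpha> \<omega>"
  have low: "\<exists>T\<in>I. \<forall>t\<in>I. t < T \<longrightarrow> \<sigma> t < \<delta>" if "0 < \<delta>" for \<delta>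
  proof -
    have "min (\<delta> / 2) (D / 2) \<in> {0<..<D}" using that D by auto
    then obtain T where T: "T \<in> I" "\<sigma> T = min (\<delta> / 2) (D / 2)" using onto unfolding I_def by blast
    moreover have "\<sigma> t < \<delta>" if "t \<in> I" "t < T" for t
      using mono[of t T] that T \<open>0 < \<delta>\<close> unfolding I_def by auto
    ultimately show ?thesis by blast
  qed
  have high: "\<exists>T\<in>I. \<forall>t\<in>I. T < t \<longrightarrow> D - \<sigma> t < \<delta>" if "0 < \<delta>" for \<delta>
  proof -
    have "max (D - \<delta> / 2) (D / 2) \<in> {0<..<D}" using that D by auto
    then obtain T where T: "T \<in> I" "\<sigma> T = max (D - \<delta> / 2) (D / 2)" using onto unfolding I_def by blast
    moreover have "D - \<sigma> t < \<delta>" if "t \<in> I" "T < t" for t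
      using mono[of T t] that T \<open>0 < \<delta>\<close> unfolding I_def by auto
    ultimately show ?thesis by blast
  qed
  define q0 where "q0 t = \<gamma> (\<sigma> t)" for t
  define \<pi> where "\<pi> t = \<pi>0 (\<sigma> t)" for t
  define Q where "Q t = (sp (W (q0 t)) / F (q0 t)) *\<^sub>R \<pi> t" for t
  have q0: "q0 t \<in> U" "0 < W (q0 t)" "W (q0 t) = V (q0 t) - c" "0 < F (q0 t)" "0 < sp (W (q0 t))" if "t \<in> I" for t
  proof -
    have s: "\<sigma> t \<in> {0<..<D}" using \<sigma> that unfolding I_def .
    show "q0 t \<in> U" "0 < W (q0 t)" "W (q0 t) = V (q0 t) - c" unfolding q0_def by (rule \<gamma>U Wpos s)+
    then show "0 < F (q0 t)" "0 < sp (W (q0 t))" by (auto simp: F_def intro: Kw_pos sp_pos)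
  qed
  have chain: "((\<lambda>t. h (\<sigma> t)) has_vector_derivative (e (\<sigma> t) *\<^sub>R h')) (at t)"
    if "t \<in> I" "(h has_vector_derivative h') (at (\<sigma> t))" for t h' and h :: "real \<Rightarrow> 'a"
    using vector_diff_chain_at[of \<sigma> "e (\<sigma> t)" t h h'] d\<sigma>[of t] that
    by (simp add: I_def comp_def has_real_derivative_iff_has_vector_derivative)
  have dq0: "(q0 has_vector_derivative Q t) (at t)" if t: "t \<in> I" for t
  proof -
    have "(q0 has_vector_derivative (e (\<sigma> t) *\<^sub>R (\<pi>0 (\<sigma> t) /\<^sub>R (F (\<gamma> (\<sigma> t)))\<^sup>2))) (at t)"
      unfolding q0_def[abs_def] using t \<sigma> \<pi>0(1) unfolding I_def by (intro chain) (auto simp: I_def)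
    moreover have "e (\<sigma> t) *\<^sub>R (\<pi>0 (\<sigma> t) /\<^sub>R (F (\<gamma> (\<sigma> t)))\<^sup>2) = Q t"
      using q0(4)[OF t] by (simp add: Q_def \<pi>_def e_def q0_def F_def[symmetric] power2_eq_square divide_inverse)
    ultimately show ?thesis by simp
  qed
  have d\<pi>: "(\<pi> has_vector_derivative gradient V (q0 t)) (at t)" if t: "t \<in> I" for t
  proof -
    have "(\<pi> has_vector_derivative (e (\<sigma> t) *\<^sub>R (DF (\<gamma> (\<sigma> t)) /\<^sub>R F (\<gamma> (\<sigma> t))))) (at t)"
      unfolding \<pi>_def[abs_def] using t \<sigma> \<pi>0(2) unfolding I_def by (intro chain) (auto simp: I_def)
    \<comment> \<open>Both factors of \<open>e\<close> cancel: \<open>F\<close> against the division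
      by \<open>F\<close>, and \<open>sp\<close> against the denominator of \<open>DF\<close>, which
      is the derivative of \<open>Kw\<close>.\<close>
    moreover have "e (\<sigma> t) *\<^sub>R (DF (\<gamma> (\<sigma> t)) /\<^sub>R F (\<gamma> (\<sigma> t))) = gradient V (q0 t)"
      using q0(4,5)[OF t] unfolding DF_def q0(3)[OF t, unfolded q0_def, symmetric] e_def F_def[symmetric]
      by (simp add: q0_def divide_inverse[symmetric] field_simps)
    ultimately show ?thesis by simp
  qed
  have norm\<pi>: "norm (\<pi> t) = F (q0 t)" if "t \<in> I" for t
    unfolding \<pi>_def q0_def using \<sigma> that unfolding I_def by (intro \<pi>0(3)) auto
  have cont_q0: "continuous_on I q0"
    using dq0 by (intro continuous_at_imp_continuous_on ballI has_vector_derivative_continuous)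
  have cont_\<pi>: "continuous_on I \<pi>"
    using d\<pi> by (intro continuous_at_imp_continuous_on ballI has_vector_derivative_continuous)
  have cont_h: "continuous_on UNIV (\<lambda>x. sp (W x))"
    by (rule continuous_on_compose2[OF cont_sp cont_W]) (auto simp: W_nonneg)
  have contQ: "continuous_on I Q"
    unfolding Q_def
  proof (intro continuous_on_scaleR continuous_on_divide cont_\<pi>)
    show "continuous_on I (\<lambda>t. sp (W (q0 t)))" by (rule continuous_on_compose2[OF cont_h cont_q0]) auto
    show "continuous_on I (\<lambda>t. F (q0 t))" by (rule continuous_on_compose2[OF cont_F cont_q0]) auto
  qed (use q0(4) in force)
  obtain r where r: "\<And>z. jdist F x0 z \<le> D \<Longrightarrow> norm z \<le> r" using jdist_bounded[OF far] by blast
  have q0_bdd: "norm (q0 t) \<le> r" if "t \<in> I" for t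
    unfolding q0_def using \<sigma>[of t] that \<gamma>(1)[of "\<sigma> t"] unfolding I_def by (intro r) auto
  obtain C where C: "\<And>x. x \<in> cball 0 r \<Longrightarrow> sp (W x) \<le> C"
  proof -
    have "bounded ((\<lambda>x. sp (W x)) ` cball 0 r)"
      by (intro compact_imp_bounded compact_continuous_image continuous_on_subset[OF cont_h]) auto
    then obtain C where "\<forall>v\<in>(\<lambda>x. sp (W x)) ` cball 0 r. norm v \<le> C" unfolding bounded_iff by blast
    then have "norm (sp (W x)) \<le> C" if "x \<in> cball 0 r" for x using that by blast
    then have "sp (W x) \<le> C" if "x \<in> cball 0 r" for x
      using that order_trans[OF abs_ge_self] unfolding real_norm_def by blast
    then show ?thesis by (rule that)
  qed
  \<comment> \<open>A point at distance 0 from a point of a well lies in the sublevel set, since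
    \<open>jdist\<close> separates points where \<open>F\<close> is positive; it is not in the other
    well because \<open>D > 0\<close>.\<close>
  have zero: "z \<in> S" if S: "S \<in> {Am, Ap}" "b \<in> S" "jdist F b z = 0" for z b S
  proof -
    have "V z \<le> c"
    proof (rule ccontr)
      assume "\<not> V z \<le> c"
      moreover have "V b \<le> c" using S by (auto simp: Am_def Ap_def)
      ultimately have "0 < jdist F z b" by (intro jdist_pos) (auto simp: F_pos_iff)
      then show False using S(3) jdist_sym[of z b] by simp
    qed
    then have "z \<in> Am \<union> Ap" by (rule level)
    then show ?thesis using S D Dmin[of b z] Dmin[of z b] jdist_sym[of z b] by auto
  qed
  have left: "\<exists>T\<in>I. \<forall>t\<in>I. t < T \<longrightarrow> infdist (q0 t) Am < \<eta>" if \<eta>: "0 < \<eta>" for \<eta>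
  proof -
    obtain R1 where "\<And>z. jdist F x0 z \<le> 1 \<Longrightarrow> norm z \<le> R1" using jdist_bounded[OF far] by blast
    then obtain \<delta> where \<delta>: "0 < \<delta>" "\<And>z. jdist F x0 z < \<delta> \<Longrightarrow> infdist z Am < \<eta>"
      using infdist_small_of_jdist[OF xy0(1) zero[OF _ xy0(1)] _ \<eta>] by blast
    obtain T where "T \<in> I" "\<And>t. t \<in> I \<Longrightarrow> t < T \<Longrightarrow> \<sigma> t < \<delta>" using low[OF \<delta>(1)] by blast
    moreover have "jdist F x0 (q0 t) = \<sigma> t" if "t \<in> I" for t
      unfolding q0_def using \<sigma>[of t] that unfolding I_def by (intro \<gamma>(1)) auto
    ultimately show ?thesis using \<delta>(2) by (intro bexI[of _ T]) auto
  qed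
  have right: "\<exists>T\<in>I. \<forall>t\<in>I. T < t \<longrightarrow> infdist (q0 t) Ap < \<eta>" if \<eta>: "0 < \<eta>" for \<eta>
  proof -
    obtain R1 where "\<And>z. jdist F y0 z \<le> 1 \<Longrightarrow> norm z \<le> R1" using jdist_bounded[OF far] by blast
    then obtain \<delta> where \<delta>: "0 < \<delta>" "\<And>z. jdist F y0 z < \<delta> \<Longrightarrow> infdist z Ap < \<eta>"
      using infdist_small_of_jdist[OF xy0(2) zero[OF _ xy0(2)] _ \<eta>] by blast
    obtain T where "T \<in> I" "\<And>t. t \<in> I \<Longrightarrow> T < t \<Longrightarrow> D - \<sigma> t < \<delta>" using high[OF \<delta>(1)] by blast
    moreover have "jdist F y0 (q0 t) = D - \<sigma> t" if "t \<in> I" for t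
      unfolding q0_def jdist_sym[of y0] using \<sigma>[of t] that unfolding I_def by (intro \<gamma>(2)) auto
    ultimately show ?thesis using \<delta>(2) by (intro bexI[of _ T]) auto
  qed
  have "\<exists>q. (\<forall>t\<in>I. q t = q0 t) \<and> (\<forall>t. ereal t \<le> \<alpha> \<longrightarrow> q t \<in> Am) \<and> (\<forall>t. \<omega> \<le> ereal t \<longrightarrow> q t \<in> Ap) \<and>
    (\<forall>t. (q has_vector_derivative (if t \<in> I then Q t else 0)) (at t)) \<and>
    continuous_on UNIV (\<lambda>t. if t \<in> I then Q t else 0) \<and> (\<forall>t. \<exists>s\<in>closure I. q t = q s)"
    unfolding I_def
  proof (rule C1_extension[OF lt, where h = "\<lambda>x. sp (W x)" and C = C])
    fix t assume "t \<in> einterval \<alpha> \<omega>"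
    then have t: "t \<in> I" by (simp add: I_def)
    show "(q0 has_vector_derivative Q t) (at t)" by (rule dq0[OF t])
    show "norm (Q t) = sp (W (q0 t))" using q0(4,5)[OF t] by (simp add: Q_def norm\<pi>[OF t])
    show "sp (W (q0 t)) \<le> C" using q0_bdd[OF t] by (intro C) simp
  next
    show "x \<in> Am \<union> Ap \<Longrightarrow> sp (W x) = 0" for x by (auto simp: Am_def Ap_def W_def max_absorb1)
  qed (use contQ cont_h left right Am Ap in \<open>auto simp: I_def compact_imp_closed\<close>)
  then obtain q where q: "\<And>t. t \<in> I \<Longrightarrow> q t = q0 t" "\<And>t. ereal t \<le> \<alpha> \<Longrightarrow> q t \<in> Am" "\<And>t. \<omega> \<le> ereal t \<Longrightarrow> q t \<in> Ap"
    "\<And>t. (q has_vector_derivative (if t \<in> I then Q t else 0)) (at t)"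
    "continuous_on UNIV (\<lambda>t. if t \<in> I then Q t else 0)" "\<And>t. \<exists>s\<in>closure I. q t = q s"
    by blast
  define R where "R t = (if t \<in> I then Q t else 0)" for t
  have cont_q: "continuous_on UNIV q"
    by (intro continuous_at_imp_continuous_on ballI has_vector_derivative_continuous[OF q(4)])
  \<comment> \<open>Beyond the ends only membership in a well is known, hence
    \<open>V \<le> c\<close>. The opposite inequality holds on the closure of \<open>I\<close>, and
    every value of \<open>q\<close> is attained there.\<close>
  have Vq: "c \<le> V (q t)" for t
  proof -
    have "continuous_on UNIV (\<lambda>t. V (q t))" by (rule continuous_on_compose2[OF cont_V[of UNIV] cont_q]) auto
    then have "closed {t. c \<le> V (q t)}" by (intro closed_Collect_le continuous_on_const)
    moreover have "I \<subseteq> {t. c \<le> V (q t)}" using q(1) q0(1) by (auto simp: U_def less_imp_le)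
    ultimately have "closure I \<subseteq> {t. c \<le> V (q t)}" by (intro closure_minimal)
    then show ?thesis using q(6)[of t] by force
  qed
  have outside: "ereal t \<le> \<alpha> \<or> \<omega> \<le> ereal t" if "t \<notin> I" for t
    using that by (auto simp: I_def einterval_iff not_less)
  have conn: "connection \<phi> l V am ap rbar cstar c \<alpha> \<omega> D \<sigma> q R \<pi>"
  proof unfold_locales
    show "\<alpha> < \<omega>" by (rule lt)
    show "0 \<le> D" using D by simp
    show "x \<in> Am \<Longrightarrow> y \<in> Ap \<Longrightarrow> D \<le> jdist F x y" for x y by (rule Dmin)
    show "((\<sigma> \<circ> real_of_ereal) \<longlongrightarrow> 0) (at_right \<alpha>)"
    proof (rule tendstoI)
      fix \<eta> :: real assume "0 < \<eta>"
      then obtain T where T: "T \<in> I" "\<And>t. t \<in> I \<Longrightarrow> t < T \<Longrightarrow> \<sigma> t < \<eta>" using low by blast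
      have "dist ((\<sigma> \<circ> real_of_ereal) z) 0 < \<eta>" if z: "\<alpha> < z" "z < ereal T" for z
      proof -
        obtain t where t: "z = ereal t" using z by (cases z) auto
        have "ereal t < \<omega>" using z(2) T(1) less_trans unfolding t I_def einterval_iff by blast
        then have "t \<in> I" using z(1) by (simp add: t I_def einterval_iff)
        then show ?thesis using T(2)[of t] \<sigma>[of t] z(2) by (simp add: t I_def dist_real_def)
      qed
      moreover have "\<alpha> < ereal T" using T(1) by (simp add: I_def einterval_iff)
      ultimately show "\<forall>\<^sub>F z in at_right \<alpha>. dist ((\<sigma> \<circ> real_of_ereal) z) 0 < \<eta>"
        unfolding eventually_at_right[OF lt] by blast
    qed
    show "((\<sigma> \<circ> real_of_ereal) \<longlongrightarrow> D) (at_left \<omega>)"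
    proof (rule tendstoI)
      fix \<eta> :: real assume "0 < \<eta>"
      then obtain T where T: "T \<in> I" "\<And>t. t \<in> I \<Longrightarrow> T < t \<Longrightarrow> D - \<sigma> t < \<eta>" using high by blast
      have "dist ((\<sigma> \<circ> real_of_ereal) z) D < \<eta>" if z: "ereal T < z" "z < \<omega>" for z
      proof -
        obtain t where t: "z = ereal t" using z by (cases z) auto
        have "\<alpha> < ereal t" using z(1) T(1) less_trans unfolding t I_def einterval_iff by blast
        then have "t \<in> I" using z(2) by (simp add: t I_def einterval_iff)
        then show ?thesis using T(2)[of t] \<sigma>[of t] z(1) by (simp add: t I_def dist_real_def)
      qed
      moreover have "ereal T < \<omega>" using T(1) by (simp add: I_def einterval_iff)
      ultimately show "\<forall>\<^sub>F z in at_left \<omega>. dist ((\<sigma> \<circ> real_of_ereal) z) D < \<eta>"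
        unfolding eventually_at_left[OF lt] by blast
    qed
    show "(q has_vector_derivative R t) (at t)" for t unfolding R_def by (rule q(4))
    show "continuous_on UNIV R" unfolding R_def by (rule q(5))
    show "R t = 0 \<and> V (q t) = c" if "t \<notin> einterval \<alpha> \<omega>" for t
    proof
      have t: "t \<notin> I" using that by (simp add: I_def)
      then show "R t = 0" by (simp add: R_def)
      have "V (q t) \<le> c" using outside[OF t] q(2,3) by (auto simp: Am_def Ap_def)
      then show "V (q t) = c" using Vq[of t] by simp
    qed
    show "bounded (q ` einterval \<alpha> \<omega>)" using q(1) q0_bdd unfolding I_def by (auto simp: bounded_iff)
    show "\<exists>T\<in>einterval \<alpha> \<omega>. \<forall>t<T. infdist (q t) Am < \<eta>" if \<eta>: "0 < \<eta>" for \<eta>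
    proof -
      obtain T where T: "T \<in> I" "\<And>t. t \<in> I \<Longrightarrow> t < T \<Longrightarrow> infdist (q0 t) Am < \<eta>" using left[OF \<eta>] by blast
      have "infdist (q t) Am < \<eta>" if "t < T" for t
      proof (cases "t \<in> I")
        case False
        have "ereal t < \<omega>" using that T(1) unfolding I_def einterval_iff by (meson less_ereal.simps(1) less_trans)
        then have "q t \<in> Am" using outside[OF False] q(2) by auto
        then show ?thesis using \<eta> by simp
      qed (use T that q(1) in simp)
      then show ?thesis using T(1) unfolding I_def by blast
    qed
    show "\<exists>T\<in>einterval \<alpha> \<omega>. \<forall>t>T. infdist (q t) Ap < \<eta>" if \<eta>: "0 < \<eta>" for \<eta>
    proof -
      obtain T where T: "T \<in> I" "\<And>t. t \<in> I \<Longrightarrow> T < t \<Longrightarrow> infdist (q0 t) Ap < \<eta>" using right[OF \<eta>] by blast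
      have "infdist (q t) Ap < \<eta>" if "T < t" for t
      proof (cases "t \<in> I")
        case False
        have "\<alpha> < ereal t" using that T(1) unfolding I_def einterval_iff by (meson less_ereal.simps(1) less_trans)
        then have "q t \<in> Ap" using outside[OF False] q(3) by auto
        then show ?thesis using \<eta> by simp
      qed (use T that q(1) in simp)
      then show ?thesis using T(1) unfolding I_def by blast
    qed
  next
    fix t assume "t \<in> einterval \<alpha> \<omega>"
    then have t: "t \<in> I" by (simp add: I_def)
    have qt: "q t = q0 t" by (rule q(1)[OF t])
    show "(\<sigma> has_real_derivative Kw (W (q t)) * sp (W (q t))) (at t)"
      using d\<sigma>[of t] t by (simp add: I_def qt e_def q0_def)
    show "q t \<in> U" "(\<pi> has_vector_derivative gradient V (q t)) (at t)" "norm (\<pi> t) = F (q t)"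
      unfolding qt by (rule q0(1)[OF t] d\<pi>[OF t] norm\<pi>[OF t])+
    show "R t = (sp (W (q t)) / F (q t)) *\<^sub>R \<pi> t" using t by (simp add: R_def qt Q_def)
  qed
  then show ?thesis by blast
qed

end

theorem proposition4p3:
  fixes \<phi> :: "real \<Rightarrow> real" and l m :: real
    and V :: "real ^ 'n \<Rightarrow> real" and a_minus a_plus :: "real ^ 'n"
    and rbar cstar :: real
  assumes "\<And>s. s > 0 \<Longrightarrow> \<phi> s > 0"
    and "\<phi> C1_differentiable_on {0<..}"
    and "1 < l" and "l \<le> m"
    and "\<And>s. s > 0 \<Longrightarrow> deriv (\<lambda>r. \<phi> r * r) s > 0"
    and "\<And>s. s > 0 \<Longrightarrow> l - 1 \<le> deriv (\<lambda>r. \<phi> r * r) s / \<phi> s"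
    and "\<And>s. s > 0 \<Longrightarrow> deriv (\<lambda>r. \<phi> r * r) s / \<phi> s \<le> m - 1"
    and "C1_scalar_field V"
    and "a_minus \<noteq> a_plus"
    and "V a_minus = 0" and "V a_plus = 0"
    and "\<And>x. x \<notin> {a_minus, a_plus} \<Longrightarrow> V x > 0"
    and "Liminf at_infinity (\<lambda>x. ereal (V x)) > 0"
    and "rbar = norm (a_minus - a_plus) / 2"
    and "cstar = Inf (V ` (UNIV - (ball a_minus rbar \<union> ball a_plus rbar)))"
  shows "\<forall>c\<in>{0..<cstar}. \<exists>\<alpha> \<omega> :: ereal. \<exists>q :: real \<Rightarrow> real ^ 'n. \<alpha> < \<omega> \<and>
     minimal_connection \<phi> V c
       ({x. V x \<le> c} \<inter> ball a_minus rbar) ({x. V x \<le> c} \<inter> ball a_plus rbar) \<alpha> \<omega> q \<and>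
     C2_curve_on (einterval \<alpha> \<omega>) q \<and> C1_curve_on (closure (einterval \<alpha> \<omega>)) q \<and>
     solves_EL \<phi> V (einterval \<alpha> \<omega>) q \<and>
     (\<forall>t\<in>einterval \<alpha> \<omega>. energy \<phi> V q t = - c)"
proof
  fix c assume c: "c \<in> {0..<cstar}"
  have V_nonneg: "0 \<le> V x" for x
    using assms(10-12) by (cases "x \<in> {a_minus, a_plus}") (auto intro: less_imp_le)
  interpret double_well \<phi> l V a_minus a_plus rbar cstar c
  proof
    show "dist a_minus a_plus = 2 * rbar" by (simp add: dist_norm assms(14))
    \<comment> \<open>The infimum is a lower bound because \<open>V\<close> is nonnegative, so the
      image is bounded below.\<close>
    show "cstar \<le> V x" if "x \<notin> ball a_minus rbar" "x \<notin> ball a_plus rbar" for x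
      unfolding assms(15) using that V_nonneg by (intro cInf_lower) (auto simp: bdd_below_def)
  qed (use assms c in auto)
  obtain \<alpha> \<omega> :: ereal and D \<sigma> q R \<pi>
    where "connection \<phi> l V a_minus a_plus rbar cstar c \<alpha> \<omega> D \<sigma> q R \<pi>"
    using connection_exists by blast
  then interpret connection \<phi> l V a_minus a_plus rbar cstar c \<alpha> \<omega> D \<sigma> q R \<pi> .
  show "\<exists>\<alpha> \<omega> :: ereal. \<exists>q :: real \<Rightarrow> real ^ 'n. \<alpha> < \<omega> \<and>
     minimal_connection \<phi> V c
       ({x. V x \<le> c} \<inter> ball a_minus rbar) ({x. V x \<le> c} \<inter> ball a_plus rbar) \<alpha> \<omega> q \<and>
     C2_curve_on (einterval \<alpha> \<omega>) q \<and> C1_curve_on (closure (einterval \<alpha> \<omega>)) q \<and>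
     solves_EL \<phi> V (einterval \<alpha> \<omega>) q \<and>
     (\<forall>t\<in>einterval \<alpha> \<omega>. energy \<phi> V q t = - c)"
    using lt minimal C2_curve C1_curve solves energy_eq unfolding Am_def Ap_def by blast
qed

end
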